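(* Let $v_1, v_2 \in W_e$ be such that $v_1 \cdot w_0$ and $w_0 \cdot v_2$ are reduced factorizations. If $v_1$ is primitive, then in $\mathscr{H}(W_e)$ $$C'_{v_1 w_0 v_2} = \overleftarrow{C}'_{v_1}\, C'_{w_0}\, \overrightarrow{C}'_{v_2}.$$
   Context: **Root data and extended affine Weyl group.** Write $[n]=\{1,\dots,n\}$. Let $G$ be a simply connected semisimple algebraic group over $\mathbb{C}$ with irreducible root system $(Y,\alpha'_i,\alpha'^\vee_i)$, $i\in[n]$: $Y$ is the (weight) lattice, $Y^\vee=\mathrm{Hom}(Y,\mathbb{Z})$, $\alpha'_i\in Y$ are the simple roots, $\alpha'^\vee_i\in Y^\vee$ the simple coroots; simple connectedness means that the fundamental weights $\varpi_i$ (with $\langle\varpi_i,\alpha'^\vee_j\rangle=\delta_{ij}$) form a $\mathbb{Z}$-basis of $Y$. Let $W_f$ be the finite Weyl group, $S_f=\{s_1,\dots,s_n\}$ its simple reflections, $w_0$ its longest element, $R_f'^\vee=R'^\vee_{f+}\sqcup R'^\vee_{f-}\subset Y^\vee$ the positive and negative coroots. The extended affine Weyl group is $W_e=Y\rtimes W_f$, with the elements of $Y$ written $y^\lambda$. Let $X=Y^\vee\oplus\mathbb{Z}\delta$. $W_e$ acts on $X$: $W_f$ acts as usual on $Y^\vee$ and fixes $\delta$, and $y^\lambda(x)=x-\langle x,\lambda\rangle\delta$, where $\langle\cdot,\cdot\rangle$ extends the pairing of $Y^\vee$ and $Y$ by $\langle\delta,Y\rangle=0$. Put $\alpha_i=\alpha'^\vee_i$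 for $i\in[n]$ and $\alpha_0=\delta-\theta$, where $\phi'$ is the dominant short root of the finite root system and $\theta=\phi'^\vee$ is the highest coroot; $s_0=y^{\phi'}s_{\phi'}$. Put $R=R_f'^\vee+\mathbb{Z}\delta$, $R_+=(R_f'^\vee+\mathbb{Z}_{>0}\delta)\cup R'^\vee_{f+}$, $R_-=-R_+$. Let $W_a$ be the affine Weyl group generated by $s_0,\dots,s_n$, and $\Pi=\{w\in W_e:w(R_+)=R_+\}$; then $W_e=\Pi\ltimes W_a$. Length: $\ell(w)=|R_-\cap w(R_+)|$, so $\ell(\pi v)=\ell(v)$ for $\pi\in\Pi$, $v\in W_a$. Bruhat order: $\pi v\le\pi'v'$ iff $\pi=\pi'$ and $v\le v'$ in $W_a$. A product $uv$ is a reduced factorization, written $u\cdot v$, if $\ell(uv)=\ell(u)+\ell(v)$. **Primitive elements.** $w\in W_e$ is primitive if $w(\alpha_i)\in(R'^\vee_{f-}+\delta)\cup R'^\vee_{f+}$ for all $i\in[n]$. **Hecke algebra.** $A=\mathbb{Z}[q^{1/2},q^{-1/2}]$, $A^-=\mathbb{Z}[q^{-1/2}]$. $\mathscr{H}(W_e)$ is the free $A$-module with basis $T_w$ ($w\in W_e$), with $T_uT_v=T_{uv}$ if $uv=u\cdot v$ is reduced, and $(T_s-q^{1/2})(T_s+q^{-1/2})=0$ for $s\in\{s_0,\dots,s_n\}$. The bar involution is the ring involution with $\overline{q^{1/2}}=q^{-1/2}$, $\overline{T_w}=T_{w^{-1}}^{-1}$. With $\mathscr{L}=A^-\langle T_w:w\in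 W_e\rangle$, $C'_w$ is the unique bar-invariant element congruent to $T_w$ modulo $q^{-1/2}\mathscr{L}$. Write $C'_w=\sum_xP'_{x,w}T_x$. If $v\cdot w_0$ is reduced, put $\overleftarrow{C}'_v=\sum_xP'_{xw_0,vw_0}T_x$, summed over $x\le v$ with $x\cdot w_0$ reduced. If $w_0\cdot v$ is reduced, put $\overrightarrow{C}'_v=\sum_xP'_{w_0x,w_0v}T_x$, summed over $x\le v$ with $w_0\cdot x$ reduced. *)

theory Defs
  imports
    "HOL-Algebra.Generated_Groups"
    "HOL-Algebra.Bij"
    "HOL-Algebra.Ring"
    "HOL-Library.Poly_Mapping"
    "HOL-Library.Product_Plus"
    "HOL-Library.FuncSet"
begin

section \<open>Root data\<close>

text \<open>The lattice \<open>Y\<close> is the whole type \<^typ>\<open>'y\<close>; elements of \<open>Hom(Y, \<int>)\<close> are additive functions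
  \<^typ>\<open>'y \<Rightarrow> int\<close>, so the pairing of a coweight \<open>x\<close> with \<open>\<lambda>\<close> is \<open>x \<lambda>\<close>.
  Simple roots and coroots are indexed by \<open>{1..rank D}\<close>.\<close>

record 'y root_datum =
  rank :: nat
  simple_root :: "nat \<Rightarrow> 'y"
  simple_coroot :: "nat \<Rightarrow> 'y \<Rightarrow> int"

definition int_mult :: "int \<Rightarrow> 'y::ab_group_add \<Rightarrow> 'y" where
  "int_mult k y = (\<Sum>i<nat k. y) - (\<Sum>i<nat (- k). y)"

definition reflection :: "'y::ab_group_add \<Rightarrow> ('y \<Rightarrow> int) \<Rightarrow> 'y \<Rightarrow> 'y" where
  "reflection a c = (\<lambda>y. y - int_mult (c y) a)"

definition simple_refl :: "'y::ab_group_add root_datum \<Rightarrow> nat \<Rightarrow> 'y \<Rightarrow> 'y" where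
  "simple_refl D i = reflection (simple_root D i) (simple_coroot D i)"

definition finite_weyl :: "'y::ab_group_add root_datum \<Rightarrow> ('y \<Rightarrow> 'y) set" where
  "finite_weyl D = generate (BijGroup UNIV) (simple_refl D ` {1..rank D})"

definition coaction :: "('y \<Rightarrow> 'y) \<Rightarrow> ('y \<Rightarrow> int) \<Rightarrow> 'y \<Rightarrow> int" where
  "coaction w x = (\<lambda>y. x (inv_into UNIV w y))"

text \<open>A finite root system in terms of simple roots and coroots: the integers
  \<open>\<langle>\<alpha>\<^sub>j, \<alpha>\<^sub>i\<^sup>\<or>\<rangle>\<close> form a generalized Cartan matrix and the Weyl group is finite.\<close>

definition finite_root_datum :: "'y::ab_group_add root_datum \<Rightarrow> bool" where
  "finite_root_datum D \<longleftrightarrow>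
     (\<forall>i\<in>{1..rank D}. \<forall>y z. simple_coroot D i (y + z) = simple_coroot D i y + simple_coroot D i z) \<and>
     (\<forall>i\<in>{1..rank D}. simple_coroot D i (simple_root D i) = 2) \<and>
     (\<forall>i\<in>{1..rank D}. \<forall>j\<in>{1..rank D}. i \<noteq> j \<longrightarrow>
        simple_coroot D i (simple_root D j) \<le> 0 \<and>
        (simple_coroot D i (simple_root D j) = 0 \<longleftrightarrow> simple_coroot D j (simple_root D i) = 0)) \<and>
     finite (finite_weyl D)"

definition irreducible_datum :: "'y root_datum \<Rightarrow> bool" where
  "irreducible_datum D \<longleftrightarrow> 1 \<le> rank D \<and>
     (\<forall>J\<subseteq>{1..rank D}. J \<noteq> {} \<longrightarrow> J \<noteq> {1..rank D} \<longrightarrow>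
        (\<exists>i\<in>J. \<exists>j\<in>{1..rank D} - J. simple_coroot D i (simple_root D j) \<noteq> 0))"

text \<open>The fundamental weights exist in \<open>Y\<close> and form a \<open>\<int>\<close>-basis of it; in particular \<open>Y\<close> is free
  of rank \<open>rank D\<close>.\<close>

definition simply_connected :: "'y::ab_group_add root_datum \<Rightarrow> bool" where
  "simply_connected D \<longleftrightarrow> (\<exists>\<omega> :: nat \<Rightarrow> 'y.
     (\<forall>i\<in>{1..rank D}. \<forall>j\<in>{1..rank D}. simple_coroot D j (\<omega> i) = (if i = j then 1 else 0)) \<and>
     (\<forall>y. \<exists>!c. c \<in> {1..rank D} \<rightarrow>\<^sub>E (UNIV :: int set) \<and> y = (\<Sum>i\<in>{1..rank D}. int_mult (c i) (\<omega> i))))"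

definition roots :: "'y::ab_group_add root_datum \<Rightarrow> 'y set" where
  "roots D = {w (simple_root D i) | w i. w \<in> finite_weyl D \<and> i \<in> {1..rank D}}"

definition coroots :: "'y::ab_group_add root_datum \<Rightarrow> ('y \<Rightarrow> int) set" where
  "coroots D = {coaction w (simple_coroot D i) | w i. w \<in> finite_weyl D \<and> i \<in> {1..rank D}}"

definition pos_coroots :: "'y::ab_group_add root_datum \<Rightarrow> ('y \<Rightarrow> int) set" where
  "pos_coroots D = {x \<in> coroots D. \<exists>c :: nat \<Rightarrow> nat.
     x = (\<lambda>y. \<Sum>i\<in>{1..rank D}. int (c i) * simple_coroot D i y)}"

definition neg_coroots :: "'y::ab_group_add root_datum \<Rightarrow> ('y \<Rightarrow> int) set" where
  "neg_coroots D = uminus ` pos_coroots D"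

definition coroot_of :: "'y::ab_group_add root_datum \<Rightarrow> 'y \<Rightarrow> 'y \<Rightarrow> int" where
  "coroot_of D a = (THE x. \<exists>w\<in>finite_weyl D. \<exists>i\<in>{1..rank D}.
     a = w (simple_root D i) \<and> x = coaction w (simple_coroot D i))"

text \<open>Root lengths are measured by the Weyl group invariant form
  \<open>(y, z) = (\<Sum>x\<in>coroots D. x y * x z)\<close>; for an irreducible datum all invariant forms are
  proportional, and if all roots have the same length then all of them count as short.\<close>

definition sq_length :: "'y::ab_group_add root_datum \<Rightarrow> 'y \<Rightarrow> int" where
  "sq_length D y = (\<Sum>x\<in>coroots D. (x y)\<^sup>2)"

definition dominant_short_root :: "'y::ab_group_add root_datum \<Rightarrow> 'y" where
  "dominant_short_root D = (THE a. a \<in> roots D \<and>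
     (\<forall>i\<in>{1..rank D}. 0 \<le> simple_coroot D i a) \<and>
     (\<forall>b\<in>roots D. sq_length D a \<le> sq_length D b))"

definition theta :: "'y::ab_group_add root_datum \<Rightarrow> 'y \<Rightarrow> int" where
  "theta D = coroot_of D (dominant_short_root D)"

section \<open>The extended affine Weyl group\<close>

text \<open>The pair \<open>(\<lambda>, w)\<close> stands for \<open>y\<^sup>\<lambda> w\<close>.\<close>

type_synonym 'y weyl_elt = "'y \<times> ('y \<Rightarrow> 'y)"

definition ext_weyl :: "'y::ab_group_add root_datum \<Rightarrow> 'y weyl_elt monoid" where
  "ext_weyl D = \<lparr>carrier = UNIV \<times> finite_weyl D,
     monoid.mult = (\<lambda>(l, w) (m, v). (l + w m, w \<circ> v)),
     one = (0, id)\<rparr>"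

text \<open>The pair \<open>(x, k)\<close> stands for \<open>x + k \<delta>\<close> in \<open>X = Y\<^sup>\<or> \<oplus> \<int>\<delta>\<close>.\<close>

type_synonym 'y affine_coweight = "('y \<Rightarrow> int) \<times> int"

definition affine_action :: "'y weyl_elt \<Rightarrow> 'y affine_coweight \<Rightarrow> 'y affine_coweight" where
  "affine_action = (\<lambda>(l, w) (x, k). (coaction w x, k - coaction w x l))"

definition affine_simple_root :: "'y::ab_group_add root_datum \<Rightarrow> nat \<Rightarrow> 'y affine_coweight" where
  "affine_simple_root D i = (if i = 0 then (- theta D, 1) else (simple_coroot D i, 0))"

definition affine_simple_refl :: "'y::ab_group_add root_datum \<Rightarrow> nat \<Rightarrow> 'y weyl_elt" where
  "affine_simple_refl D i =
     (if i = 0 then (dominant_short_root D, reflection (dominant_short_root D) (theta D))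
      else (0, simple_refl D i))"

definition affine_pos_roots :: "'y::ab_group_add root_datum \<Rightarrow> 'y affine_coweight set" where
  "affine_pos_roots D = coroots D \<times> {k. 0 < k} \<union> pos_coroots D \<times> {0}"

definition affine_neg_roots :: "'y::ab_group_add root_datum \<Rightarrow> 'y affine_coweight set" where
  "affine_neg_roots D = uminus ` affine_pos_roots D"

definition affine_weyl :: "'y::ab_group_add root_datum \<Rightarrow> 'y weyl_elt set" where
  "affine_weyl D = generate (ext_weyl D) (affine_simple_refl D ` {0..rank D})"

definition length_zero_group :: "'y::ab_group_add root_datum \<Rightarrow> 'y weyl_elt set" where
  "length_zero_group D =
     {w \<in> carrier (ext_weyl D). affine_action w ` affine_pos_roots D = affine_pos_roots D}"

definition weyl_length :: "'y::ab_group_add root_datum \<Rightarrow> 'y weyl_elt \<Rightarrow> nat" where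
  "weyl_length D w = card (affine_neg_roots D \<inter> affine_action w ` affine_pos_roots D)"

definition reduced_product :: "'y::ab_group_add root_datum \<Rightarrow> 'y weyl_elt \<Rightarrow> 'y weyl_elt \<Rightarrow> bool" where
  "reduced_product D u v \<longleftrightarrow>
     weyl_length D (u \<otimes>\<^bsub>ext_weyl D\<^esub> v) = weyl_length D u + weyl_length D v"

definition affine_reflections :: "'y::ab_group_add root_datum \<Rightarrow> 'y weyl_elt set" where
  "affine_reflections D =
     {w \<otimes>\<^bsub>ext_weyl D\<^esub> affine_simple_refl D i \<otimes>\<^bsub>ext_weyl D\<^esub> inv\<^bsub>ext_weyl D\<^esub> w
       | w i. w \<in> affine_weyl D \<and> i \<in> {0..rank D}}"

definition bruhat_affine :: "'y::ab_group_add root_datum \<Rightarrow> 'y weyl_elt \<Rightarrow> 'y weyl_elt \<Rightarrow> bool" where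
  "bruhat_affine D u v \<longleftrightarrow> u \<in> affine_weyl D \<and>
     (u, v) \<in> {(x, x \<otimes>\<^bsub>ext_weyl D\<^esub> t) | x t. x \<in> affine_weyl D \<and> t \<in> affine_reflections D \<and>
                 weyl_length D x < weyl_length D (x \<otimes>\<^bsub>ext_weyl D\<^esub> t)}\<^sup>*"

definition bruhat_le :: "'y::ab_group_add root_datum \<Rightarrow> 'y weyl_elt \<Rightarrow> 'y weyl_elt \<Rightarrow> bool" where
  "bruhat_le D x y \<longleftrightarrow> (\<exists>p\<in>length_zero_group D. \<exists>u v. bruhat_affine D u v \<and>
     x = p \<otimes>\<^bsub>ext_weyl D\<^esub> u \<and> y = p \<otimes>\<^bsub>ext_weyl D\<^esub> v)"

definition longest_elt :: "'y::ab_group_add root_datum \<Rightarrow> 'y weyl_elt" where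
  "longest_elt D = (THE w. w \<in> {0} \<times> finite_weyl D \<and>
     (\<forall>u \<in> {0} \<times> finite_weyl D. weyl_length D u \<le> weyl_length D w))"

definition primitive_elt :: "'y::ab_group_add root_datum \<Rightarrow> 'y weyl_elt \<Rightarrow> bool" where
  "primitive_elt D w \<longleftrightarrow> w \<in> carrier (ext_weyl D) \<and>
     (\<forall>i\<in>{1..rank D}. affine_action w (affine_simple_root D i)
        \<in> neg_coroots D \<times> {1} \<union> pos_coroots D \<times> {0})"

section \<open>The Hecke algebra\<close>

text \<open>Laurent polynomials in \<open>q\<^bsup>1/2\<^esup>\<close> over \<open>\<int>\<close>, as the group ring of \<open>\<int>\<close>; exponents count powers of
  \<open>q\<^bsup>1/2\<^esup>\<close>.\<close>

type_synonym laurent = "int \<Rightarrow>\<^sub>0 int"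

definition qhalf :: "int \<Rightarrow> laurent" where
  "qhalf k = Poly_Mapping.single k 1"

definition laurent_bar :: "laurent \<Rightarrow> laurent" where
  "laurent_bar a = Poly_Mapping.map_key uminus a"

definition laurent_minus :: "laurent set" where
  "laurent_minus = {a. Poly_Mapping.keys a \<subseteq> {..0}}"

text \<open>Elements of the free module on \<open>T\<^sub>w\<close> are finitely supported coefficient functions
  \<open>w \<mapsto>\<close> coefficient of \<open>T\<^sub>w\<close>.\<close>

type_synonym 'y hecke_elt = "'y weyl_elt \<Rightarrow>\<^sub>0 laurent"

definition T :: "'y weyl_elt \<Rightarrow> 'y hecke_elt" where
  "T w = Poly_Mapping.single w 1"

definition smul :: "laurent \<Rightarrow> 'y hecke_elt \<Rightarrow> 'y hecke_elt" (infixr "\<odot>\<^sub>A" 75) where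
  "a \<odot>\<^sub>A h = Poly_Mapping.map ((*) a) h"

text \<open>\<open>H\<close> is the Hecke algebra: an \<open>A\<close>-algebra structure on the free module on \<open>{T\<^sub>w}\<close> satisfying the
  defining relations. These determine the multiplication of \<open>H\<close> on its carrier.\<close>

definition hecke_algebra :: "'y::ab_group_add root_datum \<Rightarrow> 'y hecke_elt ring \<Rightarrow> bool" where
  "hecke_algebra D H \<longleftrightarrow> ring H \<and>
     carrier H = {h. Poly_Mapping.keys h \<subseteq> carrier (ext_weyl D)} \<and>
     \<zero>\<^bsub>H\<^esub> = 0 \<and>
     (\<forall>g\<in>carrier H. \<forall>h\<in>carrier H. g \<oplus>\<^bsub>H\<^esub> h = g + h) \<and>
     (\<forall>a. \<forall>g\<in>carrier H. \<forall>h\<in>carrier H.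
        (a \<odot>\<^sub>A g) \<otimes>\<^bsub>H\<^esub> h = a \<odot>\<^sub>A (g \<otimes>\<^bsub>H\<^esub> h) \<and> g \<otimes>\<^bsub>H\<^esub> (a \<odot>\<^sub>A h) = a \<odot>\<^sub>A (g \<otimes>\<^bsub>H\<^esub> h)) \<and>
     (\<forall>u\<in>carrier (ext_weyl D). \<forall>v\<in>carrier (ext_weyl D). reduced_product D u v \<longrightarrow>
        T u \<otimes>\<^bsub>H\<^esub> T v = T (u \<otimes>\<^bsub>ext_weyl D\<^esub> v)) \<and>
     (\<forall>i\<in>{0..rank D}.
        (T (affine_simple_refl D i) - qhalf 1 \<odot>\<^sub>A \<one>\<^bsub>H\<^esub>) \<otimes>\<^bsub>H\<^esub>
        (T (affine_simple_refl D i) + qhalf (-1) \<odot>\<^sub>A \<one>\<^bsub>H\<^esub>) = 0)"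

text \<open>The bar involution is determined by its semilinearity and its values on the basis.\<close>

definition hecke_bar ::
    "'y::ab_group_add root_datum \<Rightarrow> 'y hecke_elt ring \<Rightarrow> 'y hecke_elt \<Rightarrow> 'y hecke_elt" where
  "hecke_bar D H h = (\<Sum>w\<in>Poly_Mapping.keys h.
     laurent_bar (Poly_Mapping.lookup h w) \<odot>\<^sub>A inv\<^bsub>H\<^esub> (T (inv\<^bsub>ext_weyl D\<^esub> w)))"

definition hecke_lattice :: "'y::ab_group_add root_datum \<Rightarrow> 'y hecke_elt set" where
  "hecke_lattice D = {h. Poly_Mapping.keys h \<subseteq> carrier (ext_weyl D) \<and>
     (\<forall>w. Poly_Mapping.lookup h w \<in> laurent_minus)}"

definition KL :: "'y::ab_group_add root_datum \<Rightarrow> 'y hecke_elt ring \<Rightarrow> 'y weyl_elt \<Rightarrow> 'y hecke_elt" where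
  "KL D H w = (THE h. h \<in> carrier H \<and> hecke_bar D H h = h \<and>
     h - T w \<in> (\<lambda>g. qhalf (-1) \<odot>\<^sub>A g) ` hecke_lattice D)"

definition KL_coeff ::
    "'y::ab_group_add root_datum \<Rightarrow> 'y hecke_elt ring \<Rightarrow> 'y weyl_elt \<Rightarrow> 'y weyl_elt \<Rightarrow> laurent" where
  "KL_coeff D H x w = Poly_Mapping.lookup (KL D H w) x"

definition KL_left :: "'y::ab_group_add root_datum \<Rightarrow> 'y hecke_elt ring \<Rightarrow> 'y weyl_elt \<Rightarrow> 'y hecke_elt" where
  "KL_left D H v = (let w0 = longest_elt D in
     \<Sum>x\<in>{x. bruhat_le D x v \<and> reduced_product D x w0}.
       KL_coeff D H (x \<otimes>\<^bsub>ext_weyl D\<^esub> w0) (v \<otimes>\<^bsub>ext_weyl D\<^esub> w0) \<odot>\<^sub>A T x)"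

definition KL_right :: "'y::ab_group_add root_datum \<Rightarrow> 'y hecke_elt ring \<Rightarrow> 'y weyl_elt \<Rightarrow> 'y hecke_elt" where
  "KL_right D H v = (let w0 = longest_elt D in
     \<Sum>x\<in>{x. bruhat_le D x v \<and> reduced_product D w0 x}.
       KL_coeff D H (w0 \<otimes>\<^bsub>ext_weyl D\<^esub> x) (w0 \<otimes>\<^bsub>ext_weyl D\<^esub> v) \<odot>\<^sub>A T x)"

end

theory Submission
  imports Defs "HOL.Modules"
begin

text \<open>Multiplying by \<open>C'\<^sub>w\<^sub>0\<close> turns the two parabolic factors into Kazhdan-Lusztig elements of \<open>v\<^sub>1 w\<^sub>0\<close>
  and \<open>w\<^sub>0 v\<^sub>2\<close>, so the triple product is bar-invariant; it remains to see that it is congruent to the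
  basis element of \<open>v\<^sub>1 w\<^sub>0 v\<^sub>2\<close>. Expanding the middle factor over \<open>u \<in> W\<^sub>f\<close> produces products
  \<open>T\<^sub>x T\<^sub>u\<^sub>z\<close> with coefficient of degree \<open>\<ell>(u) - \<ell>(w\<^sub>0)\<close>. The degree of such a product is at most the
  number of finite parts of affine roots inverted both by \<open>x\<close> and by \<open>(u z)\<^sup>-\<^sup>1\<close>. When \<open>x w\<^sub>0\<close> and
  \<open>w\<^sub>0 z\<close> are reduced, these finite parts are of the form \<open>- \<beta>\<close> with \<open>\<beta>\<close> and \<open>u\<^sup>-\<^sup>1 \<beta>\<close> positive, so there
  are at most \<open>\<ell>(w\<^sub>0) - \<ell>(u)\<close> of them and every summand lies in the lattice. If \<open>x\<close> is primitive, no
  simple coroot occurs as \<open>\<beta>\<close>, which makes the inequality strict for \<open>u \<noteq> w\<^sub>0\<close>.\<close>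

section \<open>Finite root systems\<close>

text \<open>Only a Cartan matrix with finite Weyl group is given, W_e is not itself a Coxeter group,
  and the dominant short root, \<open>longest_elt\<close> and \<open>KL\<close> are definite
  descriptions, so existence and uniqueness have to be established for each of them. Positivity is
  turned into integer arithmetic: an affine root is evaluated at the point rho / h inside the
  fundamental alcove, h being the Coxeter number, and the value is scaled by h. Inversions become
  sign conditions, a simple descent exists as soon as there is an inversion, and inductions on
  length start from all elements of length zero. The degree bound is an induction on the left
  factor: each use of the quadratic relation costs one degree, and it is paid for by a direction
  that disappears from the common inversions. The parabolic elements are built inside the left ideal
  generated by C'_w0. Right multiplication by C'_w0 loses nothing on combinations of minimal coset
  representatives, since the coefficient at y is recovered at y w0. This both runs Lusztig's
  triangular argument and identifies the factors of the theorem, which are defined through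
  coefficients of ordinary Kazhdan-Lusztig elements.\<close>

lemma additive_int_mult:
  fixes f :: "'a::ab_group_add \<Rightarrow> int"
  assumes "additive f"
  shows "f (int_mult k y) = k * f y"
proof -
  have "f (int_mult k y) = (\<Sum>i<nat k. f y) - (\<Sum>i<nat (- k). f y)"
    unfolding int_mult_def by (simp only: additive.diff[OF assms] additive.sum[OF assms])
  also have "\<dots> = k * f y"
    by (cases "k \<ge> 0") (auto simp: left_diff_distrib)
  finally show ?thesis .
qed

lemma additive_int_mult_group:
  fixes f :: "'a::ab_group_add \<Rightarrow> 'b::ab_group_add"
  assumes "additive f"
  shows "f (int_mult k y) = int_mult k (f y)"
  unfolding int_mult_def by (simp only: additive.diff[OF assms] additive.sum[OF assms])

text \<open>Off-diagonal terms come in equal pairs. In \<open>coroot_signs\<close> this is the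
  source of integrality: it makes a norm an integral multiple of the squared length of the root,
  where the expansion alone gives this only for twice the norm.\<close>

lemma even_sum_symmetric:
  fixes f :: "'a \<Rightarrow> 'a \<Rightarrow> int"
  assumes "finite P" "\<And>j l. f j l = f l j" "\<And>j. even (f j j)"
  shows "even (\<Sum>j\<in>P. \<Sum>l\<in>P. f j l)"
  using assms(1)
proof (induction P rule: finite_induct)
  case (insert k P)
  have "(\<Sum>j\<in>insert k P. \<Sum>l\<in>insert k P. f j l)
      = f k k + (\<Sum>l\<in>P. f k l) + (\<Sum>j\<in>P. f j k) + (\<Sum>j\<in>P. \<Sum>l\<in>P. f j l)"
    using insert.hyps by (simp add: sum.distrib)
  also have "(\<Sum>j\<in>P. f j k) = (\<Sum>l\<in>P. f k l)"
    using assms(2) by simp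
  finally show ?case using insert.IH assms(3) by simp
qed simp

lemma finite_maximizer:
  fixes f :: "'a \<Rightarrow> 'b::linorder"
  assumes "finite S" "S \<noteq> {}"
  obtains y where "y \<in> S" "\<And>z. z \<in> S \<Longrightarrow> f z \<le> f y"
proof -
  have "Max (f ` S) \<in> f ` S" using assms by (intro Max_in) auto
  then obtain y where "y \<in> S" "Max (f ` S) = f y" by auto
  with assms that[of y] show ?thesis by (metis Max_ge finite_imageI imageI)
qed

text \<open>Fixing the elements of \<open>A\<close> that lie in \<open>B\<close> and applying the
  involution \<open>f\<close> to the others injects \<open>A\<close> into \<open>B - {b}\<close>;
  \<open>both\<close> prevents a moved element from colliding with a fixed one. It serves for
  inverted roots and again for their directions.\<close>

lemma card_less_swap:
  assumes "finite B" and inv: "\<And>a. a \<in> A \<Longrightarrow> f (f a) = a"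
    and dich: "\<And>a. a \<in> A \<Longrightarrow> a \<in> B \<or> f a \<in> B"
    and both: "\<And>a. a \<in> A \<Longrightarrow> f a \<in> A \<Longrightarrow> a \<in> B"
    and b: "b \<in> B" "b \<notin> A" "\<And>a. a \<in> A \<Longrightarrow> f a \<noteq> b"
  shows "card A < card B"
proof -
  define g where "g a = (if a \<in> B then a else f a)" for a
  have "inj_on g A"
  proof (rule inj_onI)
    fix a a' assume a: "a \<in> A" "a' \<in> A" "g a = g a'"
    then show "a = a'" using inv both unfolding g_def by (metis (full_types))
  qed
  moreover have "g ` A \<subseteq> B - {b}" using dich b by (auto simp: g_def)
  ultimately have "card A \<le> card (B - {b})" using assms(1) by (metis card_inj_on_le finite_Diff)
  also have "\<dots> < card B" using assms(1) b(1) by (rule card_Diff1_less)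
  finally show ?thesis .
qed

section \<open>Fundamental weights and the finite Weyl group\<close>

locale affine_datum =
  fixes D :: "'y::ab_group_add root_datum"
  assumes fin_datum: "finite_root_datum D"
    and irred: "irreducible_datum D"
    and sc: "simply_connected D"
begin

definition "I = {1..rank D}"
abbreviation "rt \<equiv> simple_root D"
abbreviation "cr \<equiv> simple_coroot D"
abbreviation "sr \<equiv> simple_refl D"
abbreviation "Wf \<equiv> finite_weyl D"
abbreviation winv :: "('y \<Rightarrow> 'y) \<Rightarrow> 'y \<Rightarrow> 'y" where "winv \<equiv> inv_into UNIV"

lemma finite_I [simp]: "finite I"
  by (simp add: I_def)

lemma cr_additive: "i \<in> I \<Longrightarrow> additive (cr i)"
  using fin_datum unfolding finite_root_datum_def I_def additive_def by blast

lemma cr_rt [simp]: "i \<in> I \<Longrightarrow> cr i (rt i) = 2"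
  using fin_datum unfolding finite_root_datum_def I_def by blast

lemma cr_rt_le: "i \<in> I \<Longrightarrow> j \<in> I \<Longrightarrow> i \<noteq> j \<Longrightarrow> cr i (rt j) \<le> 0"
  using fin_datum unfolding finite_root_datum_def I_def by blast

lemma Wf_eq: "Wf = generate (BijGroup UNIV) (sr ` I)"
  by (simp add: finite_weyl_def I_def)

lemma finite_Wf: "finite Wf"
  using fin_datum unfolding finite_root_datum_def I_def by blast

text \<open>The fundamental weights. Being dual to the simple coroots, they read off coordinates:
  \<open>x (fw i)\<close> is the coefficient of the simple coroot \<open>cr i\<close> in a coweight
  \<open>x\<close>.\<close>

definition fw :: "nat \<Rightarrow> 'y" where
  "fw = (SOME \<omega>. (\<forall>i\<in>I. \<forall>j\<in>I. cr j (\<omega> i) = (if i = j then 1 else 0)) \<and>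
     (\<forall>y. \<exists>!c. c \<in> I \<rightarrow>\<^sub>E (UNIV :: int set) \<and> y = (\<Sum>i\<in>I. int_mult (c i) (\<omega> i))))"

lemma fw_props:
  "(\<forall>i\<in>I. \<forall>j\<in>I. cr j (fw i) = (if i = j then 1 else 0)) \<and>
     (\<forall>y. \<exists>!c. c \<in> I \<rightarrow>\<^sub>E (UNIV :: int set) \<and> y = (\<Sum>i\<in>I. int_mult (c i) (fw i)))"
  using someI_ex[OF sc[unfolded simply_connected_def, folded I_def], folded fw_def] .

lemma cr_fw [simp]: "i \<in> I \<Longrightarrow> j \<in> I \<Longrightarrow> cr j (fw i) = (if i = j then 1 else 0)"
  using fw_props by blast

lemma weight_expansion: "y = (\<Sum>i\<in>I. int_mult (cr i y) (fw i))"
proof -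
  obtain c where c: "y = (\<Sum>i\<in>I. int_mult (c i) (fw i))"
    using fw_props by blast
  have "cr j y = c j" if j: "j \<in> I" for j
  proof -
    have "cr j y = (\<Sum>i\<in>I. c i * cr j (fw i))"
      by (subst c) (simp only: additive.sum[OF cr_additive[OF j]] additive_int_mult[OF cr_additive[OF j]])
    also have "\<dots> = (\<Sum>i\<in>I. if i = j then c i else 0)"
      by (rule sum.cong) (use j in auto)
    finally show ?thesis using j by simp
  qed
  then have "(\<Sum>i\<in>I. int_mult (cr i y) (fw i)) = (\<Sum>i\<in>I. int_mult (c i) (fw i))"
    by (intro sum.cong) auto
  with c show ?thesis by simp
qed

lemma weight_ext: "(\<And>i. i \<in> I \<Longrightarrow> cr i y = cr i z) \<Longrightarrow> y = z"
  using weight_expansion[of y] weight_expansion[of z] by (metis (mono_tags, lifting) sum.cong)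

lemma coweight_expansion:
  assumes "additive x"
  shows "x y = (\<Sum>i\<in>I. x (fw i) * cr i y)"
  by (subst weight_expansion[of y])
    (simp add: additive.sum[OF assms] additive_int_mult[OF assms] mult.commute)

lemma sr_apply: "sr i y = y - int_mult (cr i y) (rt i)"
  by (simp add: simple_refl_def reflection_def)

lemma additive_sr:
  fixes x :: "'y \<Rightarrow> int"
  assumes "additive x"
  shows "x (sr i y) = x y - cr i y * x (rt i)"
  by (simp add: sr_apply additive.diff[OF assms] additive_int_mult[OF assms])

lemma cr_sr: "j \<in> I \<Longrightarrow> cr j (sr i y) = cr j y - cr i y * cr j (rt i)"
  by (rule additive_sr[OF cr_additive])

lemma sr_sr [simp]: "i \<in> I \<Longrightarrow> sr i (sr i y) = y"
  by (rule weight_ext) (simp add: cr_sr)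

lemma sr_comp [simp]: "i \<in> I \<Longrightarrow> sr i \<circ> sr i = id"
  by auto

lemma sr_rt [simp]: "i \<in> I \<Longrightarrow> sr i (rt i) = - rt i"
  by (rule weight_ext) (simp add: cr_sr additive.minus[OF cr_additive])

lemma sr_additive: "i \<in> I \<Longrightarrow> additive (sr i)"
  unfolding additive_def
  by (intro allI weight_ext) (simp add: cr_sr additive.add[OF cr_additive] algebra_simps)

lemma sr_Bij: "i \<in> I \<Longrightarrow> sr i \<in> Bij UNIV"
  using o_bij[OF sr_comp sr_comp] by (auto simp: Bij_def)

lemma BijGroup_UNIV:
  "f \<in> Bij UNIV \<Longrightarrow> g \<in> Bij UNIV \<Longrightarrow> f \<otimes>\<^bsub>BijGroup UNIV\<^esub> g = f \<circ> g"
  "\<one>\<^bsub>BijGroup UNIV\<^esub> = id"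
  "f \<in> Bij UNIV \<Longrightarrow> inv\<^bsub>BijGroup UNIV\<^esub> f = winv f"
  by (simp_all add: inv_BijGroup) (auto simp: BijGroup_def compose_def)

lemma winv_sr [simp]: "i \<in> I \<Longrightarrow> winv (sr i) = sr i"
  by (metis inv_equality sr_sr)

lemma Wf_Bij: "w \<in> Wf \<Longrightarrow> w \<in> Bij UNIV"
proof -
  interpret B: group "BijGroup UNIV" by (rule group_BijGroup)
  have "sr ` I \<subseteq> carrier (BijGroup UNIV)"
    using sr_Bij by (auto simp: BijGroup_def)
  then show "w \<in> Wf \<Longrightarrow> w \<in> Bij UNIV"
    unfolding Wf_eq using B.generate_incl[of "sr ` I"] by (auto simp: BijGroup_def)
qed

lemma Wf_bij: "w \<in> Wf \<Longrightarrow> bij w"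
  using Wf_Bij by (auto simp: Bij_def)

lemma Wf_id [simp]: "id \<in> Wf"
  unfolding Wf_eq using generate.one[of "BijGroup UNIV"] by (simp add: BijGroup_UNIV)

lemma Wf_sr [simp]: "i \<in> I \<Longrightarrow> sr i \<in> Wf"
  unfolding Wf_eq by (auto intro: generate.incl)

lemma Wf_comp: "u \<in> Wf \<Longrightarrow> v \<in> Wf \<Longrightarrow> u \<circ> v \<in> Wf"
  using generate.eng[of u "BijGroup UNIV" "sr ` I" v] Wf_Bij
  by (simp add: Wf_eq BijGroup_UNIV)

lemma Wf_induct [consumes 1, case_names id sr]:
  assumes "w \<in> Wf" and id: "P id" and sr: "\<And>i w. i \<in> I \<Longrightarrow> w \<in> Wf \<Longrightarrow> P w \<Longrightarrow> P (sr i \<circ> w)"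
  shows "P w"
proof -
  \<comment> \<open>\<open>generate\<close> splits products arbitrarily, not one generator at a
    time; carrying along every right factor \<open>v\<close> with \<open>P v\<close> turns the
    product case into composition.\<close>
  have "w \<in> Wf \<and> (\<forall>v\<in>Wf. P v \<longrightarrow> P (w \<circ> v))"
    using assms(1) unfolding Wf_eq
  proof (induction rule: generate.induct)
    case one
    show ?case using Wf_id[unfolded Wf_eq] by (simp only: BijGroup_UNIV(2)) simp
  next
    case (incl h)
    then show ?case using sr[folded Wf_eq] Wf_sr unfolding Wf_eq[symmetric] by blast
  next
    case (inv h)
    then obtain i where i: "i \<in> I" "h = sr i" by blast
    then have "inv\<^bsub>BijGroup UNIV\<^esub> h = sr i"
      by (simp add: BijGroup_UNIV(3) sr_Bij)
    with i show ?case using sr Wf_sr unfolding Wf_eq[symmetric] by metis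
  next
    case (eng h1 h2)
    then have "h1 \<otimes>\<^bsub>BijGroup UNIV\<^esub> h2 = h1 \<circ> h2"
      using Wf_Bij by (simp add: Wf_eq BijGroup_UNIV)
    with eng show ?case using Wf_comp unfolding Wf_eq[symmetric] by (simp only: comp_assoc) blast
  qed
  then show ?thesis using id Wf_id by (metis comp_id)
qed

lemma Wf_winv: "w \<in> Wf \<Longrightarrow> winv w \<in> Wf"
proof (induction rule: Wf_induct)
  case (sr i w)
  then have "winv (sr i \<circ> w) = winv w \<circ> sr i"
    by (simp add: o_inv_distrib Wf_bij)
  with sr show ?case by (metis Wf_comp Wf_sr)
qed (metis Wf_id inv_id)

lemma Wf_winv_comp: "w \<in> Wf \<Longrightarrow> winv w \<circ> w = id" "w \<in> Wf \<Longrightarrow> w \<circ> winv w = id"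
  using Wf_bij[of w] by (simp_all add: bij_def surj_iff)

lemma Wf_winv_apply [simp]: "w \<in> Wf \<Longrightarrow> winv w (w y) = y" "w \<in> Wf \<Longrightarrow> w (winv w y) = y"
  using Wf_winv_comp by (metis comp_apply id_apply)+

lemma winv_comp: "u \<in> Wf \<Longrightarrow> v \<in> Wf \<Longrightarrow> winv (u \<circ> v) = winv v \<circ> winv u"
  by (simp add: o_inv_distrib Wf_bij)

lemma winv_winv: "w \<in> Wf \<Longrightarrow> winv (winv w) = w"
  by (simp add: inv_inv_eq Wf_bij)

lemma additive_comp: "additive f \<Longrightarrow> additive g \<Longrightarrow> additive (f \<circ> g)"
  by (simp add: additive_def)

lemma Wf_additive: "w \<in> Wf \<Longrightarrow> additive w"
proof (induction rule: Wf_induct)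
  case id
  show ?case by (simp add: additive_def)
qed (blast intro: additive_comp sr_additive)

lemma coaction_comp: "coaction w x = x \<circ> winv w"
  by (auto simp: coaction_def)

lemma coroots_eq: "coroots D = {cr i \<circ> w | w i. w \<in> Wf \<and> i \<in> I}"
proof -
  have "cr i \<circ> w = cr i \<circ> winv (winv w)" if "w \<in> Wf" for w i
    using that by (simp add: winv_winv)
  then show ?thesis
    unfolding coroots_def coaction_comp I_def[symmetric] using Wf_winv by blast
qed

lemma finite_coroots: "finite (coroots D)"
proof -
  have "coroots D = (\<lambda>(w, i). cr i \<circ> w) ` (Wf \<times> I)"
    unfolding coroots_eq by auto
  then show ?thesis using finite_Wf by simp
qed

lemma coroot_additive: "x \<in> coroots D \<Longrightarrow> additive x"
  unfolding coroots_eq by (auto intro: additive_comp cr_additive Wf_additive)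

lemma coroot_comp: "x \<in> coroots D \<Longrightarrow> v \<in> Wf \<Longrightarrow> x \<circ> v \<in> coroots D"
  unfolding coroots_eq using Wf_comp by (force simp: comp_assoc)

lemma cr_coroot: "i \<in> I \<Longrightarrow> cr i \<in> coroots D"
  unfolding coroots_eq by (force intro: exI[of _ id])

section \<open>The invariant form and the correspondence of roots and coroots\<close>

definition form :: "'y \<Rightarrow> 'y \<Rightarrow> int" where
  "form y z = (\<Sum>x\<in>coroots D. x y * x z)"

lemma sq_length_form: "sq_length D y = form y y"
  by (simp add: sq_length_def form_def power2_eq_square)

lemma form_commute: "form y z = form z y"
  by (simp add: form_def mult.commute)

lemma form_additive: "additive (form y)"
  unfolding additive_def form_def
  by (simp add: additive.add[OF coroot_additive] distrib_left sum.distrib)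

lemma form_Wf: "v \<in> Wf \<Longrightarrow> form (v y) (v z) = form y z"
  unfolding form_def
  by (rule sum.reindex_bij_witness[where i = "\<lambda>x. x \<circ> winv v" and j = "\<lambda>x. x \<circ> v"])
    (auto simp: coroot_comp Wf_winv comp_assoc Wf_winv_comp)

lemma form_nonneg: "form y y \<ge> 0"
  unfolding form_def by (intro sum_nonneg) simp

lemma form_eq_0: assumes "form y y = 0" shows "y = 0"
proof (rule weight_ext)
  fix i assume i: "i \<in> I"
  have "\<forall>x\<in>coroots D. x y * x y = 0"
    using assms finite_coroots unfolding form_def by (subst (asm) sum_nonneg_eq_0_iff) auto
  then show "cr i y = cr i 0"
    using cr_coroot[OF i] additive.zero[OF cr_additive[OF i]] by simp
qed

lemma form_pos: "y \<noteq> 0 \<Longrightarrow> form y y > 0"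
  using form_nonneg form_eq_0 by (metis order_le_less)

text \<open>A relation rather than a function, because bijectivity of the correspondence is a
  consequence of the invariant form, drawn in \<open>root_pair_unique_coroot\<close> and
  \<open>root_pair_unique_root\<close>.\<close>

definition root_pair :: "'y \<Rightarrow> ('y \<Rightarrow> int) \<Rightarrow> bool" where
  "root_pair a x \<longleftrightarrow> (\<exists>w\<in>Wf. \<exists>i\<in>I. a = w (rt i) \<and> x = cr i \<circ> winv w)"

lemma root_pair_coroot: "root_pair a x \<Longrightarrow> x \<in> coroots D"
  unfolding root_pair_def coroots_def coaction_comp I_def[symmetric] by auto

lemma root_pair_root: "root_pair a x \<Longrightarrow> a \<in> roots D"
  unfolding root_pair_def roots_def I_def[symmetric] by auto

lemma coroot_pairE: assumes "x \<in> coroots D" obtains a where "root_pair a x"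
  using assms unfolding root_pair_def coroots_def coaction_comp I_def[symmetric] by blast

lemma root_pairE: assumes "a \<in> roots D" obtains x where "root_pair a x"
  using assms unfolding root_pair_def roots_def I_def[symmetric] by blast

lemma root_pair_simple: "i \<in> I \<Longrightarrow> root_pair (rt i) (cr i)"
  unfolding root_pair_def by (rule bexI[of _ id]) auto

lemma root_pair_Wf: "root_pair a x \<Longrightarrow> v \<in> Wf \<Longrightarrow> root_pair (v a) (x \<circ> winv v)"
proof -
  assume "root_pair a x" and v: "v \<in> Wf"
  then obtain w i where w: "w \<in> Wf" "i \<in> I" "a = w (rt i)" "x = cr i \<circ> winv w"
    unfolding root_pair_def by blast
  then have "v a = (v \<circ> w) (rt i)" "x \<circ> winv v = cr i \<circ> winv (v \<circ> w)"
    using v by (simp_all add: winv_comp comp_assoc)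
  then show ?thesis
    unfolding root_pair_def using w v Wf_comp by blast
qed

lemma root_pair_self: "root_pair a x \<Longrightarrow> x a = 2"
  unfolding root_pair_def by auto

text \<open>Since \<open>sr i\<close> negates \<open>rt i\<close>, invariance gives (rt i, y) = -
  (rt i, sr i y); expanding \<open>sr i y\<close> yields the formula. It exhibits the coroot as 2
  (rt i, y) / (rt i, rt i).\<close>

lemma form_simple: assumes "i \<in> I" shows "form (rt i) (rt i) * cr i y = 2 * form (rt i) y"
proof -
  note add = form_additive[of "rt i"]
  have "form (rt i) (- sr i y) = form (sr i (rt i)) (sr i y)"
    using assms by (metis additive.minus[OF form_additive] form_commute sr_rt)
  also have "\<dots> = form (rt i) y" using assms by (intro form_Wf Wf_sr)
  finally show ?thesis
    by (simp add: additive.minus[OF add] additive.diff[OF add] additive_int_mult[OF add] sr_apply algebra_simps)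
qed

lemma root_pair_form:
  assumes "root_pair a x"
  shows "form a a * x y = 2 * form a y"
proof -
  obtain w i where w: "w \<in> Wf" "i \<in> I" "a = w (rt i)" "x = cr i \<circ> winv w"
    using assms unfolding root_pair_def by blast
  have "form a y = form (w (rt i)) (w (winv w y))" using w by simp
  also have "\<dots> = form (rt i) (winv w y)" using w(1) by (rule form_Wf)
  finally show ?thesis using form_simple[OF w(2), of "winv w y"] w form_Wf[OF w(1)] by simp
qed

lemma root_pair_nonzero: "root_pair a x \<Longrightarrow> a \<noteq> 0"
  using root_pair_self root_pair_coroot coroot_additive additive.zero by fastforce

lemma root_pair_form_pos: "root_pair a x \<Longrightarrow> form a a > 0"
  by (simp add: form_pos root_pair_nonzero)

lemma root_pair_unique_coroot:
  assumes "root_pair a x" "root_pair a x'" shows "x = x'"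
proof
  fix y show "x y = x' y"
    using assms[THEN root_pair_form, of y] root_pair_form_pos[OF assms(1)]
    by (metis less_irrefl mult_cancel_left)
qed

text \<open>Both roots represent multiples of the same functional \<open>x\<close>, and
  \<open>x a = x b = 2\<close> forces equal norms; so they agree against every \<open>y\<close>, and
  \<open>a - b\<close> has norm 0.\<close>

lemma root_pair_unique_root:
  assumes "root_pair a x" "root_pair b x" shows "a = b"
proof -
  have *: "form b b * form a y = form a a * form b y" for y
  proof -
    have "2 * (form b b * form a y) = form b b * (form a a * x y)"
      by (simp add: root_pair_form[OF assms(1)])
    also have "\<dots> = form a a * (form b b * x y)" by simp
    also have "\<dots> = 2 * (form a a * form b y)"
      by (simp add: root_pair_form[OF assms(2)])
    finally show ?thesis by simp
  qed
  have "form b b = form a a"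
    using root_pair_form[OF assms(1), of b] root_pair_form[OF assms(2), of a]
      root_pair_self[OF assms(1)] root_pair_self[OF assms(2)] form_commute[of a b] by simp
  then have "form a y = form b y" for y
    using *[of y] root_pair_form_pos[OF assms(2)] by simp
  then have "form (a - b) (a - b) = 0"
    by (metis additive.diff[OF form_additive] form_commute diff_self)
  then show ?thesis using form_eq_0 by fastforce
qed

lemma root_pair_uminus:
  assumes "root_pair a x" shows "root_pair (- a) (\<lambda>y. - x y)"
proof -
  obtain w i where w: "w \<in> Wf" "i \<in> I" "a = w (rt i)" "x = cr i \<circ> winv w"
    using assms unfolding root_pair_def by blast
  have "- a = (w \<circ> sr i) (rt i)"
    using w by (simp add: additive.minus[OF Wf_additive])
  moreover have "(\<lambda>y. - x y) = cr i \<circ> winv (w \<circ> sr i)"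
    using w by (auto simp: winv_comp cr_sr)
  ultimately show ?thesis
    unfolding root_pair_def using w Wf_comp Wf_sr by blast
qed

lemma reflection_conj:
  assumes "w \<in> Wf" "i \<in> I"
  shows "reflection (w (rt i)) (cr i \<circ> winv w) = w \<circ> sr i \<circ> winv w"
  using assms
  by (auto simp: reflection_def sr_apply additive.diff[OF Wf_additive] additive_int_mult_group[OF Wf_additive])

lemma reflection_Wf: "root_pair a x \<Longrightarrow> reflection a x \<in> Wf"
  unfolding root_pair_def by (auto simp: reflection_conj intro!: Wf_comp Wf_winv)

lemma winv_reflection:
  assumes "root_pair a x" shows "winv (reflection a x) = reflection a x"
proof -
  obtain w i where w: "w \<in> Wf" "i \<in> I" "a = w (rt i)" "x = cr i \<circ> winv w"
    using assms unfolding root_pair_def by blast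
  then show ?thesis
    by (simp add: reflection_conj winv_comp Wf_comp Wf_winv winv_winv comp_assoc)
qed

lemma reflection_apply:
  fixes x :: "'y \<Rightarrow> int"
  assumes "additive x" shows "x (reflection a z y) = x y - z y * x a"
  by (simp add: reflection_def additive.diff[OF assms] additive_int_mult[OF assms])

section \<open>Coordinates of roots and the sign dichotomy for coroots\<close>

lemma root_lattice:
  assumes "root_pair a x"
  shows "\<exists>b. a = (\<Sum>j\<in>I. int_mult (b j) (rt j))"
proof -
  obtain w i where w: "w \<in> Wf" "i \<in> I" "a = w (rt i)"
    using assms unfolding root_pair_def by blast
  have "\<exists>b. w (rt i) = (\<Sum>j\<in>I. int_mult (b j) (rt j))"
    using w(1)
  proof (induction rule: Wf_induct)
    case id
    have "rt i = (\<Sum>j\<in>I. int_mult (if j = i then 1 else 0) (rt j))"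
      using w(2) by (intro weight_ext)
        (simp add: additive.sum[OF cr_additive] additive_int_mult[OF cr_additive] if_distrib if_distribR sum.delta cong: if_cong)
    then show ?case by auto
  next
    case (sr k w)
    then obtain b where b: "w (rt i) = (\<Sum>j\<in>I. int_mult (b j) (rt j))" by blast
    let ?b = "\<lambda>j. b j - (if j = k then cr k (w (rt i)) else 0)"
    have "(sr k \<circ> w) (rt i) = (\<Sum>j\<in>I. int_mult (?b j) (rt j))"
    proof (rule weight_ext)
      fix l assume l: "l \<in> I"
      have "cr l (\<Sum>j\<in>I. int_mult (?b j) (rt j))
          = (\<Sum>j\<in>I. b j * cr l (rt j)) - (\<Sum>j\<in>I. if j = k then cr k (w (rt i)) * cr l (rt j) else 0)"
        by (simp only: additive.sum[OF cr_additive[OF l]] additive_int_mult[OF cr_additive[OF l]]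
            sum_subtractf[symmetric]) (intro sum.cong, auto simp: left_diff_distrib)
      also have "\<dots> = cr l (w (rt i)) - cr k (w (rt i)) * cr l (rt k)"
        using sr(1) by (simp add: b additive.sum[OF cr_additive[OF l]] additive_int_mult[OF cr_additive[OF l]])
      finally show "cr l ((sr k \<circ> w) (rt i)) = cr l (\<Sum>j\<in>I. int_mult (?b j) (rt j))"
        using l by (simp add: cr_sr)
    qed
    then show ?case by (rule exI[of _ ?b])
  qed
  with w show ?thesis by simp
qed

lemma form_rt_le: "j \<in> I \<Longrightarrow> l \<in> I \<Longrightarrow> j \<noteq> l \<Longrightarrow> form (rt j) (rt l) \<le> 0"
  using form_simple[of j "rt l"] cr_rt_le[of j l] root_pair_form_pos[OF root_pair_simple, of j]
  by (smt (verit) mult_nonneg_nonpos)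

text \<open>If a root \<open>a\<close> had coefficients of both signs, split it as \<open>a = e + f\<close> accordingly. Both
  \<open>(e, e)\<close> and \<open>(f, f)\<close> are positive multiples of \<open>d = (a, a)\<close> because the coroot of \<open>a\<close> is integral,
  and \<open>(e, f) \<ge> 0\<close>, so that \<open>(a, a) \<ge> 2 * d\<close>.\<close>

lemma coroot_signs:
  assumes "x \<in> coroots D"
  shows "(\<forall>i\<in>I. 0 \<le> x (fw i)) \<or> (\<forall>i\<in>I. x (fw i) \<le> 0)"
proof -
  obtain a where a: "root_pair a x" using assms by (rule coroot_pairE)
  obtain b where b: "a = (\<Sum>j\<in>I. int_mult (b j) (rt j))" using root_lattice[OF a] by blast
  define d where "d = form a a"
  define d' where "d' j = form (rt j) (rt j)" for j
  have d: "d > 0" using root_pair_form_pos[OF a] by (simp add: d_def)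
  have d': "d' j > 0" if "j \<in> I" for j
    using root_pair_form_pos[OF root_pair_simple[OF that]] by (simp add: d'_def)
  have expand: "2 * form (\<Sum>j\<in>S. int_mult (b j) (rt j)) y = (\<Sum>j\<in>S. b j * (d' j * cr j y))" if "S \<subseteq> I" for S y
  proof -
    have "form (\<Sum>j\<in>S. int_mult (b j) (rt j)) y = (\<Sum>j\<in>S. b j * form (rt j) y)"
      by (subst form_commute) (simp add: additive.sum[OF form_additive] additive_int_mult[OF form_additive] form_commute)
    moreover have "(\<Sum>j\<in>S. b j * (d' j * cr j y)) = (\<Sum>j\<in>S. 2 * (b j * form (rt j) y))"
      using that by (intro sum.cong) (auto simp: d'_def form_simple)
    ultimately show ?thesis by (simp add: sum_distrib_left)
  qed
  \<comment> \<open>The coordinates of the coroot and of the root differ by the positive factors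
    \<open>d' j / d\<close>, so it suffices to find the signs of \<open>b\<close>.\<close>
  have bc: "d * x (fw j) = b j * d' j" if j: "j \<in> I" for j
  proof -
    have "d * x (fw j) = (\<Sum>k\<in>I. b k * (d' k * cr k (fw j)))"
      using root_pair_form[OF a] expand[of I "fw j"] b by (simp add: d_def)
    also have "\<dots> = (\<Sum>k\<in>I. if k = j then b k * d' k else 0)"
      using j by (intro sum.cong) auto
    finally show ?thesis using j by simp
  qed
  have large: "d \<le> form (\<Sum>j\<in>S. int_mult (b j) (rt j)) (\<Sum>j\<in>S. int_mult (b j) (rt j))"
    if S: "S \<subseteq> I" and ex: "\<exists>j\<in>S. b j \<noteq> 0" for S
  proof -
    let ?e = "\<Sum>j\<in>S. int_mult (b j) (rt j)"
    \<comment> \<open>Summing \<open>d * ?f j l\<close> over \<open>S\<close> gives twice the norm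
      of \<open>?e\<close>. The matrix is symmetric because \<open>d * ?f\<close> is a Gram matrix
      up to scalars, and its diagonal is even because \<open>cr j (rt j) = 2\<close>; hence the norm
      is \<open>d * m\<close> with \<open>m\<close> an integer. The default 0 extends symmetry and
      evenness to all indices.\<close>
    let ?f = "\<lambda>j l. if j \<in> I \<and> l \<in> I then x (fw j) * b l * cr j (rt l) else 0"
    have finS: "finite S" using S finite_subset finite_I by blast
    have "?e \<noteq> 0"
    proof
      assume e: "?e = 0"
      obtain j where j: "j \<in> S" "b j \<noteq> 0" using ex by blast
      have "0 = (\<Sum>k\<in>S. b k * (d' k * cr k (fw j)))"
        using expand[OF S, of "fw j"] e additive.zero[OF form_additive] form_commute by (metis mult_zero_right)
      also have "\<dots> = (\<Sum>k\<in>S. if k = j then b k * d' k else 0)"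
        using j S by (intro sum.cong) (auto simp: subset_iff)
      finally show False using j S d' finS by fastforce
    qed
    then have pos: "form ?e ?e > 0" by (rule form_pos)
    have "?f j l = ?f l j" for j l
    proof (cases "j \<in> I \<and> l \<in> I")
      case True
      have "d * ?f j l = (d * x (fw j)) * b l * cr j (rt l)" using True by simp
      also have "\<dots> = b j * b l * (d' j * cr j (rt l))" using True by (simp add: bc)
      also have "d' j * cr j (rt l) = d' l * cr l (rt j)"
        using True form_simple[of j "rt l"] form_simple[of l "rt j"] form_commute[of "rt j" "rt l"] by (simp add: d'_def)
      also have "b j * b l * (d' l * cr l (rt j)) = (d * x (fw l)) * b j * cr l (rt j)"
        using True by (simp add: bc)
      also have "\<dots> = d * ?f l j" using True by simp
      finally show ?thesis using d by simp
    qed auto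
    then have "even (\<Sum>j\<in>S. \<Sum>l\<in>S. ?f j l)"
      using finS by (intro even_sum_symmetric) auto
    then obtain m where m: "(\<Sum>j\<in>S. \<Sum>l\<in>S. ?f j l) = 2 * m" by (rule evenE)
    have "2 * form ?e ?e = (\<Sum>j\<in>S. d * (x (fw j) * cr j ?e))"
    proof (subst expand[OF S], intro sum.cong refl)
      fix j assume "j \<in> S"
      then show "b j * (d' j * cr j ?e) = d * (x (fw j) * cr j ?e)"
        using bc[of j] S by (metis (no_types, lifting) mult.assoc subsetD)
    qed
    also have "\<dots> = (\<Sum>j\<in>S. d * (\<Sum>l\<in>S. ?f j l))"
    proof (intro sum.cong refl)
      fix j assume j: "j \<in> S"
      then have "cr j ?e = (\<Sum>l\<in>S. b l * cr j (rt l))"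
        using S by (simp add: additive.sum[OF cr_additive] additive_int_mult[OF cr_additive] subset_iff)
      also have "x (fw j) * \<dots> = (\<Sum>l\<in>S. ?f j l)"
        unfolding sum_distrib_left using j S by (intro sum.cong) (auto simp: mult.assoc)
      finally show "d * (x (fw j) * cr j ?e) = d * (\<Sum>l\<in>S. ?f j l)" by simp
    qed
    also have "\<dots> = d * (2 * m)" by (simp add: m flip: sum_distrib_left)
    finally have "form ?e ?e = d * m" by simp
    with pos d have "m \<ge> 1" by (metis zero_less_mult_pos int_one_le_iff_zero_less)
    with \<open>form ?e ?e = d * m\<close> d show ?thesis by simp
  qed
  define P M where "P = {j \<in> I. b j > 0}" and "M = {j \<in> I. b j < 0}"
  define e f where "e = (\<Sum>j\<in>P. int_mult (b j) (rt j))" and "f = (\<Sum>j\<in>M. int_mult (b j) (rt j))"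
  have PM: "P \<subseteq> I" "M \<subseteq> I" "finite P" "finite M" "P \<inter> M = {}" by (auto simp: P_def M_def)
  have "P = {} \<or> M = {}"
  proof (rule ccontr)
    assume ne: "\<not> (P = {} \<or> M = {})"
    have "d \<le> form e e" "d \<le> form f f"
      unfolding e_def f_def using ne PM by (intro large; force simp: P_def M_def)+
    moreover have "form e f \<ge> 0"
    proof -
      have "form e f = (\<Sum>j\<in>P. \<Sum>l\<in>M. b j * b l * form (rt j) (rt l))"
      proof -
        have "form e f = (\<Sum>l\<in>M. b l * form (rt l) e)"
          unfolding f_def by (simp add: additive.sum[OF form_additive] additive_int_mult[OF form_additive] form_commute)
        also have "\<dots> = (\<Sum>l\<in>M. \<Sum>j\<in>P. b j * b l * form (rt j) (rt l))"
          unfolding e_def by (simp add: additive.sum[OF form_additive] additive_int_mult[OF form_additive]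
              form_commute sum_distrib_left ac_simps)
        finally show ?thesis by (subst sum.swap)
      qed
      moreover have "b j * b l * form (rt j) (rt l) \<ge> 0" if "j \<in> P" "l \<in> M" for j l
        using that form_rt_le[of j l] PM
        by (intro mult_nonpos_nonpos) (auto simp: P_def M_def mult_le_0_iff)
      ultimately show ?thesis by (simp add: sum_nonneg)
    qed
    moreover have "a = e + f"
    proof -
      have "(\<Sum>j\<in>P \<union> M. int_mult (b j) (rt j)) = a"
        unfolding b using PM by (intro sum.mono_neutral_left) (auto simp: P_def M_def int_mult_def)
      then show ?thesis using PM by (simp add: e_def f_def sum.union_disjoint)
    qed
    then have "d = form e e + form f f + 2 * form e f"
      using additive.add[OF form_additive] form_commute by (simp add: d_def)
    ultimately show False using d by simp
  qed
  moreover have "x (fw j) > 0 \<longleftrightarrow> b j > 0" "x (fw j) < 0 \<longleftrightarrow> b j < 0" if "j \<in> I" for j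
    using bc[OF that] d d'[OF that] by (smt (verit) zero_less_mult_iff mult_less_0_iff)+
  ultimately show ?thesis unfolding P_def M_def by force
qed

lemma pos_coroots_iff: "x \<in> pos_coroots D \<longleftrightarrow> x \<in> coroots D \<and> (\<forall>i\<in>I. 0 \<le> x (fw i))"
proof safe
  assume "x \<in> pos_coroots D"
  then obtain c :: "nat \<Rightarrow> nat" where x: "x \<in> coroots D" "x = (\<lambda>y. \<Sum>i\<in>I. int (c i) * cr i y)"
    unfolding pos_coroots_def I_def by blast
  then show "x \<in> coroots D" by blast
  fix i assume "i \<in> I"
  then show "0 \<le> x (fw i)" using x(2) by (simp add: sum_nonneg)
next
  assume x: "x \<in> coroots D" "\<forall>i\<in>I. 0 \<le> x (fw i)"
  then have "x = (\<lambda>y. \<Sum>i\<in>I. int (nat (x (fw i))) * cr i y)"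
    using coweight_expansion[OF coroot_additive] by fastforce
  with x(1) show "x \<in> pos_coroots D" unfolding pos_coroots_def I_def
    by (intro CollectI conjI exI[of _ "\<lambda>i. nat (x (fw i))"])
qed

lemma coroot_uminus: "x \<in> coroots D \<Longrightarrow> - x \<in> coroots D"
  using root_pair_uminus root_pair_coroot coroot_pairE unfolding fun_Compl_def by metis

text \<open>Pairing with \<open>rho\<close> gives the height of a coroot, the sum of its simple
  coordinates, so that by the sign dichotomy one integer decides positivity.\<close>

definition rho :: 'y where "rho = (\<Sum>i\<in>I. fw i)"

lemma cr_rho [simp]: "i \<in> I \<Longrightarrow> cr i rho = 1"
  by (simp add: rho_def additive.sum[OF cr_additive])

lemma coroot_rho: "x \<in> coroots D \<Longrightarrow> x rho = (\<Sum>i\<in>I. x (fw i))"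
  by (simp add: rho_def additive.sum[OF coroot_additive])

lemma coroot_nonzero: "x \<in> coroots D \<Longrightarrow> \<exists>i\<in>I. x (fw i) \<noteq> 0"
  using coweight_expansion[OF coroot_additive] root_pair_self coroot_pairE
  by (metis (no_types, lifting) mult_zero_left sum.neutral zero_neq_numeral)

lemma coroot_pos_or_neg:
  "x \<in> coroots D \<Longrightarrow> (x \<in> pos_coroots D \<and> x rho > 0) \<or> (- x \<in> pos_coroots D \<and> x rho < 0)"
proof -
  assume x: "x \<in> coroots D"
  obtain i where i: "i \<in> I" "x (fw i) \<noteq> 0" using coroot_nonzero[OF x] by blast
  show ?thesis
  proof (cases "\<forall>i\<in>I. 0 \<le> x (fw i)")
    case True
    then have "x rho > 0" unfolding coroot_rho[OF x] using i by (intro sum_pos2[of _ i]) auto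
    with True x show ?thesis by (simp add: pos_coroots_iff)
  next
    case False
    then have neg: "\<forall>i\<in>I. x (fw i) \<le> 0" using coroot_signs[OF x] by blast
    then have "0 < (\<Sum>i\<in>I. - x (fw i))" using i by (intro sum_pos2[of _ i]) auto
    then have "x rho < 0" unfolding coroot_rho[OF x] by (simp add: sum_negf)
    with neg x show ?thesis by (simp add: pos_coroots_iff coroot_uminus)
  qed
qed

lemma pos_coroots_rho: "x \<in> coroots D \<Longrightarrow> x \<in> pos_coroots D \<longleftrightarrow> x rho > 0"
proof -
  assume x: "x \<in> coroots D"
  have "x rho \<ge> 0" if "x \<in> pos_coroots D"
    using that by (simp add: pos_coroots_iff coroot_rho sum_nonneg)
  then show ?thesis using coroot_pos_or_neg[OF x] by auto
qed

lemma pos_coroot_ge_0: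
  assumes "x \<in> pos_coroots D" "\<And>i. i \<in> I \<Longrightarrow> 0 \<le> cr i y" shows "0 \<le> x y"
  using assms coweight_expansion[OF coroot_additive, of x y]
  by (auto simp: pos_coroots_iff intro!: sum_nonneg)

section \<open>The dominant short root and the highest coroot\<close>

lemma finite_roots: "finite (roots D)"
proof -
  have "roots D = (\<lambda>(w, i). w (rt i)) ` (Wf \<times> I)"
    unfolding roots_def I_def[symmetric] by auto
  then show ?thesis using finite_Wf by simp
qed

lemma root_pair_dual_dominant:
  assumes "root_pair a x" "i \<in> I"
  shows "form a a * x (rt i) = form (rt i) (rt i) * cr i a"
  using root_pair_form[OF assms(1), of "rt i"] form_simple[OF assms(2), of a] form_commute[of a "rt i"] by simp

text \<open>If the support of \<open>y\<close> were proper, irreducibility would join some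
  \<open>j\<close> in it to some \<open>k\<close> outside it. Then no term of the expansion of
  \<open>y (rt k)\<close> is positive and the one at \<open>j\<close> is negative, whereas dominance
  of \<open>b\<close> makes \<open>y (rt k)\<close> nonnegative.\<close>

lemma dominant_full_support:
  assumes b: "root_pair b y" and dom: "\<And>i. i \<in> I \<Longrightarrow> 0 \<le> cr i b" and i: "i \<in> I"
  shows "0 < y (fw i)"
proof -
  have y: "y \<in> coroots D" using b by (rule root_pair_coroot)
  have pos: "y \<in> pos_coroots D"
  proof (rule ccontr)
    assume "y \<notin> pos_coroots D"
    then have "- y \<in> pos_coroots D" using coroot_pos_or_neg[OF y] by blast
    from pos_coroot_ge_0[OF this dom] show False using root_pair_self[OF b] by simp
  qed
  define J where "J = {j \<in> I. 0 < y (fw j)}"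
  have "J \<noteq> {}" using coroot_nonzero[OF y] pos by (force simp: J_def pos_coroots_iff)
  have "J = I"
  proof (rule ccontr)
    assume "J \<noteq> I"
    then obtain j k where jk: "j \<in> J" "k \<in> I - J" "cr j (rt k) \<noteq> 0"
      using irred \<open>J \<noteq> {}\<close> unfolding irreducible_datum_def I_def[symmetric]
      by (metis (no_types, lifting) J_def mem_Collect_eq subsetI)
    have term_le: "y (fw l) * cr l (rt k) \<le> 0" if l: "l \<in> I" for l
    proof (cases "l = k")
      case True
      then have "y (fw l) = 0" using jk pos l by (auto simp: J_def pos_coroots_iff)
      then show ?thesis by simp
    next
      case False
      then show ?thesis using l jk pos cr_rt_le[of l k]
        by (auto simp: pos_coroots_iff mult_nonneg_nonpos)
    qed
    have j: "j \<in> I" "0 < y (fw j)" "j \<noteq> k" using jk by (auto simp: J_def)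
    then have "y (fw j) * cr j (rt k) < 0"
      using jk cr_rt_le[of j k] by (intro mult_pos_neg) auto
    then have "0 < (\<Sum>l\<in>I. - (y (fw l) * cr l (rt k)))"
      using j term_le by (intro sum_pos2[of _ j]) auto
    then have "y (rt k) < 0"
      using coweight_expansion[OF coroot_additive[OF y], of "rt k"] by (simp add: sum_negf)
    moreover have "0 \<le> y (rt k)"
      using root_pair_dual_dominant[OF b, of k] dom[of k] jk(2) root_pair_form_pos[OF b] form_nonneg[of "rt k"]
      by (metis DiffD1 mult_nonneg_nonneg zero_le_mult_iff not_less)
    ultimately show False by simp
  qed
  with i show ?thesis by (auto simp: J_def)
qed

lemma dominant_pairing_pos:
  assumes "root_pair a x" "\<And>i. i \<in> I \<Longrightarrow> 0 \<le> cr i a"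
    and "root_pair b y" "\<And>i. i \<in> I \<Longrightarrow> 0 \<le> cr i b"
  shows "0 < x b"
proof -
  have "\<exists>i\<in>I. cr i b \<noteq> 0"
    using weight_ext[of b 0] root_pair_nonzero[OF assms(3)] additive.zero[OF cr_additive] by metis
  then obtain i where i: "i \<in> I" "cr i b > 0" using assms(4) by force
  have supp: "0 < x (fw j)" if "j \<in> I" for j
    using dominant_full_support[OF assms(1,2) that] .
  have "0 < (\<Sum>j\<in>I. x (fw j) * cr j b)"
    using i supp assms(4) by (intro sum_pos2[of _ i]) (auto intro: mult_nonneg_nonneg less_imp_le)
  then show ?thesis
    using coweight_expansion[OF coroot_additive[OF root_pair_coroot[OF assms(1)]]] by metis
qed

lemma form_diff: "form (a - b) (a - b) = form a a - 2 * form a b + form b b"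
proof -
  have "form (a - b) z = form a z - form b z" for z
    by (metis additive.diff[OF form_additive] form_commute)
  then show ?thesis
    using form_commute[of a b] by (simp add: additive.diff[OF form_additive])
qed

lemma coroot_reflection:
  assumes "root_pair b y" "x \<in> coroots D"
  shows "(\<lambda>v. x v - y v * x b) \<in> coroots D"
proof -
  have "x \<circ> reflection b y = (\<lambda>v. x v - y v * x b)"
    by (auto simp: reflection_apply[OF coroot_additive[OF assms(2)]])
  then show ?thesis using coroot_comp[OF assms(2) reflection_Wf[OF assms(1)]] by simp
qed

text \<open>Both parts come from (a - b, a - b) being nonnegative, together with
  \<open>x b = 2 (a, b) / (a, a)\<close> and the assumption that \<open>b\<close> is no longer than
  \<open>a\<close>.\<close>

lemma short_pairing:
  assumes a: "root_pair a x" and b: "root_pair b y" and le: "form b b \<le> form a a"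
  shows "x b \<le> 2" "x b = 2 \<Longrightarrow> a = b"
proof -
  have fa: "form a a > 0" using root_pair_form_pos[OF a] .
  have "0 \<le> form a a - form a a * x b + form b b"
    using form_nonneg[of "a - b"] root_pair_form[OF a, of b] by (simp add: form_diff)
  with le have "form a a * x b \<le> form a a * 2" by linarith
  with fa show "x b \<le> 2" by simp
  assume "x b = 2"
  with root_pair_form[OF a, of b] have "form a b = form a a" by simp
  then have "form (a - b) (a - b) \<le> 0" using le by (simp add: form_diff)
  then show "a = b" using form_pos[of "a - b"] by force
qed

abbreviation "phi \<equiv> dominant_short_root D"
abbreviation "thet \<equiv> theta D"

definition is_dominant_short :: "'y \<Rightarrow> bool" where
  "is_dominant_short a \<longleftrightarrow> a \<in> roots D \<and> (\<forall>i\<in>I. 0 \<le> cr i a) \<and> (\<forall>b\<in>roots D. form a a \<le> form b b)"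

text \<open>Among the roots of least norm, one with the largest form against \<open>rho\<close> is
  dominant: reflecting in a simple root with negative pairing would keep the norm and increase the
  form.\<close>

lemma dominant_short_exists: "\<exists>a. is_dominant_short a"
proof -
  have "1 \<in> I" using irred by (simp add: irreducible_datum_def I_def)
  then have ne: "roots D \<noteq> {}" using root_pair_root[OF root_pair_simple] by blast
  obtain a0 where a0: "a0 \<in> roots D" "\<And>b. b \<in> roots D \<Longrightarrow> - form b b \<le> - form a0 a0"
    using finite_maximizer[OF finite_roots ne, of "\<lambda>b. - form b b"] by blast
  let ?S = "{b \<in> roots D. form b b = form a0 a0}"
  obtain a where a: "a \<in> ?S" "\<And>b. b \<in> ?S \<Longrightarrow> form rho b \<le> form rho a"
    using finite_maximizer[of ?S "form rho"] finite_roots a0(1) by auto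
  have "0 \<le> cr i a" if i: "i \<in> I" for i
  proof (rule ccontr)
    assume neg: "\<not> 0 \<le> cr i a"
    obtain x where "root_pair a x" using a(1) root_pairE by blast
    then have "sr i a \<in> roots D" using root_pair_root root_pair_Wf i Wf_sr by blast
    then have "sr i a \<in> ?S" using a(1) form_Wf[OF Wf_sr[OF i]] by simp
    then have "form rho (sr i a) \<le> form rho a" by (rule a(2))
    moreover have "form rho (sr i a) = form rho a - cr i a * form rho (rt i)"
      by (rule additive_sr[OF form_additive])
    moreover have "form rho (rt i) > 0"
      using form_simple[OF i, of rho] root_pair_form_pos[OF root_pair_simple[OF i]] i by (simp add: form_commute)
    ultimately show False using neg by (simp add: zero_le_mult_iff)
  qed
  with a(1) a0(2) show ?thesis unfolding is_dominant_short_def by force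
qed

text \<open>The pairing \<open>x b\<close> is 1 or 2, and 2 means equality. If it were 1, then
  \<open>x - y\<close> would be a coroot with value -1 at \<open>b\<close> and 1 at
  \<open>a\<close>, hence neither positive nor negative as both roots are dominant.\<close>

lemma dominant_short_unique:
  assumes "is_dominant_short a" "is_dominant_short b" shows "a = b"
proof -
  obtain x y where p: "root_pair a x" "root_pair b y"
    using assms root_pairE unfolding is_dominant_short_def by metis
  have dom: "\<And>i. i \<in> I \<Longrightarrow> 0 \<le> cr i a" "\<And>i. i \<in> I \<Longrightarrow> 0 \<le> cr i b"
    using assms by (auto simp: is_dominant_short_def)
  have eq: "form a a = form b b" using assms by (auto simp: is_dominant_short_def intro: antisym)
  have pos: "0 < x b" by (rule dominant_pairing_pos[OF p(1) dom(1) p(2) dom(2)])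
  have ya: "y a = x b"
    using root_pair_form[OF p(1), of b] root_pair_form[OF p(2), of a] form_commute[of a b] eq root_pair_form_pos[OF p(1)]
    by (metis less_irrefl mult_cancel_left)
  have "x b \<noteq> 1"
  proof
    assume 1: "x b = 1"
    then have z: "(\<lambda>v. x v - y v) \<in> coroots D"
      using coroot_reflection[OF p(2) root_pair_coroot[OF p(1)]] by simp
    show False
      using coroot_pos_or_neg[OF z] pos_coroot_ge_0[of "\<lambda>v. x v - y v" b] pos_coroot_ge_0[of "- (\<lambda>v. x v - y v)" a]
        dom 1 ya root_pair_self[OF p(1)] root_pair_self[OF p(2)] by force
  qed
  with pos short_pairing[OF p] eq show ?thesis by simp
qed

lemma phi_short: "is_dominant_short phi"
proof -
  have "phi = (THE a. is_dominant_short a)"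
    unfolding dominant_short_root_def is_dominant_short_def I_def sq_length_form ..
  then show ?thesis using theI'[of is_dominant_short] dominant_short_exists dominant_short_unique by metis
qed

lemma phi_dominant: "i \<in> I \<Longrightarrow> 0 \<le> cr i phi"
  using phi_short by (simp add: is_dominant_short_def)

lemma phi_min: "root_pair a x \<Longrightarrow> form phi phi \<le> form a a"
  using phi_short root_pair_root by (simp add: is_dominant_short_def)

lemma phi_theta: "root_pair phi thet"
proof -
  obtain x where x: "root_pair phi x" using phi_short root_pairE by (metis is_dominant_short_def)
  have "thet = (THE x. root_pair phi x)"
    unfolding theta_def coroot_of_def root_pair_def coaction_comp I_def ..
  then show ?thesis using theI[of "root_pair phi", OF x] root_pair_unique_coroot[OF x] by metis
qed

lemma theta_coroot: "thet \<in> coroots D"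
  using phi_theta by (rule root_pair_coroot)

lemma coroot_phi_le: "x \<in> coroots D \<Longrightarrow> x phi \<le> 2"
  using short_pairing(1)[OF _ phi_theta phi_min] coroot_pairE by metis

lemma coroot_phi_eq_2:
  assumes "x \<in> coroots D" "x phi = 2" shows "x = thet"
proof -
  obtain a where a: "root_pair a x" using assms coroot_pairE by metis
  then have "a = phi" using short_pairing(2)[OF a phi_theta phi_min[OF a]] assms by simp
  with a show ?thesis using phi_theta root_pair_unique_coroot by simp
qed

lemma coroot_minus_theta: "x \<in> coroots D \<Longrightarrow> x phi = 1 \<Longrightarrow> x - thet \<in> coroots D"
  using coroot_reflection[OF phi_theta] by (fastforce simp: fun_diff_def)

lemma coroot_minus_theta_neg:
  assumes "x \<in> coroots D" "x phi = 1" shows "thet - x \<in> pos_coroots D"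
proof -
  have z: "x - thet \<in> coroots D" using coroot_minus_theta[OF assms] .
  have "(x - thet) phi < 0" using assms(2) root_pair_self[OF phi_theta] by simp
  then have "x - thet \<notin> pos_coroots D" using pos_coroot_ge_0[OF _ phi_dominant] by (metis leD)
  then have "- (x - thet) \<in> pos_coroots D" using coroot_pos_or_neg[OF z] by blast
  moreover have "- (x - thet) = thet - x" by auto
  ultimately show ?thesis by metis
qed

text \<open>Among the coroots that dominate \<open>x\<close> coordinatewise take \<open>y\<close> of
  greatest height. Simple reflections cannot raise it, so its root is dominant and
  \<open>y phi\<close> is 1 or 2: in the latter case \<open>y\<close> is \<open>thet\<close>, in the
  former \<open>thet - y\<close> is positive.\<close>

lemma theta_highest:
  assumes x: "x \<in> coroots D" and k: "k \<in> I"
  shows "x (fw k) \<le> thet (fw k)"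
proof -
  let ?S = "{y \<in> coroots D. \<forall>i\<in>I. x (fw i) \<le> y (fw i)}"
  obtain y where y: "y \<in> ?S" "\<And>z. z \<in> ?S \<Longrightarrow> z rho \<le> y rho"
    using finite_maximizer[of ?S "\<lambda>y. y rho"] finite_coroots x by auto
  obtain b where b: "root_pair b y" using y coroot_pairE by blast
  have "0 \<le> y (rt i)" if i: "i \<in> I" for i
  proof (rule ccontr)
    assume neg: "\<not> 0 \<le> y (rt i)"
    have "(y \<circ> sr i) v = y v - cr i v * y (rt i)" for v
      using y additive_sr[OF coroot_additive] by simp
    then have "y \<circ> sr i \<in> ?S" "(y \<circ> sr i) rho > y rho"
      using y(1) i neg coroot_comp[OF _ Wf_sr] by fastforce+
    with y(2) show False by force
  qed
  then have dom: "0 \<le> cr i b" if "i \<in> I" for i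
    using root_pair_dual_dominant[OF b that] that root_pair_form_pos[OF b] root_pair_form_pos[OF root_pair_simple[OF that]]
    by (metis zero_le_mult_iff less_imp_le not_less)
  have "0 < y phi" by (rule dominant_pairing_pos[OF b dom phi_theta phi_dominant])
  moreover have "y phi \<le> 2" using y coroot_phi_le by blast
  ultimately consider "y phi = 2" | "y phi = 1" by linarith
  then have "y (fw k) \<le> thet (fw k)"
  proof cases
    case 1
    then have "y = thet" using coroot_phi_eq_2[of y] y(1) by blast
    then show ?thesis by simp
  next
    case 2
    then show ?thesis using coroot_minus_theta_neg y k by (force simp: pos_coroots_iff)
  qed
  with y k show ?thesis by fastforce
qed

section \<open>The extended affine Weyl group\<close>

abbreviation "E \<equiv> ext_weyl D"
abbreviation ext_mult (infixl "\<cdot>" 70) where "u \<cdot> v \<equiv> u \<otimes>\<^bsub>E\<^esub> v"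
abbreviation ext_inv where "ext_inv u \<equiv> inv\<^bsub>E\<^esub> u"
abbreviation "EC \<equiv> carrier E"
abbreviation "e1 \<equiv> \<one>\<^bsub>E\<^esub>"
abbreviation "act \<equiv> affine_action"
abbreviation "S \<equiv> affine_simple_refl D"
abbreviation "sroot \<equiv> affine_simple_root D"
definition "I0 = {0..rank D}"

lemma ext_mult_eq: "u \<cdot> v = (fst u + snd u (fst v), snd u \<circ> snd v)"
  by (simp add: ext_weyl_def case_prod_unfold)

lemma ext_one_eq: "e1 = (0, id)"
  by (simp add: ext_weyl_def)

lemma ext_carrier: "u \<in> EC \<longleftrightarrow> snd u \<in> Wf"
  by (cases u) (simp add: ext_weyl_def)

lemma group_E: "group E"
proof (rule groupI)
  fix u assume u: "u \<in> EC"
  then have "(- winv (snd u) (fst u), winv (snd u)) \<cdot> u = e1"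
    by (simp add: ext_mult_eq ext_one_eq ext_carrier Wf_winv_comp)
  then show "\<exists>v\<in>carrier E. v \<cdot> u = e1"
    using u by (metis ext_carrier Wf_winv snd_conv)
qed (auto simp: ext_mult_eq ext_one_eq ext_carrier Wf_comp comp_assoc
    additive.zero[OF Wf_additive] additive.add[OF Wf_additive] add.assoc)

sublocale E: group E by (rule group_E)

section \<open>Affine roots and their heights\<close>

definition R :: "'y affine_coweight set" where "R = coroots D \<times> UNIV"

lemma act_eq: "act u \<alpha> = (fst \<alpha> \<circ> winv (snd u), snd \<alpha> - fst \<alpha> (winv (snd u) (fst u)))"
  by (cases u; cases \<alpha>) (simp add: affine_action_def coaction_comp)

lemma R_additive: "\<alpha> \<in> R \<Longrightarrow> additive (fst \<alpha>)"
  by (auto simp: R_def coroot_additive)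

lemma act_R: "u \<in> EC \<Longrightarrow> \<alpha> \<in> R \<Longrightarrow> act u \<alpha> \<in> R"
  by (auto simp: act_eq R_def ext_carrier coroot_comp Wf_winv)

lemma act_mult: "u \<in> EC \<Longrightarrow> v \<in> EC \<Longrightarrow> \<alpha> \<in> R \<Longrightarrow> act (u \<cdot> v) \<alpha> = act u (act v \<alpha>)"
  using additive.add[OF R_additive, of \<alpha>]
  by (simp add: act_eq ext_mult_eq ext_carrier winv_comp comp_assoc
      additive.add[OF Wf_additive[OF Wf_winv]] Wf_winv)

lemma act_one [simp]: "\<alpha> \<in> R \<Longrightarrow> act e1 \<alpha> = \<alpha>"
  using additive.zero[OF R_additive, of \<alpha>] by (simp add: act_eq ext_one_eq inv_id)

lemma act_inv [simp]:
  assumes "u \<in> EC" "\<alpha> \<in> R"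
  shows "act (ext_inv u) (act u \<alpha>) = \<alpha>" "act u (act (ext_inv u) \<alpha>) = \<alpha>"
  using assms act_mult[of "ext_inv u" u \<alpha>] act_mult[of u "ext_inv u" \<alpha>] by simp_all

text \<open>The simple coroots separate points of \<open>Y\<close>, so the linear and the
  translation part of an element can be read from the images of the roots \<open>(cr i, 0)\<close>.
  Identities in W_e may therefore be checked on roots.\<close>

lemma act_faithful:
  assumes "u \<in> EC" "v \<in> EC" "\<And>\<alpha>. \<alpha> \<in> R \<Longrightarrow> act u \<alpha> = act v \<alpha>"
  shows "u = v"
proof -
  have eq: "cr i (winv (snd u) y) = cr i (winv (snd v) y)" "cr i (winv (snd u) (fst u)) = cr i (winv (snd v) (fst v))"
    if "i \<in> I" for i y
    using assms(3)[of "(cr i, 0)"] that by (auto simp: R_def cr_coroot act_eq dest: fun_cong[of _ _ y])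
  have "winv (snd u) = winv (snd v)"
    by (rule ext, rule weight_ext) (rule eq)
  moreover have "winv (snd u) (fst u) = winv (snd v) (fst v)"
    by (rule weight_ext) (rule eq)
  ultimately have "snd u = snd v" "fst u = fst v"
    using assms(1,2) unfolding ext_carrier by (metis winv_winv, metis Wf_winv_apply(2))
  then show ?thesis by (simp add: prod_eq_iff)
qed

text \<open>The Coxeter number. This value gives the affine simple root \<open>(- thet, 1)\<close>
  height \<open>- thet rho + Hc = 1\<close>, like the finite ones.\<close>

definition Hc :: int where "Hc = thet rho + 1"

text \<open>Let the pair \<open>(l, w)\<close> act on rational points by \<open>w\<close> followed
  by translation by \<open>l\<close>. Then \<open>eta\<close> is \<open>Hc\<close> times the image
  of the alcove point rho / Hc under the inverse of the element; the scaling keeps it in the lattice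
  \<open>Y\<close>.\<close>

definition eta :: "'y weyl_elt \<Rightarrow> 'y" where
  "eta w = winv (snd w) (rho - int_mult Hc (fst w))"

text \<open>\<open>ev w \<alpha>\<close> is the height of \<open>w \<alpha>\<close>, normalised so that all affine simple roots have height 1.\<close>

definition ev :: "'y weyl_elt \<Rightarrow> 'y affine_coweight \<Rightarrow> int" where
  "ev w \<alpha> = fst \<alpha> (eta w) + snd \<alpha> * Hc"

abbreviation ht :: "'y affine_coweight \<Rightarrow> int" where "ht \<equiv> ev e1"

lemma ht_eq: "ht \<alpha> = fst \<alpha> rho + snd \<alpha> * Hc"
proof -
  have "int_mult Hc (0::'y) = 0" by (simp add: int_mult_def)
  then show ?thesis by (simp add: ev_def eta_def ext_one_eq inv_id)
qed

lemma ev_ht: "w \<in> EC \<Longrightarrow> \<alpha> \<in> R \<Longrightarrow> ev w \<alpha> = ht (act w \<alpha>)"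
  by (simp add: ht_eq) (simp add: ev_def eta_def act_eq ext_carrier
      additive.diff[OF Wf_additive[OF Wf_winv]] additive_int_mult_group[OF Wf_additive[OF Wf_winv]]
      additive.diff[OF R_additive] additive_int_mult[OF R_additive] algebra_simps)

lemma ev_mult: "u \<in> EC \<Longrightarrow> v \<in> EC \<Longrightarrow> \<alpha> \<in> R \<Longrightarrow> ev (u \<cdot> v) \<alpha> = ev u (act v \<alpha>)"
  by (simp only: ev_ht[of "u \<cdot> v"] ev_ht[of u "act v \<alpha>"] act_mult act_R E.m_closed)

lemma theta_pos: "thet \<in> pos_coroots D"
  using dominant_full_support[OF phi_theta phi_dominant] theta_coroot
  by (simp add: pos_coroots_iff less_imp_le)

lemma Hc_pos: "Hc > 1"
  using theta_pos theta_coroot by (simp add: Hc_def pos_coroots_rho)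

lemma coroot_rho_bound: "x \<in> coroots D \<Longrightarrow> x rho < Hc" "x \<in> coroots D \<Longrightarrow> - Hc < x rho"
proof -
  have *: "x rho < Hc" if "x \<in> coroots D" for x
    using that theta_highest[OF that] theta_coroot by (simp add: Hc_def coroot_rho sum_mono)
  show "x \<in> coroots D \<Longrightarrow> x rho < Hc" by (rule *)
  show "x \<in> coroots D \<Longrightarrow> - Hc < x rho" using *[of "- x"] coroot_uminus by fastforce
qed

lemma Hc_mult: "0 < k \<Longrightarrow> Hc \<le> k * Hc" "k < 0 \<Longrightarrow> k * Hc \<le> - Hc"
  using Hc_pos mult_right_mono[of 1 k Hc] mult_right_mono[of k "- 1" Hc] by simp_all

text \<open>Finite heights lie strictly between \<open>- Hc\<close> and \<open>Hc\<close>, so a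
  nonzero level \<open>k\<close> outweighs them: the lexicographic description of the positive
  affine roots becomes a single inequality.\<close>

lemma pos_root_cases:
  assumes "(x, k) \<in> R"
  shows "0 < ht (x, k) \<longleftrightarrow> 0 < k \<or> (k = 0 \<and> x \<in> pos_coroots D)"
    and "ht (x, k) \<noteq> 0"
proof -
  have x: "x \<in> coroots D" using assms by (simp add: R_def)
  note b = coroot_rho_bound[OF x] coroot_pos_or_neg[OF x] pos_coroots_rho[OF x]
  have "k * Hc = 0" if "k = 0" using that by simp
  then show "0 < ht (x, k) \<longleftrightarrow> 0 < k \<or> (k = 0 \<and> x \<in> pos_coroots D)" "ht (x, k) \<noteq> 0"
    using b Hc_mult[of k] unfolding ht_eq fst_conv snd_conv by linarith+
qed

lemma ev_nonzero: "w \<in> EC \<Longrightarrow> \<alpha> \<in> R \<Longrightarrow> ev w \<alpha> \<noteq> 0"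
  using pos_root_cases(2)[of "fst (act w \<alpha>)" "snd (act w \<alpha>)"] act_R[of w \<alpha>] by (simp add: ev_ht[of w])

lemma affine_pos_roots_eq: "affine_pos_roots D = {\<alpha> \<in> R. 0 < ht \<alpha>}"
  using pos_root_cases(1) by (auto simp: affine_pos_roots_def R_def pos_coroots_iff)

lemma R_uminus: "\<alpha> \<in> R \<Longrightarrow> - \<alpha> \<in> R"
  by (auto simp: R_def coroot_uminus)

lemma ev_uminus [simp]: "ev w (- \<alpha>) = - ev w \<alpha>"
  by (cases \<alpha>) (simp add: ev_def)

lemma uminus_uminus_root [simp]: "- (- \<alpha>) = (\<alpha> :: 'y affine_coweight)"
  by (cases \<alpha>) auto

lemma act_uminus: "act u (- \<alpha>) = - act u \<alpha>" for u :: "'y weyl_elt"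
  by (simp add: act_eq prod_eq_iff fun_eq_iff)

lemma affine_neg_roots_eq: "affine_neg_roots D = {\<alpha> \<in> R. ht \<alpha> < 0}"
proof -
  have "\<alpha> \<in> uminus ` {\<alpha> \<in> R. 0 < ht \<alpha>}" if "\<alpha> \<in> R" "ht \<alpha> < 0" for \<alpha>
    using that R_uminus by (intro image_eqI[of _ _ "- \<alpha>"]) auto
  moreover have "- \<alpha> \<in> R \<and> ht (- \<alpha>) < 0" if "\<alpha> \<in> R" "0 < ht \<alpha>" for \<alpha>
    using that R_uminus[of \<alpha>] ev_uminus[of _ \<alpha>] by simp
  ultimately show ?thesis unfolding affine_neg_roots_def affine_pos_roots_eq by blast
qed

section \<open>Inversion sets and length\<close>

definition N :: "'y weyl_elt \<Rightarrow> 'y affine_coweight set" where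
  "N w = {\<alpha> \<in> R. 0 < ht \<alpha> \<and> ev w \<alpha> < 0}"

lemma weyl_length_N: "w \<in> EC \<Longrightarrow> weyl_length D w = card (N w)"
proof -
  assume w: "w \<in> EC"
  have "affine_neg_roots D \<inter> act w ` affine_pos_roots D = act w ` N w"
    using w by (auto simp: affine_neg_roots_eq affine_pos_roots_eq N_def ev_ht[OF w] act_R)
  moreover have "inj_on (act w) (N w)"
    by (rule inj_on_inverseI[of _ "act (ext_inv w)"]) (use w in \<open>auto simp: N_def\<close>)
  ultimately show ?thesis by (simp add: weyl_length_def card_image)
qed

lemma finite_N: "finite (N w)"
proof (rule finite_subset)
  show "N w \<subseteq> (SIGMA x:coroots D. {0..- x (eta w)})"
  proof clarify
    fix x k assume a: "(x, k) \<in> N w"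
    then have R: "(x, k) \<in> R" and h: "0 < ht (x, k)" and e: "x (eta w) + k * Hc < 0"
      by (auto simp: N_def ev_def)
    then have k: "k \<ge> 0" using pos_root_cases(1) by fastforce
    then have "k \<le> k * Hc" using Hc_pos by (simp add: mult_le_cancel_left1)
    with e k R show "x \<in> coroots D \<and> k \<in> {0..- x (eta w)}" by (simp add: R_def)
  qed
qed (simp add: finite_coroots)

subsection \<open>Simple affine reflections\<close>

definition sub_mult :: "'y affine_coweight \<Rightarrow> int \<Rightarrow> 'y affine_coweight \<Rightarrow> 'y affine_coweight" where
  "sub_mult \<alpha> c \<beta> = (\<lambda>v. fst \<alpha> v - c * fst \<beta> v, snd \<alpha> - c * snd \<beta>)"

lemma ev_sub_mult: "ev w (sub_mult \<alpha> c \<beta>) = ev w \<alpha> - c * ev w \<beta>"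
  by (simp add: ev_def sub_mult_def algebra_simps)

lemma act_sub_mult: "act w (sub_mult \<alpha> c \<beta>) = sub_mult (act w \<alpha>) c (act w \<beta>)"
  by (auto simp: act_eq sub_mult_def algebra_simps)

text \<open>The root whose coroot is the finite part of \<open>sroot i\<close>; this explains the
  sign at 0.\<close>

definition aroot :: "nat \<Rightarrow> 'y" where
  "aroot i = (if i = 0 then - phi else rt i)"

lemma I0_cases: "i \<in> I0 \<Longrightarrow> i = 0 \<or> i \<in> I"
  by (auto simp: I_def I0_def)

lemma I_I0: "i \<in> I \<Longrightarrow> i \<in> I0" "i \<in> I \<Longrightarrow> i \<noteq> 0" "0 \<in> I0"
  by (auto simp: I_def I0_def)

lemma sroot_0: "sroot 0 = (- thet, 1)"
  by (simp add: affine_simple_root_def)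

lemma sroot_I: "i \<in> I \<Longrightarrow> sroot i = (cr i, 0)"
  using I_I0 by (auto simp: affine_simple_root_def)

lemma root_pair_aroot: "i \<in> I0 \<Longrightarrow> root_pair (aroot i) (fst (sroot i))"
proof -
  assume "i \<in> I0"
  then consider "i = 0" | "i \<in> I" using I0_cases by blast
  then show ?thesis
  proof cases
    case 1
    then show ?thesis using root_pair_uminus[OF phi_theta]
      by (simp add: aroot_def sroot_0 fun_Compl_def)
  next
    case 2
    then show ?thesis using root_pair_simple[OF 2] I_I0(2)[OF 2] by (simp add: aroot_def sroot_I)
  qed
qed

lemma sroot_R: "i \<in> I0 \<Longrightarrow> sroot i \<in> R"
  using root_pair_coroot[OF root_pair_aroot, of i] by (simp add: R_def mem_Times_iff)

lemma S_carrier: "i \<in> I0 \<Longrightarrow> S i \<in> EC"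
  using I0_cases[of i] reflection_Wf[OF phi_theta]
  by (auto simp: affine_simple_refl_def ext_carrier)

lemma ht_sroot: "i \<in> I0 \<Longrightarrow> ht (sroot i) = 1"
  using I0_cases[of i] by (auto simp: ht_eq sroot_0 sroot_I Hc_def)

lemma act_S: "i \<in> I0 \<Longrightarrow> \<alpha> \<in> R \<Longrightarrow> act (S i) \<alpha> = sub_mult \<alpha> (fst \<alpha> (aroot i)) (sroot i)"
proof -
  assume i: "i \<in> I0" and \<alpha>: "\<alpha> \<in> R"
  note ad = R_additive[OF \<alpha>]
  show ?thesis
  proof (cases "i = 0")
    case True
    then show ?thesis
      using root_pair_self[OF phi_theta]
      by (auto simp: act_eq affine_simple_refl_def sub_mult_def aroot_def sroot_0 winv_reflection[OF phi_theta]
          reflection_apply[OF ad] additive.minus[OF ad] algebra_simps)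
  next
    case False
    then have "i \<in> I" using i I0_cases by blast
    then show ?thesis using False
      by (auto simp: act_eq affine_simple_refl_def sub_mult_def aroot_def sroot_I additive_sr[OF ad]
          additive.zero[OF ad] additive.zero[OF sr_additive] algebra_simps)
  qed
qed

lemma act_S_sroot: "i \<in> I0 \<Longrightarrow> act (S i) (sroot i) = - sroot i"
  using root_pair_self[OF root_pair_aroot]
  by (auto simp: act_S sroot_R sub_mult_def prod_eq_iff)

lemma S_S [simp]: "i \<in> I0 \<Longrightarrow> S i \<cdot> S i = e1"
proof (rule act_faithful)
  fix \<alpha> assume i: "i \<in> I0" and \<alpha>: "\<alpha> \<in> R"
  have "act (S i) \<alpha> \<in> R" using i \<alpha> act_R S_carrier by blast
  then have "act (S i) (act (S i) \<alpha>) = sub_mult (act (S i) \<alpha>) (fst (act (S i) \<alpha>) (aroot i)) (sroot i)"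
    using i by (simp add: act_S)
  also have "\<dots> = \<alpha>"
    using i \<alpha> root_pair_self[OF root_pair_aroot[OF i]] by (cases \<alpha>) (auto simp: act_S sub_mult_def)
  finally show "act (S i \<cdot> S i) \<alpha> = act e1 \<alpha>"
    using i \<alpha> by (simp add: act_mult S_carrier)
qed (simp_all add: S_carrier)

lemma inv_S [simp]: "i \<in> I0 \<Longrightarrow> ext_inv (S i) = S i"
  by (rule E.inv_equality) (simp_all add: S_carrier)

text \<open>The coroot system is reduced: a coroot is a simple one composed with a Weyl group
  element and so takes the value 1 on some weight; a nonnegative multiple of \<open>cr i\<close>
  with this property is \<open>cr i\<close>.\<close>

lemma pos_multiple_simple:
  assumes x: "x \<in> pos_coroots D" and i: "i \<in> I" and z: "\<And>j. j \<in> I \<Longrightarrow> j \<noteq> i \<Longrightarrow> x (fw j) = 0"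
  shows "x = cr i"
proof -
  have xc: "x \<in> coroots D" using x by (simp add: pos_coroots_iff)
  have eq: "x y = x (fw i) * cr i y" for y
  proof -
    have "x y = (\<Sum>j\<in>I. if j = i then x (fw i) * cr i y else 0)"
      unfolding coweight_expansion[OF coroot_additive[OF xc], of y] by (intro sum.cong) (auto simp: z)
    then show ?thesis using i by simp
  qed
  obtain w k where w: "w \<in> Wf" "k \<in> I" "x = cr k \<circ> w" using xc unfolding coroots_eq by blast
  then have "1 = x (winv w (fw k))" by simp
  also have "\<dots> = x (fw i) * cr i (winv w (fw k))" by (rule eq)
  finally have "x (fw i) dvd 1" by (metis dvd_triv_left)
  moreover have "0 \<le> x (fw i)" using x i by (simp add: pos_coroots_iff)
  ultimately have "x (fw i) = 1" by (simp add: zdvd1_eq)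
  with eq show ?thesis by (auto intro!: ext)
qed

text \<open>For finite \<open>i\<close> the level and the other simple coordinates are unchanged, so
  some positive coordinate survives unless the root is \<open>sroot i\<close>. For
  \<open>i = 0\<close> the level becomes \<open>k + m\<close> with \<open>m = x phi\<close> at least
  -2; it can fail to be positive only for \<open>k\<close> at most 2, where
  \<open>coroot_phi_eq_2\<close> and \<open>coroot_minus_theta_neg\<close> decide.\<close>

lemma S_permutes_pos:
  assumes i: "i \<in> I0" and \<alpha>: "\<alpha> \<in> R" "0 < ht \<alpha>" and ne: "\<alpha> \<noteq> sroot i"
  shows "0 < ht (act (S i) \<alpha>)"
proof -
  obtain x k where xk: "\<alpha> = (x, k)" by (cases \<alpha>)
  have x: "x \<in> coroots D" using \<alpha> xk by (simp add: R_def)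
  have R': "act (S i) \<alpha> \<in> R" using i \<alpha> act_R S_carrier by blast
  define x' k' where "x' = (\<lambda>v. x v - x (aroot i) * fst (sroot i) v)" and "k' = k - x (aroot i) * snd (sroot i)"
  have a: "act (S i) \<alpha> = (x', k')" using i \<alpha> xk by (simp add: act_S sub_mult_def x'_def k'_def)
  have x': "x' \<in> coroots D" using R' a by (simp add: R_def)
  have pos: "0 < k \<or> (k = 0 \<and> x \<in> pos_coroots D)" using pos_root_cases(1)[of x k] \<alpha> xk by blast
  have "0 < k' \<or> (k' = 0 \<and> x' \<in> pos_coroots D)"
  proof (cases "i = 0")
    case True
    define m where "m = x phi"
    have ma: "x (aroot i) = - m" using True by (simp add: aroot_def m_def additive.minus[OF coroot_additive[OF x]])
    have k': "k' = k + m" and xx: "x' = (\<lambda>v. x v - m * thet v)"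
      using True ma by (auto simp: k'_def x'_def sroot_0)
    have mb: "- 2 \<le> m" using coroot_phi_le[OF coroot_uminus[OF x]] by (simp add: m_def)
    show ?thesis
    proof (cases "k = 0")
      case True
      then have "x \<in> pos_coroots D" using pos by simp
      moreover from this have "0 \<le> m" unfolding m_def by (rule pos_coroot_ge_0) (rule phi_dominant)
      ultimately show ?thesis using True k' xx by (cases "m = 0") auto
    next
      case False
      then have "k \<ge> 1" using pos by simp
      with mb consider "k + m > 0" | "k = 1" "m = -1" | "k = 1" "m = -2" | "k = 2" "m = -2" by force
      then show ?thesis
      proof cases
        case 1
        then show ?thesis using k' by simp
      next
        case 2
        then have "thet - (- x) \<in> pos_coroots D"
          by (intro coroot_minus_theta_neg coroot_uminus x) (simp add: m_def)
        moreover have "thet - (- x) = x'" using 2 xx by auto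
        ultimately show ?thesis using 2 k' by simp
      next
        case 3
        then have "- x = thet" by (intro coroot_phi_eq_2 coroot_uminus x) (simp add: m_def)
        then have "x = - thet" unfolding fun_eq_iff by (metis add.inverse_inverse uminus_apply)
        then have "\<alpha> = sroot i" using 3 \<open>i = 0\<close> xk sroot_0 by simp
        with ne show ?thesis by simp
      next
        case 4
        then have "- x = thet" by (intro coroot_phi_eq_2 coroot_uminus x) (simp add: m_def)
        then have "x v = - thet v" for v by (metis add.inverse_inverse uminus_apply)
        then have "x' = thet" using xx 4 by auto
        then show ?thesis using theta_pos k' 4 by simp
      qed
    qed
  next
    case False
    then have iI: "i \<in> I" using i I0_cases by blast
    have k': "k' = k" by (simp add: k'_def sroot_I[OF iI])
    show ?thesis
    proof (cases "k = 0")
      case True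
      then have xp: "x \<in> pos_coroots D" using pos by simp
      have "x \<noteq> cr i" using ne xk True sroot_I[OF iI] by simp
      then obtain j where j: "j \<in> I" "j \<noteq> i" "x (fw j) \<noteq> 0" using pos_multiple_simple[OF xp iI] by blast
      then have "x' (fw j) > 0" using xp iI by (auto simp: x'_def sroot_I pos_coroots_iff order_less_le)
      then have "x' \<in> pos_coroots D" using coroot_signs[OF x'] x' j by (force simp: pos_coroots_iff)
      then show ?thesis using k' True by simp
    qed (use pos k' in simp)
  qed
  then show ?thesis using pos_root_cases(1)[of x' k'] R' a by simp
qed

lemma finite_descent:
  assumes "w \<in> EC" "\<And>i. i \<in> I \<Longrightarrow> 0 < ev w (cr i, 0)" "x \<in> pos_coroots D"
  shows "0 < ev w (x, 0)"
proof -
  have x: "x \<in> coroots D" using assms(3) by (simp add: pos_coroots_iff)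
  have "0 \<le> cr i (eta w)" if "i \<in> I" for i using assms(2)[OF that] by (simp add: ev_def)
  then have "0 \<le> x (eta w)" by (rule pos_coroot_ge_0[OF assms(3)])
  moreover have "ev w (x, 0) \<noteq> 0" using ev_nonzero[OF assms(1)] x by (simp add: R_def)
  ultimately show ?thesis by (simp add: ev_def)
qed

text \<open>Without a descent, \<open>eta w\<close> is positive on the simple coroots and
  \<open>thet\<close> is less than \<open>Hc\<close> there, so it lies inside the scaled fundamental
  alcove. By \<open>theta_highest\<close> every coroot then exceeds \<open>- Hc\<close> at it, and
  no positive affine root can be inverted.\<close>

lemma descent_exists:
  assumes w: "w \<in> EC" and "N w \<noteq> {}"
  shows "\<exists>i\<in>I0. ev w (sroot i) < 0"
proof (rule ccontr)
  assume "\<not> ?thesis"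
  then have pos: "0 < ev w (sroot i)" if "i \<in> I0" for i
    using that ev_nonzero[OF w sroot_R] by fastforce
  then have posI: "0 < cr i (eta w)" if "i \<in> I" for i
    using that pos[OF I_I0(1)] by (fastforce simp: sroot_I ev_def)
  have th: "thet (eta w) < Hc" using pos[OF I_I0(3)] by (simp add: sroot_0 ev_def)
  obtain x k where xk: "(x, k) \<in> R" "0 < ht (x, k)" "ev w (x, k) < 0"
    using assms(2) unfolding N_def by fastforce
  have x: "x \<in> coroots D" using xk by (simp add: R_def)
  have "- x (eta w) \<le> thet (eta w)"
  proof -
    have "- x (eta w) = (\<Sum>i\<in>I. (- x) (fw i) * cr i (eta w))"
      by (subst coweight_expansion[OF coroot_additive[OF x], of "eta w"]) (simp add: sum_negf)
    also have "\<dots> \<le> (\<Sum>i\<in>I. thet (fw i) * cr i (eta w))"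
      by (intro sum_mono mult_right_mono theta_highest coroot_uminus x) (use posI in \<open>auto simp: less_imp_le\<close>)
    also have "\<dots> = thet (eta w)" by (rule coweight_expansion[OF coroot_additive[OF theta_coroot], symmetric])
    finally show ?thesis .
  qed
  then have "0 < ev w (x, k)" if "0 < k"
    using th Hc_mult(1)[OF that] by (simp add: ev_def)
  moreover have "0 < ev w (x, k)" if "k = 0" "x \<in> pos_coroots D"
    using finite_descent[OF w _ that(2)] posI that by (simp add: ev_def)
  ultimately show False using pos_root_cases(1)[OF xk(1)] xk by force
qed

lemma pos_root_iff: "\<alpha> \<in> R \<Longrightarrow> 0 < ht \<alpha> \<longleftrightarrow> 0 < snd \<alpha> \<or> (snd \<alpha> = 0 \<and> fst \<alpha> \<in> pos_coroots D)"
  using pos_root_cases(1)[of "fst \<alpha>" "snd \<alpha>"] by simp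

definition len :: "'y weyl_elt \<Rightarrow> nat" where "len w = card (N w)"

lemma weyl_length_len: "w \<in> EC \<Longrightarrow> weyl_length D w = len w"
  by (simp add: weyl_length_N len_def)

lemma ext_cancel [simp]:
  assumes "u \<in> EC" "v \<in> EC"
  shows "ext_inv u \<cdot> (u \<cdot> v) = v" "u \<cdot> (ext_inv u \<cdot> v) = v"
  using assms by (simp_all add: E.m_assoc[symmetric])

lemma mult_S_S [simp]: "w \<in> EC \<Longrightarrow> i \<in> I0 \<Longrightarrow> w \<cdot> S i \<cdot> S i = w"
  by (simp add: E.m_assoc S_carrier)

lemma S_mult_S [simp]: "w \<in> EC \<Longrightarrow> i \<in> I0 \<Longrightarrow> S i \<cdot> (S i \<cdot> w) = w"
  by (simp add: E.m_assoc[symmetric] S_carrier)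

subsection \<open>Reflections and length\<close>

text \<open>The root is kept beside the reflection so that lengths can be compared by the sign of
  \<open>ev\<close>; \<open>reflects_uminus\<close> gives the opposite root.\<close>

definition reflects :: "'y weyl_elt \<Rightarrow> 'y affine_coweight \<Rightarrow> bool" where
  "reflects t \<beta> \<longleftrightarrow> (\<exists>w\<in>carrier E. \<exists>i\<in>I0. t = w \<cdot> S i \<cdot> ext_inv w \<and> \<beta> = act w (sroot i))"

lemma reflects_act:
  assumes "reflects t \<beta>"
  obtains b where "root_pair b (fst \<beta>)" "\<And>\<alpha>. \<alpha> \<in> R \<Longrightarrow> act t \<alpha> = sub_mult \<alpha> (fst \<alpha> b) \<beta>"
proof -
  obtain w i where w: "w \<in> EC" "i \<in> I0" "t = w \<cdot> S i \<cdot> ext_inv w" "\<beta> = act w (sroot i)"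
    using assms unfolding reflects_def by blast
  have Wf: "snd w \<in> Wf" using w by (simp add: ext_carrier)
  show ?thesis
  proof (rule that[of "snd w (aroot i)"])
    show "root_pair (snd w (aroot i)) (fst \<beta>)"
      using root_pair_Wf[OF root_pair_aroot[OF w(2)] Wf] by (simp add: w(4) act_eq)
    fix \<alpha> assume \<alpha>: "\<alpha> \<in> R"
    define \<alpha>' where "\<alpha>' = act (ext_inv w) \<alpha>"
    have \<alpha>': "\<alpha>' \<in> R" "\<alpha> = act w \<alpha>'" using \<alpha> w(1) by (simp_all add: \<alpha>'_def act_R)
    have "act t \<alpha> = act w (act (S i) \<alpha>')"
      using w \<alpha> by (simp add: act_mult S_carrier act_R \<alpha>'_def)
    also have "\<dots> = sub_mult \<alpha> (fst \<alpha>' (aroot i)) \<beta>"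
      using w \<alpha>' by (simp add: act_S act_sub_mult)
    also have "fst \<alpha>' (aroot i) = fst \<alpha> (snd w (aroot i))"
      using Wf by (simp add: \<alpha>'(2) act_eq)
    finally show "act t \<alpha> = sub_mult \<alpha> (fst \<alpha> (snd w (aroot i))) \<beta>" .
  qed
qed

lemma reflects_carrier: "reflects t \<beta> \<Longrightarrow> t \<in> EC"
  and reflects_R: "reflects t \<beta> \<Longrightarrow> \<beta> \<in> R"
  unfolding reflects_def by (auto simp: S_carrier act_R sroot_R)

lemma reflects_self: assumes "reflects t \<beta>" shows "act t \<beta> = - \<beta>"
proof (rule reflects_act[OF assms])
  fix b assume "root_pair b (fst \<beta>)" "\<And>\<alpha>. \<alpha> \<in> R \<Longrightarrow> act t \<alpha> = sub_mult \<alpha> (fst \<alpha> b) \<beta>"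
  then show ?thesis
    using root_pair_self reflects_R[OF assms] by (auto simp: sub_mult_def prod_eq_iff)
qed

lemma reflects_involution: assumes "reflects t \<beta>" shows "t \<cdot> t = e1"
proof -
  obtain w i where w: "w \<in> EC" "i \<in> I0" "t = w \<cdot> S i \<cdot> ext_inv w"
    using assms unfolding reflects_def by blast
  then show ?thesis by (simp add: E.m_assoc S_carrier)
qed

lemma reflects_S: "i \<in> I0 \<Longrightarrow> reflects (S i) (sroot i)"
  unfolding reflects_def by (rule bexI[of _ "e1"]) (auto simp: S_carrier sroot_R intro!: bexI[of _ i])

lemma reflects_conj:
  assumes "reflects t \<beta>" "g \<in> EC"
  shows "reflects (g \<cdot> t \<cdot> ext_inv g) (act g \<beta>)"
proof -
  obtain w i where w: "w \<in> EC" "i \<in> I0" "t = w \<cdot> S i \<cdot> ext_inv w" "\<beta> = act w (sroot i)"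
    using assms unfolding reflects_def by blast
  then show ?thesis
    unfolding reflects_def using assms(2)
    by (intro bexI[of _ "g \<cdot> w"] bexI[of _ i]) (simp_all add: E.m_assoc E.inv_mult_group S_carrier act_mult sroot_R)
qed

lemma reflects_uminus: assumes "reflects t \<beta>" shows "reflects t (- \<beta>)"
proof -
  have t: "t \<in> EC" using assms by (rule reflects_carrier)
  then have "t \<cdot> t \<cdot> ext_inv t = t" by (simp add: E.m_assoc)
  then show ?thesis using reflects_conj[OF assms t] reflects_self[OF assms] by simp
qed

lemma reflects_pos: assumes "reflects t \<beta>" obtains \<gamma> where "reflects t \<gamma>" "0 < ht \<gamma>"
  using assms reflects_uminus[OF assms] ev_nonzero[of "e1" \<beta>] reflects_R[OF assms]
  by (metis E.one_closed ev_uminus linorder_neqE neg_0_less_iff_less)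

lemma reflects_unique:
  assumes "reflects t \<beta>" "reflects t' \<beta>" shows "t = t'"
proof (rule act_faithful)
  fix \<alpha> assume \<alpha>: "\<alpha> \<in> R"
  obtain b where b: "root_pair b (fst \<beta>)" "\<And>\<alpha>. \<alpha> \<in> R \<Longrightarrow> act t \<alpha> = sub_mult \<alpha> (fst \<alpha> b) \<beta>"
    using reflects_act[OF assms(1)] by metis
  obtain b' where b': "root_pair b' (fst \<beta>)" "\<And>\<alpha>. \<alpha> \<in> R \<Longrightarrow> act t' \<alpha> = sub_mult \<alpha> (fst \<alpha> b') \<beta>"
    using reflects_act[OF assms(2)] by metis
  have "b = b'" using b(1) b'(1) by (rule root_pair_unique_root)
  with b b' \<alpha> show "act t \<alpha> = act t' \<alpha>" by simp
qed (use assms reflects_carrier in auto)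

lemma ev_inv_act: "w \<in> EC \<Longrightarrow> \<alpha> \<in> R \<Longrightarrow> ev (ext_inv w) (act w \<alpha>) = ht \<alpha>"
  using ev_mult[of "ext_inv w" w \<alpha>] by simp

text \<open>For an inversion of \<open>w\<close>, either its pairing with \<beta> is positive and it
  remains an inversion of \<open>w t\<close>, or its image under \<open>t\<close> is still positive
  and is inverted by \<open>w t\<close>. The root \<beta> itself is a new inversion.\<close>

lemma len_reflect:
  assumes w: "w \<in> EC" and t: "reflects t \<beta>" and ht: "0 < ht \<beta>" and ev: "0 < ev w \<beta>"
  shows "len w < len (w \<cdot> t)"
proof -
  note tE = reflects_carrier[OF t] and \<beta> = reflects_R[OF t]
  obtain b where b: "\<And>\<alpha>. \<alpha> \<in> R \<Longrightarrow> act t \<alpha> = sub_mult \<alpha> (fst \<alpha> b) \<beta>"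
    using reflects_act[OF t] by metis
  have tt: "act t (act t \<alpha>) = \<alpha>" if "\<alpha> \<in> R" for \<alpha>
    using that act_mult[OF tE tE that] reflects_involution[OF t] by simp
  have evt: "ev (w \<cdot> t) \<alpha> = ev w (act t \<alpha>)" "ev (w \<cdot> t) (act t \<alpha>) = ev w \<alpha>" if "\<alpha> \<in> R" for \<alpha>
    using that tt w tE by (simp_all add: ev_mult act_R)
  have "card (N w) < card (N (w \<cdot> t))"
  proof (rule card_less_swap[where f = "act t" and b = \<beta>])
    fix \<alpha> assume "\<alpha> \<in> N w"
    then have \<alpha>: "\<alpha> \<in> R" "0 < ht \<alpha>" "ev w \<alpha> < 0" by (auto simp: N_def)
    define c where "c = fst \<alpha> b"
    have tR: "act t \<alpha> \<in> R" using \<alpha> tE by (simp add: act_R)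
    show "act t (act t \<alpha>) = \<alpha>" using tt \<alpha> by simp
    show "\<alpha> \<in> N (w \<cdot> t) \<or> act t \<alpha> \<in> N (w \<cdot> t)"
    proof (cases "0 < c")
      case True
      then have "ev (w \<cdot> t) \<alpha> < 0"
        using \<alpha> evt(1)[OF \<alpha>(1)] ev by (simp add: b ev_sub_mult c_def less_imp_le zero_less_mult_iff) 
          (smt (verit) mult_pos_pos)
      with \<alpha> show ?thesis by (simp add: N_def)
    next
      case False
      then have "c * ht \<beta> \<le> 0" using ht by (simp add: mult_le_0_iff)
      then have "0 < ht (act t \<alpha>)" using \<alpha> by (simp add: b ev_sub_mult c_def)
      moreover have "ev (w \<cdot> t) (act t \<alpha>) < 0" using evt(2) \<alpha> by simp
      ultimately show ?thesis using tR by (simp add: N_def)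
    qed
    show "act t \<alpha> \<noteq> \<beta>"
    proof
      assume "act t \<alpha> = \<beta>"
      then have "\<alpha> = - \<beta>" using tt[OF \<alpha>(1)] reflects_self[OF t] by simp
      with \<alpha>(2) ht show False by simp
    qed
    show "\<alpha> \<in> N (w \<cdot> t)" if "act t \<alpha> \<in> N w"
      using that \<alpha> evt by (simp add: N_def)
  next
    show "\<beta> \<in> N (w \<cdot> t)"
      using \<beta> ht ev evt(1)[OF \<beta>] by (simp add: N_def reflects_self[OF t])
    show "\<beta> \<notin> N w" using ev by (simp add: N_def)
  qed (rule finite_N)
  then show ?thesis by (simp add: len_def)
qed

lemma len_reflect_iff:
  assumes w: "w \<in> EC" and t: "reflects t \<beta>" and ht: "0 < ht \<beta>"
  shows "len w < len (w \<cdot> t) \<longleftrightarrow> 0 < ev w \<beta>"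
proof
  assume less: "len w < len (w \<cdot> t)"
  note tE = reflects_carrier[OF t] and \<beta> = reflects_R[OF t]
  show "0 < ev w \<beta>"
  proof (rule ccontr)
    assume "\<not> 0 < ev w \<beta>"
    then have "0 < ev (w \<cdot> t) \<beta>"
      using ev_nonzero[OF w \<beta>] ev_mult[OF w tE \<beta>] reflects_self[OF t] by simp
    then have "len (w \<cdot> t) < len (w \<cdot> t \<cdot> t)" using w tE t ht by (intro len_reflect) auto
    also have "w \<cdot> t \<cdot> t = w" using w tE reflects_involution[OF t] by (simp add: E.m_assoc)
    finally show False using less by simp
  qed
qed (use assms len_reflect in blast)

lemma act_S_S [simp]: "i \<in> I0 \<Longrightarrow> \<alpha> \<in> R \<Longrightarrow> act (S i) (act (S i) \<alpha>) = \<alpha>"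
  using act_inv(1)[of "S i" \<alpha>] by (simp add: S_carrier)

lemma ev_mult_S: "w \<in> EC \<Longrightarrow> i \<in> I0 \<Longrightarrow> ev (w \<cdot> S i) (sroot i) = - ev w (sroot i)"
  by (simp add: ev_mult S_carrier sroot_R act_S_sroot)

lemma ev_mult_S_act: "w \<in> EC \<Longrightarrow> i \<in> I0 \<Longrightarrow> \<alpha> \<in> R \<Longrightarrow> ev (w \<cdot> S i) (act (S i) \<alpha>) = ev w \<alpha>"
  by (simp add: ev_mult S_carrier act_R)

lemma len_inv [simp]: assumes w: "w \<in> EC" shows "len (ext_inv w) = len w"
proof -
  have sub: "(\<lambda>\<alpha>. - act u \<alpha>) ` N u \<subseteq> N (ext_inv u)" if u: "u \<in> EC" for u
    using u by (auto simp: N_def R_uminus act_R ev_inv_act ev_ht[OF u])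
  have inj: "inj_on (\<lambda>\<alpha>. - act u \<alpha>) (N u)" if u: "u \<in> EC" for u
    by (rule inj_on_inverseI[of _ "\<lambda>\<alpha>. - act (ext_inv u) \<alpha>"])
      (use u in \<open>auto simp: N_def act_uminus\<close>)
  have "len u \<le> len (ext_inv u)" if u: "u \<in> EC" for u
    unfolding len_def using card_inj_on_le[OF inj[OF u] sub[OF u] finite_N] .
  from this[OF w] this[of "ext_inv w"] w show ?thesis by simp
qed

lemma N_mult_subset:
  assumes "u \<in> EC" "v \<in> EC"
  shows "N (u \<cdot> v) \<subseteq> N v \<union> act (ext_inv v) ` N u"
proof
  fix \<alpha> assume "\<alpha> \<in> N (u \<cdot> v)"
  then have \<alpha>: "\<alpha> \<in> R" "0 < ht \<alpha>" "ev u (act v \<alpha>) < 0" using assms by (auto simp: N_def ev_mult)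
  show "\<alpha> \<in> N v \<union> act (ext_inv v) ` N u"
  proof (cases "\<alpha> \<in> N v")
    case False
    then have "0 < ht (act v \<alpha>)"
      using \<alpha> ev_nonzero[OF assms(2) \<alpha>(1)] by (auto simp: N_def ev_ht[OF assms(2)])
    then have "act v \<alpha> \<in> N u" using \<alpha> assms by (simp add: N_def act_R)
    then show ?thesis using act_inv(1)[OF assms(2) \<alpha>(1)] by (metis UnI2 imageI)
  qed simp
qed

lemma len_mult_le: "u \<in> EC \<Longrightarrow> v \<in> EC \<Longrightarrow> len (u \<cdot> v) \<le> len u + len v"
proof -
  assume uv: "u \<in> EC" "v \<in> EC"
  have "card (N (u \<cdot> v)) \<le> card (N v \<union> act (ext_inv v) ` N u)"
    by (intro card_mono N_mult_subset uv) (simp add: finite_N)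
  also have "\<dots> \<le> card (N v) + card (act (ext_inv v) ` N u)" by (rule card_Un_le)
  also have "card (act (ext_inv v) ` N u) \<le> card (N u)" by (rule card_image_le[OF finite_N])
  finally show ?thesis by (simp add: len_def)
qed

text \<open>A root inverted by \<open>v\<close> is sent to the negative of an inversion of the
  inverse of \<open>v\<close>; disjointness keeps \<open>u\<close> from making it positive again.
  Hence the inversions of the product are the disjoint union of those of \<open>v\<close> and the
  pulled back ones of \<open>u\<close>.\<close>

lemma len_mult:
  assumes u: "u \<in> EC" and v: "v \<in> EC" and disj: "N u \<inter> N (ext_inv v) = {}"
  shows "len (u \<cdot> v) = len u + len v"
proof -
  let ?A = "act (ext_inv v) ` N u"
  have 1: "N (u \<cdot> v) = N v \<union> ?A"
  proof (rule equalityI[OF N_mult_subset[OF u v]], rule Un_least; rule subsetI)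
    fix \<alpha> assume "\<alpha> \<in> N v"
    then have \<alpha>: "\<alpha> \<in> R" "0 < ht \<alpha>" "ev v \<alpha> < 0" by (auto simp: N_def)
    have "- act v \<alpha> \<in> R" "0 < ht (- act v \<alpha>)" "ev (ext_inv v) (- act v \<alpha>) < 0"
      using \<alpha> v by (simp_all add: act_R R_uminus ev_inv_act ev_ht[OF v])
    then have "\<not> ev u (- act v \<alpha>) < 0" using disj by (auto simp: N_def)
    then have "ev (u \<cdot> v) \<alpha> < 0"
      using ev_nonzero[of "u \<cdot> v" \<alpha>] u v \<alpha> by (simp add: ev_mult)
    with \<alpha> show "\<alpha> \<in> N (u \<cdot> v)" by (simp add: N_def)
  next
    fix \<alpha> assume "\<alpha> \<in> ?A"
    then obtain \<gamma> where \<gamma>N: "\<gamma> \<in> N u" and \<alpha>: "\<alpha> = act (ext_inv v) \<gamma>" by blast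
    then have \<gamma>: "\<gamma> \<in> R" "0 < ht \<gamma>" "ev u \<gamma> < 0" by (auto simp: N_def)
    then have "\<not> ev (ext_inv v) \<gamma> < 0" using disj \<gamma>N by (auto simp: N_def)
    then have "0 < ht (act (ext_inv v) \<gamma>)"
      using ev_nonzero[of "ext_inv v" \<gamma>] v \<gamma> ev_ht[of "ext_inv v" \<gamma>] by simp
    with \<gamma> u v show "\<alpha> \<in> N (u \<cdot> v)" by (auto simp: \<alpha> N_def act_R ev_mult)
  qed
  have 2: "N v \<inter> ?A = {}"
  proof (rule ccontr)
    assume "N v \<inter> ?A \<noteq> {}"
    then obtain \<gamma> where "\<gamma> \<in> N u" "act (ext_inv v) \<gamma> \<in> N v" by blast
    then show False using v ev_ht[OF v, of "act (ext_inv v) \<gamma>"] by (simp add: N_def)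
  qed
  have "inj_on (act (ext_inv v)) (N u)"
    by (rule inj_on_inverseI[of _ "act v"]) (use v in \<open>auto simp: N_def\<close>)
  then show ?thesis using 1 2 by (simp add: len_def card_Un_disjoint finite_N card_image)
qed

lemma N_S: "i \<in> I0 \<Longrightarrow> N (S i) = {sroot i}"
proof -
  assume i: "i \<in> I0"
  have "\<alpha> \<in> N (S i) \<longleftrightarrow> \<alpha> = sroot i" for \<alpha>
    using S_permutes_pos[OF i, of \<alpha>] i ev_ht[OF S_carrier[OF i], of \<alpha>]
    by (cases "\<alpha> = sroot i")
      (auto simp: N_def sroot_R ht_sroot act_S_sroot ev_ht[OF S_carrier[OF i] sroot_R[OF i]])
  then show ?thesis by blast
qed

lemma len_S_up:
  assumes w: "w \<in> EC" and i: "i \<in> I0" and ev: "0 < ev w (sroot i)"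
  shows "len (w \<cdot> S i) = Suc (len w)"
proof -
  have "sroot i \<notin> N w" using ev by (simp add: N_def)
  then show ?thesis using len_mult[OF w S_carrier[OF i]] i by (simp add: N_S) (simp add: len_def N_S)
qed

lemma len_S_down:
  assumes w: "w \<in> EC" and i: "i \<in> I0" and ev: "ev w (sroot i) < 0"
  shows "len w = Suc (len (w \<cdot> S i))"
  using len_S_up[of "w \<cdot> S i" i] assms by (simp add: S_carrier ev_mult_S)

lemma len_S_le: "w \<in> EC \<Longrightarrow> i \<in> I0 \<Longrightarrow> len (w \<cdot> S i) \<le> Suc (len w)"
  using len_S_up[of w i] len_S_down[of w i] ev_nonzero[of w "sroot i"] sroot_R[of i] by linarith

text \<open>A stand-in for reduced expressions: \<open>descent_exists\<close> allows a simple
  reflection to be split off on the right until no inversion is left. The base case therefore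
  comprises every element of length zero.\<close>

lemma ext_induct [consumes 1, case_names zero S]:
  assumes "w \<in> EC"
    and zero: "\<And>p. p \<in> EC \<Longrightarrow> len p = 0 \<Longrightarrow> P p"
    and S: "\<And>w i. w \<in> EC \<Longrightarrow> i \<in> I0 \<Longrightarrow> 0 < ev w (sroot i) \<Longrightarrow> P w \<Longrightarrow> P (w \<cdot> S i)"
  shows "P w"
  using assms(1)
proof (induction "len w" arbitrary: w rule: less_induct)
  case less
  show ?case
  proof (cases "N w = {}")
    case True
    then show ?thesis using zero less.prems by (simp add: len_def)
  next
    case False
    then obtain i where i: "i \<in> I0" "ev w (sroot i) < 0" using descent_exists less.prems by blast
    then have "P (w \<cdot> S i)" using less len_S_down[OF less.prems i] by (simp add: S_carrier)
    from S[OF _ i(1) _ this] i less.prems show ?thesis by (simp add: S_carrier ev_mult_S)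
  qed
qed

lemma len_0_N: "len w = 0 \<longleftrightarrow> N w = {}"
  by (simp add: len_def finite_N)

lemma len_one [simp]: "len e1 = 0"
  by (auto simp: len_0_N N_def)

subsection \<open>The finite parabolic subgroup\<close>

definition FW :: "'y weyl_elt set" where "FW = {0} \<times> Wf"

lemma FW_carrier: "u \<in> FW \<Longrightarrow> u \<in> EC"
  by (auto simp: FW_def ext_carrier)

lemma FW_one [simp]: "e1 \<in> FW"
  by (simp add: FW_def ext_one_eq)

lemma FW_S: "i \<in> I \<Longrightarrow> S i \<in> FW"
  using I_I0(2) by (auto simp: FW_def affine_simple_refl_def)

lemma FW_mult: "u \<in> FW \<Longrightarrow> v \<in> FW \<Longrightarrow> u \<cdot> v \<in> FW"
  by (auto simp: FW_def ext_mult_eq Wf_comp additive.zero[OF Wf_additive])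

lemma FW_inv: "u \<in> FW \<Longrightarrow> ext_inv u \<in> FW"
proof -
  assume u: "u \<in> FW"
  then have "(0, winv (snd u)) \<cdot> u = e1"
    by (auto simp: FW_def ext_mult_eq ext_one_eq Wf_winv_comp additive.zero[OF Wf_additive[OF Wf_winv]])
  then have "ext_inv u = (0, winv (snd u))"
    using u by (intro E.inv_equality) (auto simp: FW_def ext_carrier Wf_winv)
  with u show ?thesis by (auto simp: FW_def Wf_winv)
qed

lemma finite_FW: "finite FW"
  by (simp add: FW_def finite_Wf)

lemma act_FW_snd: "u \<in> FW \<Longrightarrow> \<alpha> \<in> R \<Longrightarrow> snd (act u \<alpha>) = snd \<alpha>"
  by (auto simp: FW_def act_eq additive.zero[OF Wf_additive[OF Wf_winv]] additive.zero[OF R_additive])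

definition Rp :: "'y affine_coweight set" where "Rp = pos_coroots D \<times> {0}"

lemma Rp_R: "\<beta> \<in> Rp \<Longrightarrow> \<beta> \<in> R" "\<beta> \<in> Rp \<Longrightarrow> 0 < ht \<beta>"
  using pos_root_cases(1)[of "fst \<beta>" "snd \<beta>"] by (auto simp: Rp_def R_def pos_coroots_iff)

lemma finite_Rp: "finite Rp"
proof -
  have "pos_coroots D \<subseteq> coroots D" by (auto simp: pos_coroots_iff)
  then show ?thesis by (simp add: Rp_def finite_subset[OF _ finite_coroots])
qed

lemma N_FW: "u \<in> FW \<Longrightarrow> N u = {\<beta> \<in> Rp. ev u \<beta> < 0}"
proof (intro equalityI subsetI)
  fix \<alpha> assume u: "u \<in> FW" and "\<alpha> \<in> N u"
  then have \<alpha>: "\<alpha> \<in> R" "0 < ht \<alpha>" "ht (act u \<alpha>) < 0"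
    using ev_ht[OF FW_carrier[OF u], of \<alpha>] by (auto simp: N_def)
  moreover have "\<not> 0 < snd \<alpha>"
    using \<alpha> u act_FW_snd[OF u \<alpha>(1)] pos_root_iff[OF act_R[OF FW_carrier[OF u] \<alpha>(1)]] by auto
  ultimately have "\<alpha> \<in> Rp" using pos_root_iff by (auto simp: Rp_def mem_Times_iff)
  then show "\<alpha> \<in> {\<beta> \<in> Rp. ev u \<beta> < 0}" using \<alpha> ev_ht[OF FW_carrier[OF u]] by simp
qed (auto simp: N_def Rp_R)

lemma sroot_Rp: "i \<in> I \<Longrightarrow> sroot i \<in> Rp"
  using cr_coroot by (auto simp: sroot_I Rp_def pos_coroots_iff)

lemma Rp_descent:
  assumes "w \<in> EC" "\<And>i. i \<in> I \<Longrightarrow> 0 < ev w (sroot i)" "\<beta> \<in> Rp"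
  shows "0 < ev w \<beta>"
  using finite_descent[OF assms(1)] assms(2,3) by (auto simp: Rp_def sroot_I)

text \<open>The list is read backwards: its head is the rightmost factor, so that right
  multiplication by a simple reflection is consing.\<close>

fun word :: "nat list \<Rightarrow> 'y weyl_elt" where
  "word [] = e1"
| "word (i # is) = word is \<cdot> S i"

lemma word_FW: "set is \<subseteq> I \<Longrightarrow> word is \<in> FW"
  by (induction "is") (auto simp: FW_mult FW_S)

lemma word_snoc: "set is \<subseteq> I \<Longrightarrow> i \<in> I \<Longrightarrow> word (is @ [i]) = S i \<cdot> word is"
  by (induction "is") (auto simp: S_carrier I_I0 FW_carrier word_FW E.m_assoc)

lemma FW_word: assumes "u \<in> FW" shows "\<exists>is. set is \<subseteq> I \<and> u = word is"
proof -
  obtain w where u: "u = (0, w)" "w \<in> Wf" using assms by (auto simp: FW_def)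
  from u(2) have "\<exists>is. set is \<subseteq> I \<and> (0, w) = word is"
  proof (induction rule: Wf_induct)
    case id
    show ?case by (rule exI[of _ "[]"]) (simp add: ext_one_eq id_def)
  next
    case (sr i w)
    then obtain "is" where "is": "set is \<subseteq> I" "(0, w) = word is" by blast
    have "(0, sr i \<circ> w) = S i \<cdot> (0, w)"
      using sr(1) I_I0(2)[OF sr(1)] by (simp add: ext_mult_eq affine_simple_refl_def additive.zero[OF sr_additive])
    then have "(0, sr i \<circ> w) = word (is @ [i])" unfolding "is"(2) by (simp only: word_snoc[OF "is"(1) sr(1)])
    moreover have "set (is @ [i]) \<subseteq> I" using "is"(1) sr(1) by simp
    ultimately show ?case by blast
  qed
  with u show ?thesis by simp
qed

text \<open>The deletion condition. The reflection is moved leftwards through the word;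
  \<open>S i\<close> keeps \<beta> positive unless \<beta> is \<open>sroot i\<close>, and at that
  letter the reflection cancels it.\<close>

lemma word_deletion:
  assumes "set is \<subseteq> I" "reflects t \<beta>" "0 < ht \<beta>" "ev (word is) \<beta> < 0"
  shows "\<exists>js. set js \<subseteq> I \<and> length js < length is \<and> word is \<cdot> t = word js"
  using assms
proof (induction "is" arbitrary: t \<beta>)
  case (Cons i "is")
  have i: "i \<in> I" "i \<in> I0" using Cons.prems(1) I_I0 by auto
  have w: "word is \<in> EC" using Cons.prems(1) by (simp add: FW_carrier word_FW)
  have t: "t \<in> EC" using Cons.prems(2) by (rule reflects_carrier)
  show ?case
  proof (cases "\<beta> = sroot i")
    case True
    then have "t = S i" using reflects_unique reflects_S[OF i(2)] Cons.prems(2) by blast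
    then show ?thesis using i w Cons.prems(1) by (intro exI[of _ "is"]) simp
  next
    case False
    note \<beta> = reflects_R[OF Cons.prems(2)]
    have "ev (word is) (act (S i) \<beta>) < 0" using Cons.prems(4) w i \<beta> by (simp add: ev_mult S_carrier)
    moreover have "0 < ht (act (S i) \<beta>)" using S_permutes_pos[OF i(2) \<beta> Cons.prems(3) False] .
    moreover have "reflects (S i \<cdot> t \<cdot> S i) (act (S i) \<beta>)"
      using reflects_conj[OF Cons.prems(2) S_carrier[OF i(2)]] i by simp
    ultimately obtain js where js: "set js \<subseteq> I" "length js < length is" "word is \<cdot> (S i \<cdot> t \<cdot> S i) = word js"
      using Cons.IH[of "S i \<cdot> t \<cdot> S i" "act (S i) \<beta>"] Cons.prems(1) by auto
    have "word (i # is) \<cdot> t = word is \<cdot> (S i \<cdot> t \<cdot> S i) \<cdot> S i"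
      using w t i by (simp add: E.m_assoc S_carrier)
    then show ?thesis using js i by (intro exI[of _ "i # js"]) simp
  qed
qed simp

text \<open>In a shortest nonempty word for \<open>u\<close> the rest of the word would invert the
  simple root of the removed letter, and deletion would give a still shorter word for
  \<open>u\<close>. The point is that W_f, unlike W_e, has no nontrivial element of length
  zero.\<close>

lemma FW_N_empty:
  assumes "u \<in> FW" "N u = {}" shows "u = e1"
proof -
  obtain "is" where "is": "set is \<subseteq> I" "u = word is"
    and min: "\<And>js. set js \<subseteq> I \<Longrightarrow> u = word js \<Longrightarrow> length is \<le> length js"
    using FW_word[OF assms(1)] ex_has_least_nat[of "\<lambda>is. set is \<subseteq> I \<and> u = word is" _ length] by metis
  show ?thesis
  proof (cases "is")
    case (Cons i is')
    then have i: "i \<in> I" "i \<in> I0" and is': "set is' \<subseteq> I" using "is"(1) I_I0 by auto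
    have w: "word is' \<in> EC" using is' by (simp add: FW_carrier word_FW)
    have "sroot i \<notin> N u" using assms(2) by simp
    then have "0 < ev u (sroot i)"
      using i ev_nonzero[OF FW_carrier[OF assms(1)] sroot_R[OF i(2)]] ht_sroot[OF i(2)] sroot_R[OF i(2)]
      by (simp add: N_def)
    then have "ev (word is') (sroot i) < 0" using "is" Cons w i by (simp add: ev_mult_S)
    then obtain js where "set js \<subseteq> I" "length js < length is'" "word is' \<cdot> S i = word js"
      using word_deletion[OF is' reflects_S[OF i(2)]] ht_sroot[OF i(2)] by auto
    then show ?thesis using min[of js] "is" Cons by simp
  qed (use "is" in simp)
qed

lemma N_I: "\<alpha> \<in> R \<Longrightarrow> 0 < ht \<alpha> \<Longrightarrow> ev w \<alpha> < 0 \<Longrightarrow> \<alpha> \<in> N w"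
  and N_D: "\<alpha> \<in> N w \<Longrightarrow> \<alpha> \<in> R" "\<alpha> \<in> N w \<Longrightarrow> 0 < ht \<alpha>" "\<alpha> \<in> N w \<Longrightarrow> ev w \<alpha> < 0"
  by (simp_all add: N_def)

lemma ev_sroot_neg: "w \<in> EC \<Longrightarrow> i \<in> I0 \<Longrightarrow> \<not> 0 < ev w (sroot i) \<longleftrightarrow> ev w (sroot i) < 0"
  using ev_nonzero[of w "sroot i"] sroot_R[of i] by linarith

lemma Rp_I: "\<alpha> \<in> R \<Longrightarrow> 0 < ht \<alpha> \<Longrightarrow> snd \<alpha> = 0 \<Longrightarrow> \<alpha> \<in> Rp"
  using pos_root_iff[of \<alpha>] by (simp add: Rp_def mem_Times_iff)

lemma len_0_pos:
  assumes "q \<in> EC" "len q = 0" "\<alpha> \<in> R" "0 < ht \<alpha>"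
  shows "0 < ht (act q \<alpha>)"
proof -
  have "\<alpha> \<notin> N q" using assms(2) by (simp add: len_0_N)
  then have "\<not> ev q \<alpha> < 0" using N_I assms(3,4) by blast
  then show ?thesis using ev_nonzero[OF assms(1,3)] ev_ht[OF assms(1,3)] by linarith
qed

subsection \<open>Longest element and minimal coset representatives\<close>

abbreviation "w0 \<equiv> longest_elt D"

lemma longest_exists: "\<exists>u\<in>FW. \<forall>v\<in>FW. len v \<le> len u"
proof -
  have "finite FW" "FW \<noteq> {}" using finite_FW FW_one by blast+
  from finite_maximizer[OF this, of "\<lambda>u. int (len u)"] show ?thesis by (metis of_nat_le_iff)
qed

lemma Rp_subset_N:
  assumes w: "w \<in> EC" and neg: "\<And>i. i \<in> I \<Longrightarrow> ev w (sroot i) < 0"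
  shows "Rp \<subseteq> N w"
proof
  fix \<beta> assume \<beta>: "\<beta> \<in> Rp"
  then obtain x where x: "\<beta> = (x, 0)" "x \<in> pos_coroots D" by (auto simp: Rp_def)
  have "0 \<le> x (- eta w)"
  proof (rule pos_coroot_ge_0[OF x(2)])
    fix i assume i: "i \<in> I"
    then show "0 \<le> cr i (- eta w)"
      using neg[OF i] by (simp add: sroot_I ev_def additive.minus[OF cr_additive])
  qed
  then have "ev w \<beta> \<le> 0"
    using x by (simp add: ev_def additive.minus[OF coroot_additive] pos_coroots_iff)
  then have "ev w \<beta> < 0" using ev_nonzero[OF w Rp_R(1)[OF \<beta>]] by simp
  then show "\<beta> \<in> N w" using Rp_R[OF \<beta>] by (intro N_I)
qed

lemma maximal_N:
  assumes u: "u \<in> FW" and max: "\<forall>v\<in>FW. len v \<le> len u"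
  shows "N u = Rp"
proof -
  note uE = FW_carrier[OF u]
  have neg: "ev u (sroot i) < 0" if i: "i \<in> I" for i
  proof (rule ccontr)
    assume "\<not> ev u (sroot i) < 0"
    then have "0 < ev u (sroot i)" using ev_sroot_neg[OF uE I_I0(1)[OF i]] by blast
    then have "len (u \<cdot> S i) = Suc (len u)" using len_S_up uE I_I0(1)[OF i] by blast
    moreover have "u \<cdot> S i \<in> FW" using u i FW_mult FW_S by blast
    ultimately show False using max by force
  qed
  have "Rp \<subseteq> N u" using Rp_subset_N[OF uE neg] .
  then show ?thesis using N_FW[OF u] by auto
qed

lemma FW_eq_of_N:
  assumes "u \<in> FW" "v \<in> FW" "\<And>\<beta>. \<beta> \<in> Rp \<Longrightarrow> 0 < ev (u \<cdot> v) \<beta>"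
  shows "v = ext_inv u"
proof -
  have "N (u \<cdot> v) = {}" using N_FW[of "u \<cdot> v"] FW_mult assms by fastforce
  then have "u \<cdot> v = e1" using FW_N_empty FW_mult assms by blast
  then have "v \<cdot> u = e1" using E.inv_comm assms FW_carrier by blast
  then show ?thesis using E.inv_equality assms FW_carrier by metis
qed

text \<open>The inverse of \<open>v\<close> makes all positive finite roots negative and
  \<open>u\<close> makes them positive again, so the product of the two has no inversion. This
  justifies the definite description in \<open>longest_elt\<close>.\<close>

lemma maximal_unique:
  assumes u: "u \<in> FW" "\<forall>w\<in>FW. len w \<le> len u" and v: "v \<in> FW" "\<forall>w\<in>FW. len w \<le> len v"
  shows "u = v"
proof -
  have iv: "ext_inv v \<in> FW" using v FW_inv by blast
  have "\<forall>w\<in>FW. len w \<le> len (ext_inv v)" using v FW_carrier by simp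
  then have Niv: "N (ext_inv v) = Rp" using maximal_N iv by blast
  have "0 < ev (u \<cdot> ext_inv v) \<beta>" if \<beta>: "\<beta> \<in> Rp" for \<beta>
  proof -
    have R: "\<beta> \<in> R" "act (ext_inv v) \<beta> \<in> R" using \<beta> Rp_R FW_carrier[OF iv] act_R by blast+
    have "ht (act (ext_inv v) \<beta>) < 0"
      using \<beta> Niv ev_ht[OF FW_carrier[OF iv] R(1)] N_D(3)[of \<beta> "ext_inv v"] by simp
    then have "- act (ext_inv v) \<beta> \<in> R" "0 < ht (- act (ext_inv v) \<beta>)" using R R_uminus by auto
    moreover have "snd (- act (ext_inv v) \<beta>) = 0"
      using act_FW_snd[OF iv R(1)] \<beta> by (auto simp: Rp_def)
    ultimately have "- act (ext_inv v) \<beta> \<in> Rp" by (rule Rp_I)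
    then have "- act (ext_inv v) \<beta> \<in> N u" using maximal_N[OF u] by simp
    then show ?thesis using R u iv FW_carrier by (simp add: N_def ev_mult)
  qed
  then have "ext_inv v = ext_inv u" using FW_eq_of_N u iv by blast
  then show ?thesis using u v FW_carrier E.inv_inv by metis
qed

lemma w0_props: "w0 \<in> FW" "v \<in> FW \<Longrightarrow> len v \<le> len w0"
proof -
  have eq: "w0 = (THE w. w \<in> FW \<and> (\<forall>u\<in>FW. len u \<le> len w))"
    unfolding longest_elt_def FW_def[symmetric] using FW_carrier weyl_length_len
    by (intro arg_cong[where f = The] ext) (metis (no_types, lifting))
  obtain u where u: "u \<in> FW" "\<forall>v\<in>FW. len v \<le> len u" using longest_exists by blast
  have "w0 \<in> FW \<and> (\<forall>u\<in>FW. len u \<le> len w0)"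
    unfolding eq by (rule theI[of _ u]) (use u maximal_unique in blast)+
  then show "w0 \<in> FW" "v \<in> FW \<Longrightarrow> len v \<le> len w0" by blast+
qed

lemma w0_carrier [simp]: "w0 \<in> EC"
  using w0_props FW_carrier by blast

lemma N_w0: "N w0 = Rp"
  using maximal_N w0_props by blast

lemma w0_inv [simp]: "ext_inv w0 = w0"
  using maximal_unique[OF FW_inv[OF w0_props(1)] _ w0_props(1)] w0_props by simp

lemma len_w0: "len w0 = card Rp"
  by (simp add: len_def N_w0)

lemma FW_up:
  assumes u: "u \<in> FW" "u \<noteq> w0"
  shows "\<exists>i\<in>I. 0 < ev u (sroot i)"
proof (rule ccontr)
  note uE = FW_carrier[OF u(1)]
  assume "\<not> ?thesis"
  then have "ev u (sroot i) < 0" if "i \<in> I" for i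
    using that ev_sroot_neg[OF uE I_I0(1)[OF that]] by blast
  then have "Rp \<subseteq> N u" by (rule Rp_subset_N[OF uE])
  then have "len w0 \<le> len u" unfolding len_w0 by (simp add: len_def card_mono finite_N)
  then have "\<forall>v\<in>FW. len v \<le> len u" using w0_props(2) order_trans by blast
  then show False using maximal_unique[OF u(1) _ w0_props(1)] w0_props(2) u(2) by blast
qed

lemma FW_down:
  assumes u: "u \<in> FW" "u \<noteq> e1"
  shows "\<exists>i\<in>I. ev u (sroot i) < 0"
proof (rule ccontr)
  note uE = FW_carrier[OF u(1)]
  assume no: "\<not> ?thesis"
  have "0 < ev u (sroot i)" if "i \<in> I" for i
  proof -
    have "\<not> ev u (sroot i) < 0" using no that by blast
    then show ?thesis using ev_sroot_neg[OF uE I_I0(1)[OF that]] by blast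
  qed
  then have "0 < ev u \<beta>" if "\<beta> \<in> Rp" for \<beta> using Rp_descent[OF uE _ that] by blast
  then have "N u = {}" using N_FW[OF u(1)] by force
  then show False using FW_N_empty u by blast
qed

text \<open>The elements of minimal length in their coset \<open>x W\<^sub>f\<close>.\<close>

definition Mr :: "'y weyl_elt set" where
  "Mr = {x \<in> carrier E. \<forall>i\<in>I. 0 < ev x (sroot i)}"

lemma Mr_carrier: "x \<in> Mr \<Longrightarrow> x \<in> EC"
  by (simp add: Mr_def)

lemma Mr_Rp: "x \<in> Mr \<Longrightarrow> \<beta> \<in> Rp \<Longrightarrow> 0 < ev x \<beta>"
  using Rp_descent by (simp add: Mr_def)

lemma Mr_len:
  assumes x: "x \<in> Mr" and u: "u \<in> FW"
  shows "N x \<inter> N (ext_inv u) = {}" "len (x \<cdot> u) = len x + len u"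
proof -
  have "ext_inv u \<in> FW" using u FW_inv by blast
  then have "N (ext_inv u) \<subseteq> Rp" using N_FW by auto
  then show "N x \<inter> N (ext_inv u) = {}" using Mr_Rp[OF x] N_D(3)[of _ x] by force
  then show "len (x \<cdot> u) = len x + len u" using x u Mr_carrier FW_carrier len_mult by blast
qed

text \<open>If \<open>x\<close> inverts a finite simple root, the letter \<open>S i\<close> can be
  cancelled between \<open>x\<close> and \<open>w0\<close>, and the product is shorter than the sum
  of lengths by at least two.\<close>

lemma reduced_w0_iff: "x \<in> EC \<Longrightarrow> reduced_product D x w0 \<longleftrightarrow> x \<in> Mr"
proof
  assume x: "x \<in> EC" and red: "reduced_product D x w0"
  show "x \<in> Mr" unfolding Mr_def
  proof (intro CollectI conjI x ballI, rule ccontr)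
    fix i assume i: "i \<in> I" and "\<not> 0 < ev x (sroot i)"
    then have neg: "ev x (sroot i) < 0" using ev_sroot_neg[OF x I_I0(1)[OF i]] by blast
    note i0 = I_I0(1)[OF i]
    have "sroot i \<in> N w0" using N_w0 sroot_Rp i by simp
    then have "len w0 = Suc (len (w0 \<cdot> S i))" using len_S_down i0 by (simp add: N_def)
    also have "len (w0 \<cdot> S i) = len (S i \<cdot> w0)"
      using len_inv[of "w0 \<cdot> S i"] i0 by (simp add: E.inv_mult_group S_carrier)
    finally have 1: "len w0 = Suc (len (S i \<cdot> w0))" .
    have 2: "len x = Suc (len (x \<cdot> S i))" using len_S_down x i0 neg by blast
    have "x \<cdot> w0 = x \<cdot> S i \<cdot> (S i \<cdot> w0)" using x i0 by (simp add: E.m_assoc S_carrier)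
    then have "len (x \<cdot> w0) \<le> len (x \<cdot> S i) + len (S i \<cdot> w0)"
      using len_mult_le x i0 S_carrier by simp
    then show False using red 1 2 x by (simp add: reduced_product_def weyl_length_len)
  qed
next
  assume "x \<in> EC" "x \<in> Mr"
  then show "reduced_product D x w0"
    using Mr_len(2) w0_props by (simp add: reduced_product_def weyl_length_len)
qed

lemma reduced_inv:
  assumes "u \<in> EC" "v \<in> EC"
  shows "reduced_product D (ext_inv v) (ext_inv u) \<longleftrightarrow> reduced_product D u v"
  using assms len_inv[of "u \<cdot> v"]
  by (simp add: reduced_product_def weyl_length_len E.inv_mult_group[symmetric] add.commute)

lemma reduced_w0_left_iff: "x \<in> EC \<Longrightarrow> reduced_product D w0 x \<longleftrightarrow> ext_inv x \<in> Mr"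
  using reduced_inv[of w0 x] reduced_w0_iff[of "ext_inv x"] by simp

text \<open>With \<open>y = x g\<close> and \<open>g\<close> in W_f, a finite root inverted by
  \<open>g\<close> would be inverted by \<open>y\<close> as well, because \<open>x\<close> preserves
  the signs of finite roots; so \<open>g\<close> has no inversion.\<close>

lemma Mr_unique:
  assumes "x \<in> Mr" "y \<in> Mr" "u \<in> FW" "v \<in> FW" "x \<cdot> u = y \<cdot> v"
  shows "x = y" "u = v"
proof -
  define g where "g = u \<cdot> ext_inv v"
  have g: "g \<in> FW" using assms FW_mult FW_inv by (simp add: g_def)
  note car = Mr_carrier[OF assms(1)] Mr_carrier[OF assms(2)] FW_carrier[OF assms(3)] FW_carrier[OF assms(4)]
  have y: "y = x \<cdot> g"
    using car assms(5) by (metis E.inv_closed E.inv_solve_right E.m_assoc E.m_closed g_def)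
  have "N g = {}"
  proof (rule equals0I)
    fix \<beta> assume "\<beta> \<in> N g"
    then have \<beta>: "\<beta> \<in> Rp" "ev g \<beta> < 0" using N_FW[OF g] by auto
    have R: "\<beta> \<in> R" "act g \<beta> \<in> R" using \<beta> Rp_R act_R FW_carrier[OF g] by blast+
    have "ht (- act g \<beta>) > 0" using \<beta> ev_ht[OF FW_carrier[OF g] R(1)] by simp
    moreover have "snd (- act g \<beta>) = 0" using act_FW_snd[OF g R(1)] \<beta> by (auto simp: Rp_def)
    ultimately have "- act g \<beta> \<in> Rp" using R_uminus[OF R(2)] Rp_I by blast
    from Mr_Rp[OF assms(1) this] have "ev y \<beta> < 0"
      using y car R FW_carrier[OF g] by (simp add: ev_mult)
    then show False using Mr_Rp[OF assms(2) \<beta>(1)] by simp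
  qed
  then have "g = e1" using FW_N_empty g by blast
  then show "x = y" "u = v" using y car unfolding g_def by (simp, metis E.inv_closed E.inv_solve_right E.l_one E.one_closed)
qed

subsection \<open>Bruhat order\<close>

text \<open>Chains in the whole of \<open>W\<^sub>e\<close>, with reflections conjugated under \<open>W\<^sub>e\<close> and not only under \<open>W\<^sub>a\<close>:
  in this form the order is visibly invariant under inversion. It implies \<^const>\<open>bruhat_le\<close>, and only
  this implication is needed.\<close>

definition bstep :: "('y weyl_elt \<times> 'y weyl_elt) set" where
  "bstep = {(x, x \<cdot> t) | x t \<beta>. x \<in> EC \<and> reflects t \<beta> \<and> len x < len (x \<cdot> t)}"

definition le :: "'y weyl_elt \<Rightarrow> 'y weyl_elt \<Rightarrow> bool" (infix "\<preceq>" 50) where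
  "x \<preceq> y \<longleftrightarrow> x \<in> EC \<and> (x, y) \<in> bstep\<^sup>*"

lemma le_refl: "x \<in> EC \<Longrightarrow> x \<preceq> x"
  by (simp add: le_def)

lemma le_trans: "x \<preceq> y \<Longrightarrow> y \<preceq> z \<Longrightarrow> x \<preceq> z"
  by (auto simp: le_def)

lemma bstepE:
  assumes "(x, y) \<in> bstep"
  obtains t \<beta> where "x \<in> EC" "y \<in> EC" "reflects t \<beta>" "0 < ht \<beta>" "y = x \<cdot> t" "len x < len y"
proof -
  obtain t \<beta> where t: "x \<in> EC" "reflects t \<beta>" "y = x \<cdot> t" "len x < len y"
    using assms unfolding bstep_def by blast
  obtain \<gamma> where "reflects t \<gamma>" "0 < ht \<gamma>" using t(2) by (rule reflects_pos)
  with t that show ?thesis using reflects_carrier by blast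
qed

lemma le_bstep: "x \<in> EC \<Longrightarrow> reflects t \<beta> \<Longrightarrow> len x < len (x \<cdot> t) \<Longrightarrow> x \<preceq> x \<cdot> t"
  unfolding le_def bstep_def by blast

lemma le_induct [consumes 1, case_names refl step]:
  assumes "x \<preceq> y" "P y" "\<And>x z. (x, z) \<in> bstep \<Longrightarrow> z \<preceq> y \<Longrightarrow> P z \<Longrightarrow> P x"
  shows "P x"
proof -
  have "(x, y) \<in> bstep\<^sup>*" using assms(1) by (simp add: le_def)
  then show ?thesis
  proof (induction rule: converse_rtrancl_induct)
    case (step x z)
    have "z \<in> EC" using step(1) by (rule bstepE)
    with step assms(3) show ?case by (simp add: le_def)
  qed (rule assms(2))
qed

lemma le_carrier: "x \<preceq> y \<Longrightarrow> x \<in> EC" "x \<preceq> y \<Longrightarrow> y \<in> EC"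
proof -
  show 1: "x \<preceq> y \<Longrightarrow> x \<in> EC" by (simp add: le_def)
  assume "x \<preceq> y"
  then have "(x, y) \<in> bstep\<^sup>*" "x \<in> EC" by (simp_all add: le_def)
  then show "y \<in> EC" by (induction rule: rtrancl_induct) (auto elim: bstepE)
qed

lemma le_len: "x \<preceq> y \<Longrightarrow> x = y \<or> len x < len y"
  by (induction rule: le_induct) (auto elim: bstepE)

lemma le_S_up: "w \<in> EC \<Longrightarrow> i \<in> I0 \<Longrightarrow> 0 < ev w (sroot i) \<Longrightarrow> w \<preceq> w \<cdot> S i"
  using le_bstep[OF _ reflects_S, of w i] len_S_up[of w i] by simp

lemma le_S_down: "w \<in> EC \<Longrightarrow> i \<in> I0 \<Longrightarrow> ev w (sroot i) < 0 \<Longrightarrow> w \<cdot> S i \<preceq> w"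
  using le_S_up[of "w \<cdot> S i" i] by (simp add: S_carrier ev_mult_S)

text \<open>Right multiplication by \<open>S i\<close> turns a step of the chain into a step by the
  conjugate reflection, whose root stays positive unless it is \<open>sroot i\<close>. In that
  exceptional case \<open>y S i\<close> is the next member of the chain, which accounts for the
  first alternative.\<close>

lemma le_lift_or:
  assumes "y \<preceq> x" and i: "i \<in> I0"
  shows "y \<cdot> S i \<preceq> x \<or> y \<cdot> S i \<preceq> x \<cdot> S i"
  using assms(1)
proof (induction rule: le_induct)
  case refl
  show ?case using le_refl le_carrier(2)[OF assms(1)] i S_carrier by blast
next
  case (step y z)
  obtain t \<beta> where t: "y \<in> EC" "z \<in> EC" "reflects t \<beta>" "0 < ht \<beta>" "z = y \<cdot> t" "len y < len z"
    using step(1) by (rule bstepE)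
  note tE = reflects_carrier[OF t(3)] and \<beta> = reflects_R[OF t(3)]
  show ?case
  proof (cases "\<beta> = sroot i")
    case True
    then have "t = S i" using reflects_unique t(3) reflects_S[OF i] by blast
    then show ?thesis using step(2) t by simp
  next
    case False
    define t' where "t' = S i \<cdot> t \<cdot> S i"
    have t': "reflects t' (act (S i) \<beta>)" unfolding t'_def
      using reflects_conj[OF t(3) S_carrier[OF i]] i by simp
    have "0 < ev y \<beta>" using len_reflect_iff[OF t(1,3,4)] t by simp
    then have "0 < ev (y \<cdot> S i) (act (S i) \<beta>)" using t i \<beta> by (simp add: ev_mult_S_act)
    then have "len (y \<cdot> S i) < len (y \<cdot> S i \<cdot> t')"
      using t i t' S_permutes_pos[OF i \<beta> t(4) False] by (intro len_reflect) (auto simp: S_carrier)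
    then have "y \<cdot> S i \<preceq> y \<cdot> S i \<cdot> t'" using le_bstep t t' i S_carrier by simp
    moreover have "y \<cdot> S i \<cdot> t' = z \<cdot> S i"
      unfolding t'_def t(5) using t tE i by (simp add: E.m_assoc S_carrier)
    ultimately show ?thesis using step(3) le_trans by metis
  qed
qed

lemma le_lift:
  assumes "y \<preceq> x" "i \<in> I0" "0 < ev x (sroot i)"
  shows "y \<cdot> S i \<preceq> x \<cdot> S i"
  using le_lift_or[OF assms(1,2)] le_S_up[OF le_carrier(2)[OF assms(1)] assms(2,3)] le_trans by blast

lemma le_inv: "x \<preceq> y \<Longrightarrow> ext_inv x \<preceq> ext_inv y"
proof -
  assume le: "x \<preceq> y"
  from le show ?thesis
  proof (induction rule: le_induct)
    case refl
    show ?case using le_refl le_carrier(2)[OF le] by simp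
  next
    case (step x z)
    obtain t \<beta> where t: "x \<in> EC" "z \<in> EC" "reflects t \<beta>" "z = x \<cdot> t" "len x < len z"
      using step(1) by (rule bstepE)
    note tE = reflects_carrier[OF t(3)]
    have tinv: "ext_inv t = t" using tE reflects_involution[OF t(3)] by (simp add: E.inv_equality)
    have "ext_inv x \<cdot> (x \<cdot> t \<cdot> ext_inv x) = ext_inv z"
      using t tE tinv by (simp add: E.m_assoc E.inv_mult_group)
    moreover have "len (ext_inv x) < len (ext_inv z)" using t by simp
    ultimately have "ext_inv x \<preceq> ext_inv z"
      using le_bstep[OF _ reflects_conj[OF t(3,1)], of "ext_inv x"] t by simp
    then show ?case using step(3) le_trans by blast
  qed
qed

section \<open>Comparison with the Bruhat order of the affine Weyl group; finiteness of lower
  sets\<close>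

lemma S_affine: "i \<in> I0 \<Longrightarrow> S i \<in> affine_weyl D"
  unfolding affine_weyl_def I0_def by (auto intro: generate.incl)

lemma affine_weyl_carrier: "u \<in> affine_weyl D \<Longrightarrow> u \<in> EC"
  unfolding affine_weyl_def I0_def[symmetric] using E.generate_incl[of "S ` I0"] S_carrier by blast

lemma affine_weyl_mult: "u \<in> affine_weyl D \<Longrightarrow> v \<in> affine_weyl D \<Longrightarrow> u \<cdot> v \<in> affine_weyl D"
  unfolding affine_weyl_def by (rule generate.eng)

lemma affine_weyl_inv: "u \<in> affine_weyl D \<Longrightarrow> ext_inv u \<in> affine_weyl D"
  unfolding affine_weyl_def I0_def[symmetric] using E.generate_m_inv_closed[of "S ` I0" u] S_carrier by blast

lemma affine_reflections_affine: "t \<in> affine_reflections D \<Longrightarrow> t \<in> affine_weyl D"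
  unfolding affine_reflections_def I0_def[symmetric]
  using affine_weyl_mult affine_weyl_inv S_affine by blast

lemma len_0_iff: assumes p: "p \<in> EC" shows "len p = 0 \<longleftrightarrow> p \<in> length_zero_group D"
proof
  assume 0: "len p = 0"
  have "act p ` affine_pos_roots D = affine_pos_roots D"
  proof (intro equalityI subsetI)
    fix \<alpha> assume \<alpha>: "\<alpha> \<in> affine_pos_roots D"
    then have "act (ext_inv p) \<alpha> \<in> affine_pos_roots D"
      using len_0_pos[of "ext_inv p" \<alpha>] p 0 by (simp add: affine_pos_roots_eq act_R)
    moreover have "\<alpha> = act p (act (ext_inv p) \<alpha>)" using \<alpha> p by (simp add: affine_pos_roots_eq)
    ultimately show "\<alpha> \<in> act p ` affine_pos_roots D" by blast
  qed (use len_0_pos[of p] p 0 in \<open>auto simp: affine_pos_roots_eq act_R\<close>)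
  then show "p \<in> length_zero_group D" using p by (simp add: length_zero_group_def)
next
  assume z: "p \<in> length_zero_group D"
  have img: "act p \<alpha> \<in> affine_pos_roots D" if "\<alpha> \<in> affine_pos_roots D" for \<alpha>
    using z that unfolding length_zero_group_def by blast
  have "\<not> ev p \<alpha> < 0" if "\<alpha> \<in> R" "0 < ht \<alpha>" for \<alpha>
  proof -
    have "0 < ht (act p \<alpha>)" using img[of \<alpha>] that unfolding affine_pos_roots_eq by blast
    then show ?thesis using ev_ht[OF p that(1)] by simp
  qed
  then show "len p = 0" by (auto simp: len_0_N N_def)
qed

lemma ext_decomp:
  assumes "x \<in> EC"
  shows "\<exists>p u. p \<in> EC \<and> len p = 0 \<and> u \<in> affine_weyl D \<and> x = p \<cdot> u"
  using assms
proof (induction rule: ext_induct)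
  case (zero p)
  have "e1 \<in> affine_weyl D" unfolding affine_weyl_def by (rule generate.one)
  with zero show ?case by (intro exI[of _ p] exI[of _ "e1"]) simp
next
  case (S w i)
  then obtain p u where pu: "p \<in> EC" "len p = 0" "u \<in> affine_weyl D" "w = p \<cdot> u" by blast
  then have "w \<cdot> S i = p \<cdot> (u \<cdot> S i)" using S affine_weyl_carrier by (simp add: E.m_assoc S_carrier)
  then show ?case using pu affine_weyl_mult S_affine S(2) by blast
qed

text \<open>The conjugate is the reflection in the positive root \<open>p (sroot i)\<close>, and it
  has a simple descent. Since \<open>p\<close> and its inverse preserve positivity, this reflection
  keeps every other simple root positive, so the descent is that root itself.\<close>

lemma len_0_conj_S:
  assumes p: "p \<in> EC" "len p = 0" and i: "i \<in> I0"
  shows "\<exists>j\<in>I0. p \<cdot> S i \<cdot> ext_inv p = S j"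
proof -
  define g \<gamma> where "g = p \<cdot> S i \<cdot> ext_inv p" and "\<gamma> = act p (sroot i)"
  have g: "reflects g \<gamma>" unfolding g_def \<gamma>_def using p i by (intro reflects_conj reflects_S)
  note gE = reflects_carrier[OF g] and \<gamma> = reflects_R[OF g]
  have "0 < ht \<gamma>" using len_0_pos[OF p sroot_R[OF i]] ht_sroot[OF i] by (simp add: \<gamma>_def)
  then have "\<gamma> \<in> N g" using \<gamma> by (simp add: N_def ev_ht[OF gE] reflects_self[OF g])
  then obtain j where j: "j \<in> I0" "ev g (sroot j) < 0" using descent_exists[OF gE] by blast
  have "sroot j = \<gamma>"
  proof (rule ccontr)
    assume ne: "sroot j \<noteq> \<gamma>"
    define \<alpha> where "\<alpha> = act (ext_inv p) (sroot j)"
    have sj: "sroot j = act p \<alpha>" "\<alpha> \<in> R" using p j sroot_R by (simp_all add: \<alpha>_def act_R)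
    have "0 < ht \<alpha>" using len_0_pos[of "ext_inv p" "sroot j"] p j by (simp add: \<alpha>_def sroot_R ht_sroot)
    moreover have "\<alpha> \<noteq> sroot i" using ne sj \<gamma>_def by auto
    ultimately have "0 < ht (act (S i) \<alpha>)" using S_permutes_pos[OF i sj(2)] by blast
    then have "0 < ht (act p (act (S i) \<alpha>))" using len_0_pos p i sj by (simp add: act_R S_carrier)
    moreover have "act g (sroot j) = act p (act (S i) \<alpha>)"
      using p i j by (simp add: g_def \<alpha>_def act_mult S_carrier sroot_R act_R)
    ultimately show False using j ev_ht[OF gE sroot_R[OF j(1)]] by simp
  qed
  then have "g = S j" using reflects_unique[OF g] reflects_S[OF j(1)] by simp
  with j show ?thesis by (auto simp: g_def)
qed

text \<open>The length zero part of the conjugating element only permutes the simple reflections, so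
  conjugates under W_e are already conjugates under W_a.\<close>

lemma reflects_affine:
  assumes "reflects t \<beta>" shows "t \<in> affine_reflections D"
proof -
  obtain w i where w: "w \<in> EC" "i \<in> I0" "t = w \<cdot> S i \<cdot> ext_inv w"
    using assms unfolding reflects_def by blast
  obtain p u where pu: "p \<in> EC" "len p = 0" "u \<in> affine_weyl D" "ext_inv w = p \<cdot> u"
    using ext_decomp[of "ext_inv w"] w by auto
  note uE = affine_weyl_carrier[OF pu(3)]
  have weq: "w = ext_inv u \<cdot> ext_inv p" using pu uE w(1) by (metis E.inv_inv E.inv_mult_group)
  obtain j where j: "j \<in> I0" "ext_inv p \<cdot> S i \<cdot> p = S j"
    using len_0_conj_S[of "ext_inv p" i] pu w by auto
  have "t = ext_inv u \<cdot> (ext_inv p \<cdot> S i \<cdot> p) \<cdot> u"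
    unfolding w(3) pu(4) using pu uE w(2) by (subst weq) (simp add: E.m_assoc S_carrier)
  then have "t = ext_inv u \<cdot> S j \<cdot> ext_inv (ext_inv u)" using j uE by simp
  then show ?thesis
    unfolding affine_reflections_def I0_def[symmetric] using affine_weyl_inv[OF pu(3)] j(1) by blast
qed

lemma len_0_mult:
  assumes p: "p \<in> EC" "len p = 0" and u: "u \<in> EC"
  shows "len (p \<cdot> u) = len u"
  using len_mult_le[of p u] len_mult_le[of "ext_inv p" "p \<cdot> u"] assms by simp

text \<open>Reflections lie in W_a, so the length zero part \<open>p\<close> is constant along a
  chain, and stripping it changes no length.\<close>

lemma le_bruhat: assumes "x \<preceq> y" shows "bruhat_le D x y"
proof -
  have x: "x \<in> EC" "(x, y) \<in> bstep\<^sup>*" using assms by (simp_all add: le_def)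
  obtain p u where pu: "p \<in> EC" "len p = 0" "u \<in> affine_weyl D" "x = p \<cdot> u"
    using ext_decomp[OF x(1)] by blast
  let ?r = "{(x, x \<cdot> t) | x t. x \<in> affine_weyl D \<and> t \<in> affine_reflections D \<and> weyl_length D x < weyl_length D (x \<cdot> t)}"
  have "\<exists>v. v \<in> affine_weyl D \<and> y = p \<cdot> v \<and> (u, v) \<in> ?r\<^sup>*"
    using x(2)
  proof (induction rule: rtrancl_induct)
    case base
    then show ?case using pu by blast
  next
    case (step y z)
    then obtain v where v: "v \<in> affine_weyl D" "y = p \<cdot> v" "(u, v) \<in> ?r\<^sup>*" by blast
    obtain t \<beta> where t: "reflects t \<beta>" "z = y \<cdot> t" "len y < len z"
      using step(2) by (rule bstepE)
    note vE = affine_weyl_carrier[OF v(1)] and tE = reflects_carrier[OF t(1)]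
    have ta: "t \<in> affine_reflections D" using t(1) by (rule reflects_affine)
    then have tw: "t \<in> affine_weyl D" by (rule affine_reflections_affine)
    have z: "z = p \<cdot> (v \<cdot> t)" using t v pu vE tE by (simp add: E.m_assoc)
    then have "len v < len (v \<cdot> t)" using t(3) v(2) len_0_mult pu vE tE by simp
    then have "weyl_length D v < weyl_length D (v \<cdot> t)" using vE tE by (simp add: weyl_length_len)
    then have "(v, v \<cdot> t) \<in> ?r" using v(1) ta by blast
    then have "(u, v \<cdot> t) \<in> ?r\<^sup>*" using v(3) by (rule rtrancl_into_rtrancl[rotated])
    then show ?case using z affine_weyl_mult v(1) tw by blast
  qed
  then obtain v where "v \<in> affine_weyl D" "y = p \<cdot> v" "(u, v) \<in> ?r\<^sup>*" by blast
  then have "bruhat_affine D u v" unfolding bruhat_affine_def using pu by blast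
  then show ?thesis
    unfolding bruhat_le_def using pu len_0_iff \<open>y = p \<cdot> v\<close> by blast
qed

lemma bruhat_le_len:
  assumes "bruhat_le D x y" shows "x \<in> EC" "len x \<le> len y"
proof -
  obtain p u v where p: "p \<in> length_zero_group D" "bruhat_affine D u v" "x = p \<cdot> u" "y = p \<cdot> v"
    using assms unfolding bruhat_le_def by blast
  have pE: "p \<in> EC" using p by (simp add: length_zero_group_def)
  have p0: "len p = 0" using p pE len_0_iff by blast
  have u: "u \<in> affine_weyl D" using p by (simp add: bruhat_affine_def)
  have "v \<in> EC \<and> len u \<le> len v"
    using p(2)[unfolded bruhat_affine_def, THEN conjunct2]
  proof (induction rule: rtrancl_induct)
    case base
    then show ?case using u affine_weyl_carrier by simp
  next
    case (step y z)
    then obtain t where t: "t \<in> affine_reflections D" "z = y \<cdot> t" "weyl_length D y < weyl_length D z" by auto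
    then have "t \<in> affine_weyl D" using affine_reflections_affine by blast
    with t step show ?case using affine_weyl_carrier by (auto simp: weyl_length_len)
  qed
  then show "x \<in> EC" "len x \<le> len y"
    using p pE p0 affine_weyl_carrier[OF u] len_0_mult by auto
qed

text \<open>If a coroot \<open>z\<close> takes the value m at the translation pulled back by the
  linear part, then \<open>(z, k)\<close> is inverted for 0 < k < m. A bound on the length thus
  bounds all coordinates of the translation, and the linear part varies in a finite group.\<close>

lemma finite_len_le: "finite {x \<in> carrier E. len x \<le> n}"
proof -
  define c where "c x = (\<lambda>i\<in>I. cr i (winv (snd x) (fst x)))" for x :: "'y weyl_elt"
  have bound: "cr i (winv (snd x) (fst x)) \<in> {- int n - 1..int n + 1}"
    if x: "x \<in> EC" "len x \<le> n" and i: "i \<in> I" for x i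
  proof -
    define m where "m = cr i (winv (snd x) (fst x))"
    have act: "act x (z, k) = (z \<circ> winv (snd x), k - z (winv (snd x) (fst x)))" for z :: "'y \<Rightarrow> int" and k
      by (simp add: act_eq)
    have *: "z (winv (snd x) (fst x)) \<le> int n + 1" if z: "z \<in> coroots D" for z
    proof -
      let ?m = "z (winv (snd x) (fst x))"
      have "(z, k) \<in> N x" if "k \<in> {0<..<?m}" for k
      proof -
        have R: "(z, k) \<in> R" using z by (simp add: R_def)
        moreover have "0 < ht (z, k)" using pos_root_iff[OF R] that by simp
        moreover have "\<not> 0 < ev x (z, k)"
          using pos_root_iff[OF act_R[OF x(1) R]] that ev_ht[OF x(1) R] by (simp add: act)
        ultimately show ?thesis using ev_nonzero[OF x(1) R] by (simp add: N_def)
      qed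
      then have "card (Pair z ` {0<..<?m}) \<le> card (N x)" by (intro card_mono finite_N) auto
      moreover have "card (Pair z ` {0<..<?m}) = card {0<..<?m}" by (rule card_image) (simp add: inj_on_def)
      ultimately show ?thesis using x(2) by (simp add: len_def)
    qed
    from *[OF cr_coroot[OF i]] *[OF coroot_uminus[OF cr_coroot[OF i]]] show ?thesis by simp
  qed
  have "inj_on (\<lambda>x. (snd x, c x)) {x \<in> carrier E. len x \<le> n}"
  proof (rule inj_onI, clarify)
    fix a b a' b' assume 1: "(a, b) \<in> EC" "(a', b') \<in> EC"
      and 2: "snd (a, b) = snd (a', b')" "c (a, b) = c (a', b')"
    have "winv b a = winv b a'"
      using fun_cong[OF 2(2)] 2(1) by (intro weight_ext) (metis (no_types, lifting) c_def fst_conv restrict_apply' snd_conv)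
    then have "b (winv b a) = b (winv b a')" by simp
    then show "a = a' \<and> b = b'" using 1 2(1) by (simp add: ext_carrier)
  qed
  moreover have "(\<lambda>x. (snd x, c x)) ` {x \<in> carrier E. len x \<le> n} \<subseteq> Wf \<times> (I \<rightarrow>\<^sub>E {- int n - 1..int n + 1})"
    using bound by (auto simp: c_def ext_carrier)
  moreover have "finite (Wf \<times> (I \<rightarrow>\<^sub>E {- int n - 1..int n + 1}))"
    by (intro finite_cartesian_product finite_Wf finite_PiE finite_I) simp
  ultimately show ?thesis by (meson inj_on_finite)
qed

subsection \<open>Directions of common inversions\<close>

text \<open>The cardinality of \<open>Fdir x y\<close> will bound the degree of \<open>T x \<otimes> T y\<close>. Counting finite parts
  instead of affine roots keeps it bounded as \<open>x\<close> and \<open>y\<close> get long.\<close>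

definition Fdir :: "'y weyl_elt \<Rightarrow> 'y weyl_elt \<Rightarrow> ('y \<Rightarrow> int) set" where
  "Fdir x y = fst ` (N x \<inter> N (ext_inv y))"

lemma finite_Fdir: "finite (Fdir x y)"
  by (simp add: Fdir_def finite_N)

lemma FdirE:
  assumes "\<phi> \<in> Fdir x y"
  obtains k where "(\<phi>, k) \<in> R" "0 < ht (\<phi>, k)" "ev x (\<phi>, k) < 0" "ev (ext_inv y) (\<phi>, k) < 0"
  using assms unfolding Fdir_def N_def by force

lemma FdirI:
  "(\<phi>, k) \<in> R \<Longrightarrow> 0 < ht (\<phi>, k) \<Longrightarrow> ev x (\<phi>, k) < 0 \<Longrightarrow> ev (ext_inv y) (\<phi>, k) < 0 \<Longrightarrow> \<phi> \<in> Fdir x y"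
  unfolding Fdir_def N_def by force

lemma ev_shift: "ev w (\<phi>, k + j) = ev w (\<phi>, k) + j * Hc"
  by (simp add: ev_def algebra_simps)

lemma R_shift: "(\<phi>, k) \<in> R \<Longrightarrow> (\<phi>, j) \<in> R"
  by (simp add: R_def)

text \<open>\<open>S i\<close> carries the common inversions for \<open>x\<close> and
  \<open>S i y\<close> to those for \<open>x S i\<close> and \<open>y\<close>. They stay positive
  because \<open>sroot i\<close>, not being inverted by \<open>x\<close>, is not among them.\<close>

lemma Fdir_shift:
  assumes x: "x \<in> EC" and y: "y \<in> EC" and i: "i \<in> I0" and up: "0 < ev x (sroot i)"
  shows "card (Fdir x (S i \<cdot> y)) \<le> card (Fdir (x \<cdot> S i) y)"
proof -
  define f :: "('y \<Rightarrow> int) \<Rightarrow> 'y \<Rightarrow> int" where "f \<phi> = \<phi> \<circ> winv (snd (S i))" for \<phi>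
  have act: "act (S i) \<alpha> = (f (fst \<alpha>), snd (act (S i) \<alpha>))" for \<alpha> by (simp add: act_eq f_def)
  have iy: "ext_inv (S i \<cdot> y) = ext_inv y \<cdot> S i" using y i by (simp add: E.inv_mult_group S_carrier)
  have "f ` Fdir x (S i \<cdot> y) \<subseteq> Fdir (x \<cdot> S i) y"
  proof
    fix \<psi> assume "\<psi> \<in> f ` Fdir x (S i \<cdot> y)"
    then obtain \<phi> where \<phi>: "\<phi> \<in> Fdir x (S i \<cdot> y)" "\<psi> = f \<phi>" by blast
    obtain k where k: "(\<phi>, k) \<in> R" "0 < ht (\<phi>, k)" "ev x (\<phi>, k) < 0" "ev (ext_inv (S i \<cdot> y)) (\<phi>, k) < 0"
      using \<phi>(1) by (rule FdirE)
    define k' where "k' = snd (act (S i) (\<phi>, k))"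
    have a: "act (S i) (\<phi>, k) = (\<psi>, k')" using act[of "(\<phi>, k)"] \<phi> by (simp add: k'_def)
    have "(\<phi>, k) \<noteq> sroot i" using k up by auto
    then have "0 < ht (\<psi>, k')" using S_permutes_pos[OF i k(1,2)] a by simp
    moreover have "(\<psi>, k') \<in> R" using act_R[OF S_carrier[OF i] k(1)] a by simp
    moreover have "ev (x \<cdot> S i) (\<psi>, k') < 0" using ev_mult_S_act[OF x i k(1)] a k(3) by simp
    moreover have "ev (ext_inv y) (\<psi>, k') < 0"
      using k(4) ev_mult[OF _ S_carrier[OF i] k(1), of "ext_inv y"] y a iy by simp
    ultimately show "\<psi> \<in> Fdir (x \<cdot> S i) y" by (intro FdirI)
  qed
  moreover have "inj_on f (Fdir x (S i \<cdot> y))"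
  proof (rule inj_onI)
    fix \<phi> \<psi> assume "f \<phi> = f \<psi>"
    moreover have "winv (snd (S i)) (snd (S i) v) = v" for v
      using S_carrier[OF i] by (simp add: ext_carrier)
    ultimately show "\<phi> = \<psi>" unfolding f_def by (metis comp_apply ext)
  qed
  ultimately show ?thesis using finite_Fdir by (metis card_image card_mono)
qed

text \<open>As for \<open>len_reflect\<close>, a direction is either kept or reflected; if both \<open>\<phi>\<close> and its reflection
  occur, comparing the \<open>\<delta>\<close>-coefficients of their representatives shows that both survive.\<close>

lemma Fdir_decrease:
  assumes x: "x \<in> EC" and y: "y \<in> EC" and i: "i \<in> I0"
    and up: "0 < ev x (sroot i)" and dn: "ev (ext_inv y) (sroot i) < 0"
  shows "card (Fdir x y) < card (Fdir (x \<cdot> S i) y)"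
proof -
  define f :: "('y \<Rightarrow> int) \<Rightarrow> 'y \<Rightarrow> int" where "f \<phi> = \<phi> \<circ> winv (snd (S i))" for \<phi>
  define m :: "('y \<Rightarrow> int) \<Rightarrow> int" where "m \<phi> = \<phi> (winv (snd (S i)) (fst (S i)))" for \<phi>
  have act: "act (S i) (\<phi>, k) = (f \<phi>, k - m \<phi>)" for \<phi> k by (simp add: act_eq f_def m_def)
  obtain \<theta> k0 where th: "sroot i = (\<theta>, k0)" by (cases "sroot i")
  have thR: "(\<theta>, k0) \<in> R" and thh: "ht (\<theta>, k0) = 1" using sroot_R[OF i] ht_sroot[OF i] th by simp_all
  have upS: "ev (x \<cdot> S i) (act (S i) \<alpha>) = ev x \<alpha>" "ev (x \<cdot> S i) \<alpha> = ev x (act (S i) \<alpha>)" if "\<alpha> \<in> R" for \<alpha>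
    using that ev_mult_S_act[OF x i] ev_mult[OF x S_carrier[OF i]] by simp_all
  have sub: "ev w (act (S i) \<alpha>) = ev w \<alpha> - fst \<alpha> (aroot i) * ev w (sroot i)" if "\<alpha> \<in> R" for w \<alpha>
    using that i by (simp add: act_S ev_sub_mult)
  have ff: "f (f \<phi>) = \<phi>" and mm: "m (f \<phi>) = - m \<phi>" if "(\<phi>, k) \<in> R" for \<phi> k
    using act_S_S[OF i that] by (simp_all add: act)
  show ?thesis
  proof (rule card_less_swap[where f = f and b = \<theta>])
    fix \<phi> assume \<phi>F: "\<phi> \<in> Fdir x y"
    then obtain k where k: "(\<phi>, k) \<in> R" "0 < ht (\<phi>, k)" "ev x (\<phi>, k) < 0" "ev (ext_inv y) (\<phi>, k) < 0"
      by (rule FdirE)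
    have ne: "(\<phi>, k) \<noteq> sroot i" using k up by auto
    note Sk = S_permutes_pos[OF i k(1,2) ne] act_R[OF S_carrier[OF i] k(1)]
    show "f (f \<phi>) = \<phi>" using ff k(1) .
    show "\<phi> \<in> Fdir (x \<cdot> S i) y \<or> f \<phi> \<in> Fdir (x \<cdot> S i) y"
    proof (cases "0 < \<phi> (aroot i)")
      case True
      then have "0 < \<phi> (aroot i) * ev x (sroot i)" using up by simp
      then have "ev (x \<cdot> S i) (\<phi>, k) < 0" using k sub[OF k(1), of x] upS(2)[OF k(1)] by simp
      then show ?thesis using k FdirI by blast
    next
      case False
      then have "0 \<le> \<phi> (aroot i) * ev (ext_inv y) (sroot i)" using dn by (intro mult_nonpos_nonpos) auto
      then have "ev (ext_inv y) (act (S i) (\<phi>, k)) < 0" using k sub[OF k(1), of "ext_inv y"] by simp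
      moreover have "ev (x \<cdot> S i) (act (S i) (\<phi>, k)) < 0" using k upS(1)[OF k(1)] by simp
      ultimately show ?thesis using Sk FdirI unfolding act by blast
    qed
    show "\<phi> \<in> Fdir (x \<cdot> S i) y" if f\<phi>: "f \<phi> \<in> Fdir x y"
    proof -
      obtain k' where k': "(f \<phi>, k') \<in> R" "0 < ht (f \<phi>, k')" "ev x (f \<phi>, k') < 0" "ev (ext_inv y) (f \<phi>, k') < 0"
        using f\<phi> by (rule FdirE)
      have ne': "(f \<phi>, k') \<noteq> sroot i" using k' up by auto
      show ?thesis
      proof (cases "k - m \<phi> \<le> k'")
        \<comment> \<open>The level \<open>k - m \<phi>\<close> does not exceed \<open>k'\<close>,
          and lowering the level only lowers \<open>ev\<close>; so the inequality known for
          \<open>k'\<close> passes to the image of \<open>(\<phi>, k)\<close>. The other case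
          exchanges the two levels and uses the inverse of \<open>y\<close>.\<close>
        case True
        then have "(k - m \<phi> - k') * Hc \<le> 0" using Hc_pos by (simp add: mult_le_0_iff)
        then have "ev x (f \<phi>, k - m \<phi>) < 0" using ev_shift[of x "f \<phi>" k' "k - m \<phi> - k'"] k' by simp
        then have "ev (x \<cdot> S i) (\<phi>, k) < 0" using upS(2)[OF k(1)] by (simp add: act)
        then show ?thesis using k FdirI by blast
      next
        case False
        have a': "act (S i) (f \<phi>, k') = (\<phi>, k' + m \<phi>)" using ff[OF k(1)] mm[OF k(1)] by (simp add: act)
        have "(k' + m \<phi> - k) * Hc \<le> 0" using False Hc_pos by (simp add: mult_le_0_iff)
        then have "ev (ext_inv y) (\<phi>, k' + m \<phi>) < 0"
          using ev_shift[of "ext_inv y" \<phi> k "k' + m \<phi> - k"] k by simp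
        moreover have "ev (x \<cdot> S i) (\<phi>, k' + m \<phi>) < 0" using upS(1)[OF k'(1)] k' a' by simp
        moreover have "0 < ht (\<phi>, k' + m \<phi>)" using S_permutes_pos[OF i k'(1,2) ne'] a' by simp
        ultimately show ?thesis using R_shift[OF k(1)] FdirI by blast
      qed
    qed
    show "f \<phi> \<noteq> \<theta>"
    proof
      assume "f \<phi> = \<theta>"
      then have "\<phi> = f \<theta>" using ff k(1) by metis
      also have "f \<theta> = - \<theta>" using act_S_sroot[OF i] th act[of \<theta> k0] by simp
      finally have \<phi>: "\<phi> = - \<theta>" .
      \<comment> \<open>\<open>(\<phi>, k)\<close> is the negative of \<open>sroot i\<close> with
        its level raised by \<open>k + k0\<close>. As the inverse of \<open>y\<close> inverts
        \<open>sroot i\<close>, it can make this negative only if \<open>k + k0 \<le> 0\<close>, and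
        then the height is at most -1.\<close>
      have e: "ev w (\<phi>, k) = - ev w (\<theta>, k0) + (k + k0) * Hc" for w
        by (simp add: ev_def \<phi> algebra_simps)
      have "k + k0 \<le> 0"
      proof (rule ccontr)
        assume "\<not> k + k0 \<le> 0"
        then have "0 < (k + k0) * Hc" using Hc_pos by simp
        then show False using e[of "ext_inv y"] k(4) dn th by simp
      qed
      then have "(k + k0) * Hc \<le> 0" using Hc_pos by (simp add: mult_le_0_iff)
      then show False using e[of "e1"] k(2) thh by simp
    qed
  next
    show "\<theta> \<in> Fdir (x \<cdot> S i) y"
      using thR thh up dn ev_mult_S[OF x i] th by (intro FdirI[of \<theta> k0]) simp_all
    show "\<theta> \<notin> Fdir x y"
    proof
      assume "\<theta> \<in> Fdir x y"
      then obtain k where k: "(\<theta>, k) \<in> R" "0 < ht (\<theta>, k)" "ev x (\<theta>, k) < 0" by (rule FdirE)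
      \<comment> \<open>Levels from \<open>k0\<close> upwards are not inverted by \<open>x\<close>,
        and levels below \<open>k0\<close> have height at most \<open>1 - Hc\<close>, which is
        negative.\<close>
      have e: "ev w (\<theta>, k) = ev w (\<theta>, k0) + (k - k0) * Hc" for w
        by (simp add: ev_def algebra_simps)
      have "k < k0"
      proof (rule ccontr)
        assume "\<not> k < k0"
        then have "0 \<le> (k - k0) * Hc" using Hc_pos by simp
        then show False using e[of x] k(3) up th by simp
      qed
      then have "(k - k0) * Hc \<le> - Hc" using Hc_mult(2)[of "k - k0"] by simp
      then show False using e[of "e1"] k(2) thh Hc_pos by simp
    qed
  qed (rule finite_Fdir)
qed

text \<open>A positive direction stays positive under \<open>x\<close>, since its level is
  nonnegative and \<open>x\<close> preserves \<open>Rp\<close>. For a direction - \<beta> with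
  \<beta> made negative by the inverse of \<open>u\<close>, the inverse of \<open>z\<close>
  preserves that sign, so the inverse of \<open>u z\<close> sends the root with direction - \<beta>
  to a positive one.\<close>

lemma Fdir_subset_FW:
  assumes x: "x \<in> Mr" and z: "z \<in> EC" "ext_inv z \<in> Mr" and u: "u \<in> FW"
  shows "Fdir x (u \<cdot> z) \<subseteq> fst ` uminus ` {\<beta> \<in> Rp. 0 < ev (ext_inv u) \<beta>}"
proof
  fix \<phi> assume "\<phi> \<in> Fdir x (u \<cdot> z)"
  then obtain k where k: "(\<phi>, k) \<in> R" "0 < ht (\<phi>, k)" "ev x (\<phi>, k) < 0" "ev (ext_inv (u \<cdot> z)) (\<phi>, k) < 0"
    by (rule FdirE)
  have \<phi>: "\<phi> \<in> coroots D" using k(1) by (simp add: R_def)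
  note uE = FW_carrier[OF u]
  have iuF: "ext_inv u \<in> FW" using u FW_inv by blast
  have neg: "- \<phi> \<in> pos_coroots D"
  proof (rule ccontr)
    assume "- \<phi> \<notin> pos_coroots D"
    then have "\<phi> \<in> pos_coroots D" using coroot_pos_or_neg[OF \<phi>] by blast
    then have "0 < ev x (\<phi>, 0)" using Mr_Rp[OF x] by (simp add: Rp_def)
    moreover have "0 \<le> k" using pos_root_iff[OF k(1)] k(2) by auto
    then have "0 \<le> k * Hc" using Hc_pos by simp
    ultimately show False using k(3) ev_shift[of x \<phi> 0 k] by simp
  qed
  define \<beta> where "\<beta> = (- \<phi>, 0::int)"
  have \<beta>: "\<beta> \<in> Rp" using neg by (simp add: \<beta>_def Rp_def)
  note \<beta>R = Rp_R(1)[OF \<beta>]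
  have "0 < ev (ext_inv u) \<beta>"
  proof (rule ccontr)
    assume "\<not> 0 < ev (ext_inv u) \<beta>"
    then have "ht (- act (ext_inv u) \<beta>) > 0"
      using ev_nonzero[OF FW_carrier[OF iuF] \<beta>R] ev_ht[OF FW_carrier[OF iuF] \<beta>R] by simp
    moreover have "- act (ext_inv u) \<beta> \<in> R" using \<beta>R iuF FW_carrier act_R R_uminus by blast
    moreover have "snd (- act (ext_inv u) \<beta>) = 0" using act_FW_snd[OF iuF \<beta>R] by (simp add: \<beta>_def)
    ultimately have "- act (ext_inv u) \<beta> \<in> Rp" by (intro Rp_I)
    then have "0 < ev (ext_inv z) (- act (ext_inv u) \<beta>)" using Mr_Rp z by blast
    then have "ev (ext_inv (u \<cdot> z)) \<beta> < 0"
      using z uE \<beta>R by (simp add: E.inv_mult_group ev_mult)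
    moreover have "0 \<le> k" using pos_root_iff[OF k(1)] k(2) by auto
    then have "0 \<le> k * Hc" using Hc_pos by simp
    moreover have "ev (ext_inv (u \<cdot> z)) (\<phi>, k) = - ev (ext_inv (u \<cdot> z)) \<beta> + k * Hc"
      by (simp add: ev_def \<beta>_def)
    ultimately show False using k(4) by simp
  qed
  then have "fst (- \<beta>) \<in> fst ` uminus ` {\<beta> \<in> Rp. 0 < ev (ext_inv u) \<beta>}"
    using \<beta> by (intro imageI) simp
  moreover have "fst (- \<beta>) = \<phi>" by (simp add: \<beta>_def fun_eq_iff)
  ultimately show "\<phi> \<in> fst ` uminus ` {\<beta> \<in> Rp. 0 < ev (ext_inv u) \<beta>}" by (simp only:)
qed

lemma card_Rp_pos:
  assumes u: "u \<in> FW"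
  shows "card {\<beta> \<in> Rp. 0 < ev (ext_inv u) \<beta>} + len u = len w0"
proof -
  have iu: "ext_inv u \<in> FW" using u FW_inv by blast
  let ?A = "{\<beta> \<in> Rp. 0 < ev (ext_inv u) \<beta>}" and ?B = "{\<beta> \<in> Rp. ev (ext_inv u) \<beta> < 0}"
  have "ev (ext_inv u) \<beta> \<noteq> 0" if "\<beta> \<in> Rp" for \<beta>
    using ev_nonzero[OF FW_carrier[OF iu] Rp_R(1)[OF that]] .
  then have "?A \<union> ?B = Rp" by (auto simp: neq_iff)
  moreover have "?A \<inter> ?B = {}" by auto
  moreover have "finite ?A" "finite ?B" using finite_Rp by simp_all
  ultimately have "card ?A + card (N (ext_inv u)) = card Rp"
    unfolding N_FW[OF iu] using card_Un_disjoint[of ?A ?B] by simp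
  then show ?thesis using len_inv[OF FW_carrier[OF u]] by (simp add: len_def N_w0)
qed

lemma card_Fdir_le:
  assumes "x \<in> Mr" "z \<in> EC" "ext_inv z \<in> Mr" "u \<in> FW"
  shows "card (Fdir x (u \<cdot> z)) + len u \<le> len w0"
proof -
  let ?B = "{\<beta> \<in> Rp. 0 < ev (ext_inv u) \<beta>}"
  have fin: "finite ?B" using finite_Rp by simp
  have "card (Fdir x (u \<cdot> z)) \<le> card (fst ` uminus ` ?B)"
    using fin by (intro card_mono Fdir_subset_FW assms) simp
  also have "\<dots> \<le> card ?B" using fin by (meson card_image_le finite_imageI order_trans)
  finally show ?thesis using card_Rp_pos[OF assms(4)] by simp
qed

text \<open>Primitivity puts \<open>v (cr i)\<close> at level 0 and positive, or at level 1 and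
  negative. So the image of \<open>(- cr i, 1)\<close> has level 1, or level 0 with positive finite
  part, and is positive either way; raising the level preserves this.\<close>

lemma primitive_iff:
  assumes "v \<in> Mr" "primitive_elt D v" "i \<in> I" "0 < k"
  shows "\<not> ev v (- cr i, k) < 0"
proof -
  have v: "v \<in> EC" using assms(1) by (rule Mr_carrier)
  have R: "(cr i, 0) \<in> R" "(- cr i, 1) \<in> R" using cr_coroot[OF assms(3)] coroot_uminus by (auto simp: R_def)
  have "act v (cr i, 0) \<in> neg_coroots D \<times> {1} \<union> pos_coroots D \<times> {0}"
    using assms(2,3) unfolding primitive_elt_def I_def[symmetric] by (metis sroot_I)
  moreover have "act v (- cr i, 1) = (- fst (act v (cr i, 0)), 1 - snd (act v (cr i, 0)))"
    by (auto simp: act_eq)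
  moreover have "- (- x) = x" for x :: "'y \<Rightarrow> int" by (simp add: fun_eq_iff)
  ultimately have "0 < ht (act v (- cr i, 1))"
    using pos_root_iff[OF act_R[OF v R(2)]] by (auto simp: neg_coroots_def image_iff)
  then have "0 < ev v (- cr i, 1)" using ev_ht[OF v R(2)] by simp
  moreover have "0 \<le> (k - 1) * Hc" using Hc_pos assms(4) by simp
  ultimately show ?thesis using ev_shift[of v "- cr i" 1 "k - 1"] by simp
qed

text \<open>For \<open>u\<close> different from \<open>w0\<close> some simple root is kept positive
  by the inverse of \<open>u\<close>. It is counted in the general bound but does not occur: a
  positive affine root with direction \<open>- cr i\<close> has level at least 1, which
  \<open>primitive_iff\<close> excludes from the inversions of \<open>v\<close>.\<close>

lemma card_Fdir_less:
  assumes v: "v \<in> Mr" "primitive_elt D v" and z: "z \<in> EC" "ext_inv z \<in> Mr"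
    and u: "u \<in> FW" "u \<noteq> w0"
  shows "card (Fdir v (u \<cdot> z)) + len u < len w0"
proof -
  let ?B = "{\<beta> \<in> Rp. 0 < ev (ext_inv u) \<beta>}"
  have iu: "ext_inv u \<in> FW" using u FW_inv by blast
  have "ext_inv u \<noteq> w0" using u FW_carrier w0_inv by (metis E.inv_inv)
  then have "\<exists>i\<in>I. 0 < ev (ext_inv u) (sroot i)" by (rule FW_up[OF iu])
  then obtain i where i: "i \<in> I" "0 < ev (ext_inv u) (sroot i)" by blast
  have fin: "finite ?B" using finite_Rp by simp
  have siB: "sroot i \<in> ?B" using i sroot_Rp by simp
  have "Fdir v (u \<cdot> z) \<subseteq> fst ` uminus ` (?B - {sroot i})"
  proof
    fix \<phi> assume \<phi>: "\<phi> \<in> Fdir v (u \<cdot> z)"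
    then obtain \<beta> where \<beta>: "\<beta> \<in> ?B" "\<phi> = fst (- \<beta>)" using Fdir_subset_FW[OF v(1) z u(1)] by blast
    obtain k where k: "(\<phi>, k) \<in> R" "0 < ht (\<phi>, k)" "ev v (\<phi>, k) < 0" using \<phi> by (rule FdirE)
    have "\<beta> \<noteq> sroot i"
    proof
      assume "\<beta> = sroot i"
      then have eq: "\<phi> = - cr i" using \<beta>(2) sroot_I[OF i(1)] by simp
      moreover have "- cr i \<notin> pos_coroots D"
        using pos_coroots_rho[OF coroot_uminus[OF cr_coroot[OF i(1)]]] i(1) by simp
      ultimately have "0 < k" using pos_root_iff[OF k(1)] k(2) by auto
      then show False using primitive_iff[OF v i(1)] k(3) eq by simp
    qed
    with \<beta> show "\<phi> \<in> fst ` uminus ` (?B - {sroot i})" by blast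
  qed
  then have "card (Fdir v (u \<cdot> z)) \<le> card (fst ` uminus ` (?B - {sroot i}))"
    using fin by (intro card_mono) simp_all
  also have "\<dots> \<le> card (?B - {sroot i})" using fin by (meson card_image_le finite_Diff finite_imageI order_trans)
  also have "\<dots> < card ?B" using fin siB by (rule card_Diff1_less)
  finally show ?thesis using card_Rp_pos[OF u(1)] by simp
qed

end

section \<open>Laurent polynomials and the free module\<close>

abbreviation "lk \<equiv> Poly_Mapping.lookup"
abbreviation "ks \<equiv> Poly_Mapping.keys"

lemma poly_mapping_expansion:
  fixes h :: "'a \<Rightarrow>\<^sub>0 'b::comm_monoid_add"
  assumes "finite X" "ks h \<subseteq> X"
  shows "h = (\<Sum>k\<in>X. Poly_Mapping.single k (lk h k))"
proof (rule poly_mapping_eqI)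
  fix w
  have "(\<Sum>k\<in>X. lk (Poly_Mapping.single k (lk h k)) w) = (\<Sum>k\<in>X. if k = w then lk h w else 0)"
    by (intro sum.cong) (auto simp: lookup_single when_def)
  also have "\<dots> = lk h w" using assms by (auto simp: in_keys_iff)
  finally show "lk h w = lk (\<Sum>k\<in>X. Poly_Mapping.single k (lk h k)) w" by (simp add: lookup_sum)
qed

abbreviation "lbar \<equiv> laurent_bar"

lemma lookup_lbar [simp]: "lk (lbar a) k = lk a (- k)"
  by (simp add: laurent_bar_def map_key.rep_eq inj_def)

lemma lbar_add [simp]: "lbar (a + b) = lbar a + lbar b"
  and lbar_uminus [simp]: "lbar (- a) = - lbar a"
  and lbar_diff [simp]: "lbar (a - b) = lbar a - lbar b"
  and lbar_0 [simp]: "lbar 0 = 0"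
  and lbar_lbar [simp]: "lbar (lbar a) = a"
  by (rule poly_mapping_eqI; simp add: lookup_add lookup_minus)+

lemma lbar_single [simp]: "lbar (Poly_Mapping.single k c) = Poly_Mapping.single (- k) c"
  by (rule poly_mapping_eqI) (auto simp: lookup_single when_def)

lemma lbar_qhalf [simp]: "lbar (qhalf k) = qhalf (- k)"
  by (simp add: qhalf_def)

lemma qhalf_0 [simp]: "qhalf 0 = 1"
  by (simp add: qhalf_def)

lemma lbar_1 [simp]: "lbar 1 = 1"
  by (metis lbar_qhalf neg_equal_zero qhalf_0)

lemma lbar_sum [simp]: "lbar (sum f X) = (\<Sum>x\<in>X. lbar (f x))"
  by (induction X rule: infinite_finite_induct) simp_all

lemma lbar_mult [simp]: "lbar (a * b) = lbar a * lbar b"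
proof -
  have s: "lbar (Poly_Mapping.single j c * b) = Poly_Mapping.single (- j) c * lbar b" for j c
    by (subst (1 2) poly_mapping_expansion[OF finite_keys order_refl, of b])
      (simp add: sum_distrib_left mult_single)
  show ?thesis
    by (subst (1 2) poly_mapping_expansion[OF finite_keys order_refl, of a])
      (simp add: sum_distrib_right s)
qed

lemma qhalf_mult [simp]: "qhalf j * qhalf k = qhalf (j + k)"
  by (simp add: qhalf_def mult_single)

definition ldeg :: "int \<Rightarrow> laurent \<Rightarrow> bool" where
  "ldeg k a \<longleftrightarrow> ks a \<subseteq> {..k}"

lemma ldeg_0 [simp]: "ldeg k 0"
  by (simp add: ldeg_def)

lemma ldeg_qhalf [simp]: "ldeg j (qhalf k) \<longleftrightarrow> k \<le> j"
  by (simp add: ldeg_def qhalf_def)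

lemma ldeg_1: "ldeg 0 1"
  using ldeg_qhalf[of 0 0] by simp

lemma ldeg_mono: "ldeg j a \<Longrightarrow> j \<le> k \<Longrightarrow> ldeg k a"
  by (auto simp: ldeg_def)

lemma ldeg_add: "ldeg k a \<Longrightarrow> ldeg k b \<Longrightarrow> ldeg k (a + b)"
  using keys_add[of a b] by (auto simp: ldeg_def)

lemma ldeg_uminus [simp]: "ldeg k (- a) \<longleftrightarrow> ldeg k a"
  by (simp add: ldeg_def)

lemma ldeg_diff: "ldeg k a \<Longrightarrow> ldeg k b \<Longrightarrow> ldeg k (a - b)"
  using ldeg_add[of k a "- b"] by simp

lemma ldeg_mult: assumes "ldeg j a" "ldeg k b" shows "ldeg (j + k) (a * b)"
  using assms keys_mult[of a b] by (fastforce simp: ldeg_def)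

lemma ldeg_neg_bar_eq: assumes "ldeg (- 1) a" "lbar a = a" shows "a = 0"
proof (rule poly_mapping_eqI)
  fix k
  have "lk a k = lk a (- k)" using assms(2) lookup_lbar by metis
  moreover have "lk a j = 0" if "j \<ge> 0" for j
    using assms(1) that by (force simp: ldeg_def in_keys_iff)
  ultimately show "lk a k = lk 0 k" by (cases "k \<ge> 0") auto
qed

text \<open>\<open>b\<close> is the part of \<open>r\<close> with negative exponents; antiinvariance
  kills the constant term and determines the rest.\<close>

lemma laurent_split:
  assumes "lbar r = - r" obtains b where "ldeg (- 1) b" "b - lbar b = r"
proof -
  have anti: "lk r (- k) = - lk r k" for k
    using assms lookup_lbar[of r k] by simp
  define b where "b = (\<Sum>k\<in>ks r \<inter> {..<0}. Poly_Mapping.single k (lk r k))"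
  have lb: "lk b k = (if k < 0 then lk r k else 0)" for k
  proof -
    have "lk b k = (\<Sum>j\<in>ks r \<inter> {..<0}. if j = k then lk r k else 0)"
      unfolding b_def lookup_sum by (intro sum.cong) (auto simp: lookup_single when_def)
    then show ?thesis by (auto simp: in_keys_iff)
  qed
  have "ldeg (- 1) b" unfolding ldeg_def by (auto simp: in_keys_iff lb split: if_splits)
  moreover have "b - lbar b = r"
  proof (rule poly_mapping_eqI)
    fix k show "lk (b - lbar b) k = lk r k"
      using anti[of k] anti[of 0] by (cases k "0::int" rule: linorder_cases) (auto simp: lookup_minus lb)
  qed
  ultimately show ?thesis by (rule that)
qed

lemma lookup_smul [simp]: "lk (a \<odot>\<^sub>A h) w = a * lk h w"
  by (simp add: smul_def Poly_Mapping.map.rep_eq when_def)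

lemma smul_add: "a \<odot>\<^sub>A (g + h) = a \<odot>\<^sub>A g + a \<odot>\<^sub>A h"
  and smul_add_left: "(a + b) \<odot>\<^sub>A h = a \<odot>\<^sub>A h + b \<odot>\<^sub>A h"
  and smul_diff: "a \<odot>\<^sub>A (g - h) = a \<odot>\<^sub>A g - a \<odot>\<^sub>A h"
  and smul_diff_left: "(a - b) \<odot>\<^sub>A h = a \<odot>\<^sub>A h - b \<odot>\<^sub>A h"
  and smul_smul [simp]: "a \<odot>\<^sub>A b \<odot>\<^sub>A h = (a * b) \<odot>\<^sub>A h"
  and smul_0 [simp]: "a \<odot>\<^sub>A 0 = 0"
  and smul_0_left [simp]: "0 \<odot>\<^sub>A h = 0"
  and smul_1 [simp]: "1 \<odot>\<^sub>A h = h"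
  and smul_minus_1: "(- 1) \<odot>\<^sub>A h = - h"
  by (rule poly_mapping_eqI; simp add: lookup_add lookup_minus algebra_simps)+

lemma smul_sum: "a \<odot>\<^sub>A (\<Sum>x\<in>X. f x) = (\<Sum>x\<in>X. a \<odot>\<^sub>A f x)"
  by (induction X rule: infinite_finite_induct) (simp_all add: smul_add)

lemma lookup_T: "lk (T w) v = (if v = w then 1 else 0)"
  by (simp add: T_def lookup_single when_def)

lemma smul_T: "a \<odot>\<^sub>A T w = Poly_Mapping.single w a"
  by (rule poly_mapping_eqI) (simp add: lookup_T lookup_single when_def)

lemma hecke_expansion:
  assumes "finite X" "ks h \<subseteq> X"
  shows "h = (\<Sum>w\<in>X. lk h w \<odot>\<^sub>A T w)"
  unfolding smul_T by (rule poly_mapping_expansion[OF assms])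

lemma keys_smul: "ks (a \<odot>\<^sub>A h) \<subseteq> ks h"
  by (auto simp: in_keys_iff)

lemma keys_minus: "ks (g - h) \<subseteq> ks g \<union> ks h" for g :: "'a \<Rightarrow>\<^sub>0 'b::ab_group_add"
  by (auto simp: in_keys_iff lookup_minus)

section \<open>The Hecke algebra\<close>

locale hecke_datum = affine_datum D for D :: "'y::ab_group_add root_datum" +
  fixes H :: "'y hecke_elt ring"
  assumes hecke: "hecke_algebra D H"
begin

abbreviation hmult (infixl "\<star>" 70) where "g \<star> h \<equiv> g \<otimes>\<^bsub>H\<^esub> h"
abbreviation "HC \<equiv> carrier H"
abbreviation "xi \<equiv> qhalf 1 - qhalf (- 1)"

sublocale H: ring H
  using hecke by (simp add: hecke_algebra_def)

lemma HC_iff: "h \<in> HC \<longleftrightarrow> ks h \<subseteq> EC"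
  using hecke by (simp add: hecke_algebra_def)

lemma HC_simps [simp]:
  "0 \<in> HC"
  "w \<in> EC \<Longrightarrow> T w \<in> HC"
  "g \<in> HC \<Longrightarrow> h \<in> HC \<Longrightarrow> g + h \<in> HC"
  "g \<in> HC \<Longrightarrow> h \<in> HC \<Longrightarrow> g - h \<in> HC"
  "h \<in> HC \<Longrightarrow> - h \<in> HC"
  "h \<in> HC \<Longrightarrow> a \<odot>\<^sub>A h \<in> HC"
  using keys_add[of g h] keys_minus[of g h] keys_smul[of a h] by (auto simp: HC_iff T_def)

lemma HC_sum [simp]: "(\<And>x. x \<in> X \<Longrightarrow> f x \<in> HC) \<Longrightarrow> sum f X \<in> HC"
  by (induction X rule: infinite_finite_induct) auto

lemma hecke_add: "g \<in> HC \<Longrightarrow> h \<in> HC \<Longrightarrow> g \<oplus>\<^bsub>H\<^esub> h = g + h"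
  using hecke by (simp add: hecke_algebra_def)

lemma smul_mult [simp]:
  "g \<in> HC \<Longrightarrow> h \<in> HC \<Longrightarrow> (a \<odot>\<^sub>A g) \<star> h = a \<odot>\<^sub>A (g \<star> h)"
  "g \<in> HC \<Longrightarrow> h \<in> HC \<Longrightarrow> g \<star> (a \<odot>\<^sub>A h) = a \<odot>\<^sub>A (g \<star> h)"
  using hecke by (simp_all add: hecke_algebra_def)

lemma mult_distrib:
  assumes "f \<in> HC" "g \<in> HC" "h \<in> HC"
  shows "(f + g) \<star> h = f \<star> h + g \<star> h" "h \<star> (f + g) = h \<star> f + h \<star> g"
    "(f - g) \<star> h = f \<star> h - g \<star> h" "h \<star> (f - g) = h \<star> f - h \<star> g"
proof -
  have add: "(f + g) \<star> h = f \<star> h + g \<star> h" "h \<star> (f + g) = h \<star> f + h \<star> g" if "g \<in> HC" for g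
    using H.l_distr[of f g h] H.r_distr[of f g h] assms that by (simp_all add: hecke_add)
  then show "(f + g) \<star> h = f \<star> h + g \<star> h" "h \<star> (f + g) = h \<star> f + h \<star> g" using assms by blast+
  \<comment> \<open>\<open>hecke_algebra\<close> ties the zero and the sum of \<open>H\<close> to
    those of the free module; negation is reached through the scalar -1.\<close>
  have neg: "(- g) \<star> h = - (g \<star> h)" "h \<star> (- g) = - (h \<star> g)"
    using smul_mult[of g h "- 1"] smul_mult[of h g "- 1"] assms by (simp_all add: smul_minus_1)
  show "(f - g) \<star> h = f \<star> h - g \<star> h" "h \<star> (f - g) = h \<star> f - h \<star> g"
    using add[of "- g"] neg assms by simp_all
qed

lemma mult_0 [simp]: "h \<in> HC \<Longrightarrow> 0 \<star> h = 0" "h \<in> HC \<Longrightarrow> h \<star> 0 = 0"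
  using mult_distrib(3,4)[of 0 0 h] by simp_all

lemma mult_sum:
  assumes "\<And>x. x \<in> X \<Longrightarrow> f x \<in> HC" "h \<in> HC"
  shows "(\<Sum>x\<in>X. f x) \<star> h = (\<Sum>x\<in>X. f x \<star> h)" "h \<star> (\<Sum>x\<in>X. f x) = (\<Sum>x\<in>X. h \<star> f x)"
  using assms(1)
  by (induction X rule: infinite_finite_induct) (simp_all add: assms(2) mult_distrib)

lemma hecke_induct [consumes 1, case_names zero single add]:
  assumes "h \<in> HC"
    and zero: "P 0"
    and single: "\<And>a w. w \<in> EC \<Longrightarrow> P (a \<odot>\<^sub>A T w)"
    and add: "\<And>f g. f \<in> HC \<Longrightarrow> g \<in> HC \<Longrightarrow> P f \<Longrightarrow> P g \<Longrightarrow> P (f + g)"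
  shows "P h"
proof -
  have "P (\<Sum>w\<in>X. lk h w \<odot>\<^sub>A T w)" if "finite X" "X \<subseteq> EC" for X
    using that
  proof (induction X rule: finite_induct)
    case (insert w X)
    then have "\<And>v. v \<in> X \<Longrightarrow> v \<in> EC" "w \<in> EC" by blast+
    then show ?case using insert by (simp add: add single)
  qed (simp add: zero)
  from this[of "ks h"] hecke_expansion[of "ks h" h] assms(1) show ?thesis by (simp add: HC_iff)
qed

lemma T_mult:
  assumes "u \<in> EC" "v \<in> EC" "N u \<inter> N (ext_inv v) = {}"
  shows "T u \<star> T v = T (u \<cdot> v)"
proof -
  have "reduced_product D u v"
    using len_mult[OF assms] assms by (simp add: reduced_product_def weyl_length_len)
  then show ?thesis using hecke assms unfolding hecke_algebra_def by blast
qed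

text \<open>\<open>hecke_algebra\<close> does not name the unit. Products with \<open>e1\<close> are
  reduced, so \<open>T e1\<close> is a left identity, and evaluating at the unit identifies the
  two.\<close>

lemma T_one: "\<one>\<^bsub>H\<^esub> = T e1"
proof -
  have N1: "N e1 = {}" using len_0_N[of "e1"] by simp
  have "T e1 \<star> h = h" if "h \<in> HC" for h
    using that
  proof (induction rule: hecke_induct)
    case (single a w)
    then show ?case using N1 T_mult[of "e1" w] by simp
  qed (simp_all add: mult_distrib)
  from this[of "\<one>\<^bsub>H\<^esub>"] show ?thesis by simp
qed

lemma T_S_up: "w \<in> EC \<Longrightarrow> i \<in> I0 \<Longrightarrow> 0 < ev w (sroot i) \<Longrightarrow> T w \<star> T (S i) = T (w \<cdot> S i)"
  by (rule T_mult) (auto simp: S_carrier N_S dest: N_D)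

lemma S_T_up: "w \<in> EC \<Longrightarrow> i \<in> I0 \<Longrightarrow> 0 < ev (ext_inv w) (sroot i) \<Longrightarrow> T (S i) \<star> T w = T (S i \<cdot> w)"
  by (rule T_mult) (auto simp: S_carrier N_S dest: N_D)

lemma T_S_square: "i \<in> I0 \<Longrightarrow> T (S i) \<star> T (S i) = xi \<odot>\<^sub>A T (S i) + T e1"
proof -
  assume i: "i \<in> I0"
  have "(T (S i) - qhalf 1 \<odot>\<^sub>A T e1) \<star> (T (S i) + qhalf (- 1) \<odot>\<^sub>A T e1) = 0"
    using hecke i unfolding hecke_algebra_def T_one[symmetric] I0_def by blast
  moreover have "T e1 \<star> h = h" "h \<star> T e1 = h" if "h \<in> HC" for h
    using that by (simp_all flip: T_one)
  ultimately have "T (S i) \<star> T (S i) + qhalf (- 1) \<odot>\<^sub>A T (S i) - (qhalf 1 \<odot>\<^sub>A T (S i) + T e1) = 0"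
    using i by (simp add: mult_distrib S_carrier smul_add smul_diff algebra_simps)
  then show ?thesis by (simp add: smul_diff_left algebra_simps)
qed

lemma one_mult [simp]: "h \<in> HC \<Longrightarrow> T e1 \<star> h = h" "h \<in> HC \<Longrightarrow> h \<star> T e1 = h"
  by (simp_all flip: T_one)

lemma T_S_down:
  assumes w: "w \<in> EC" and i: "i \<in> I0" and dn: "ev w (sroot i) < 0"
  shows "T w \<star> T (S i) = xi \<odot>\<^sub>A T w + T (w \<cdot> S i)"
proof -
  have Tw: "T w = T (w \<cdot> S i) \<star> T (S i)"
    using T_S_up[of "w \<cdot> S i" i] assms by (simp add: ev_mult_S S_carrier)
  have "T w \<star> T (S i) = T (w \<cdot> S i) \<star> (T (S i) \<star> T (S i))"
    unfolding Tw using w i by (simp add: H.m_assoc S_carrier)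
  also have "\<dots> = xi \<odot>\<^sub>A (T (w \<cdot> S i) \<star> T (S i)) + T (w \<cdot> S i)"
    using w i by (simp add: T_S_square mult_distrib S_carrier)
  finally show ?thesis unfolding Tw[symmetric] .
qed

lemma inv_mult_S: "w \<in> EC \<Longrightarrow> i \<in> I0 \<Longrightarrow> ext_inv (S i \<cdot> w) = ext_inv w \<cdot> S i"
  by (simp add: E.inv_mult_group S_carrier)

lemma S_T_down:
  assumes w: "w \<in> EC" and i: "i \<in> I0" and dn: "ev (ext_inv w) (sroot i) < 0"
  shows "T (S i) \<star> T w = xi \<odot>\<^sub>A T w + T (S i \<cdot> w)"
proof -
  have Tw: "T w = T (S i) \<star> T (S i \<cdot> w)"
    using S_T_up[of "S i \<cdot> w" i] assms by (simp add: ev_mult_S S_carrier inv_mult_S)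
  have "T (S i) \<star> T w = (T (S i) \<star> T (S i)) \<star> T (S i \<cdot> w)"
    unfolding Tw using w i by (simp add: H.m_assoc S_carrier)
  also have "\<dots> = xi \<odot>\<^sub>A (T (S i) \<star> T (S i \<cdot> w)) + T (S i \<cdot> w)"
    using w i by (simp add: T_S_square mult_distrib S_carrier)
  finally show ?thesis unfolding Tw[symmetric] .
qed

subsection \<open>Degrees of structure constants\<close>

text \<open>A filtration by degree in q^(1/2): \<open>Ldeg 0\<close> is the lattice and
  \<open>Ldeg (- 1)\<close> is q^(-1/2) times it.\<close>

definition Ldeg :: "int \<Rightarrow> 'y hecke_elt set" where
  "Ldeg k = {h \<in> HC. \<forall>w. ldeg k (lk h w)}"

lemma Ldeg_HC: "h \<in> Ldeg k \<Longrightarrow> h \<in> HC"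
  by (simp add: Ldeg_def)

lemma Ldeg_add: "g \<in> Ldeg k \<Longrightarrow> h \<in> Ldeg k \<Longrightarrow> g + h \<in> Ldeg k"
  by (simp add: Ldeg_def lookup_add ldeg_add)

lemma Ldeg_diff: "g \<in> Ldeg k \<Longrightarrow> h \<in> Ldeg k \<Longrightarrow> g - h \<in> Ldeg k"
  by (simp add: Ldeg_def lookup_minus ldeg_diff)

lemma Ldeg_smul: "ldeg j a \<Longrightarrow> h \<in> Ldeg k \<Longrightarrow> a \<odot>\<^sub>A h \<in> Ldeg (j + k)"
  by (simp add: Ldeg_def ldeg_mult)

lemma Ldeg_mono: "h \<in> Ldeg j \<Longrightarrow> j \<le> k \<Longrightarrow> h \<in> Ldeg k"
  by (auto simp: Ldeg_def intro: ldeg_mono)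

lemma Ldeg_0 [simp]: "0 \<in> Ldeg k"
  by (simp add: Ldeg_def)

lemma Ldeg_sum: "(\<And>x. x \<in> X \<Longrightarrow> f x \<in> Ldeg k) \<Longrightarrow> sum f X \<in> Ldeg k"
  by (induction X rule: infinite_finite_induct) (auto intro: Ldeg_add)

lemma Ldeg_T: "w \<in> EC \<Longrightarrow> T w \<in> Ldeg 0"
  by (simp add: Ldeg_def lookup_T ldeg_1)

text \<open>When \<open>S i\<close> shortens \<open>y\<close>, the product splits into a term with
  the factor \<open>xi\<close> of degree 1, compensated by the strict inequality
  \<open>Fdir_decrease\<close>, and a term covered by \<open>Fdir_shift\<close>; the latter alone
  occurs when \<open>S i\<close> lengthens \<open>y\<close>.\<close>

lemma T_mult_degree:
  assumes "x \<in> EC" "y \<in> EC"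
  shows "T x \<star> T y \<in> Ldeg (int (card (Fdir x y)))"
  using assms
proof (induction arbitrary: y rule: ext_induct)
  case (zero p)
  then have "N p = {}" by (simp add: len_0_N)
  then have "T p \<star> T y = T (p \<cdot> y)" "Fdir p y = {}" using zero by (simp_all add: T_mult Fdir_def)
  then show ?case using zero by (simp add: Ldeg_T)
next
  case (S x i)
  have SE: "S i \<in> EC" using S by (simp add: S_carrier)
  have eq: "T (x \<cdot> S i) \<star> T y = T x \<star> (T (S i) \<star> T y)"
    using S SE by (simp add: T_S_up[symmetric] H.m_assoc)
  have 1: "T x \<star> T (S i \<cdot> y) \<in> Ldeg (int (card (Fdir (x \<cdot> S i) y)))"
  proof (rule Ldeg_mono)
    show "T x \<star> T (S i \<cdot> y) \<in> Ldeg (int (card (Fdir x (S i \<cdot> y))))"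
      using S.IH S.prems SE by simp
  qed (use Fdir_shift S in simp)
  show ?case
  proof (cases "0 < ev (ext_inv y) (sroot i)")
    case True
    then show ?thesis using eq 1 S by (simp add: S_T_up)
  next
    case False
    then have dn: "ev (ext_inv y) (sroot i) < 0" using ev_sroot_neg S by simp
    have "T x \<star> T y \<in> Ldeg (int (card (Fdir (x \<cdot> S i) y)) - 1)"
      using S.IH[OF S.prems] by (rule Ldeg_mono) (use Fdir_decrease[OF S(1) S.prems S(2,3) dn] in simp)
    moreover have "ldeg 1 xi" by (intro ldeg_diff) simp_all
    ultimately have "xi \<odot>\<^sub>A (T x \<star> T y) \<in> Ldeg (int (card (Fdir (x \<cdot> S i) y)))"
      using Ldeg_smul by fastforce
    then show ?thesis using eq 1 S SE dn by (simp add: S_T_down mult_distrib Ldeg_add)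
  qed
qed

subsection \<open>The bar involution\<close>

lemma T_Units: assumes "w \<in> EC" shows "T w \<in> Units H"
  using assms
proof (induction rule: ext_induct)
  case (zero p)
  then have "N p = {}" "N (ext_inv p) = {}" by (simp_all flip: len_0_N)
  then have "T p \<star> T (ext_inv p) = \<one>\<^bsub>H\<^esub>" "T (ext_inv p) \<star> T p = \<one>\<^bsub>H\<^esub>"
    using zero by (simp_all add: T_mult T_one)
  then show ?case using zero unfolding Units_def by auto
next
  case (S w i)
  have SE: "S i \<in> EC" using S by (simp add: S_carrier)
  have "T (S i) \<star> (T (S i) - xi \<odot>\<^sub>A T e1) = \<one>\<^bsub>H\<^esub>" "(T (S i) - xi \<odot>\<^sub>A T e1) \<star> T (S i) = \<one>\<^bsub>H\<^esub>"
    using S SE by (simp_all add: mult_distrib T_S_square T_one)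
  then have "T (S i) \<in> Units H" using SE unfolding Units_def by auto
  then show ?case using S by (simp flip: T_S_up)
qed

definition bT :: "'y weyl_elt \<Rightarrow> 'y hecke_elt" where
  "bT w = inv\<^bsub>H\<^esub> (T (ext_inv w))"

lemma bT_HC [simp]: "w \<in> EC \<Longrightarrow> bT w \<in> HC"
  by (simp add: bT_def T_Units)

lemma bT_eqI:
  assumes "w \<in> EC" "h \<in> HC" "h \<star> T (ext_inv w) = T e1"
  shows "bT w = h"
proof -
  have "T (ext_inv w) \<in> Units H" using assms by (simp add: T_Units)
  then show ?thesis
    unfolding bT_def using assms H.inv_char[of "T (ext_inv w)" h] H.Units_l_cancel
    by (metis E.inv_closed H.Units_inv_closed H.Units_r_inv H.m_assoc H.r_one H.l_one HC_simps(2) T_one)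
qed

lemma bT_inv: "w \<in> EC \<Longrightarrow> bT w \<star> T (ext_inv w) = T e1" "w \<in> EC \<Longrightarrow> T (ext_inv w) \<star> bT w = T e1"
  using T_Units[of "ext_inv w"] by (simp_all add: bT_def T_one)

lemma bT_zero: assumes "p \<in> EC" "len p = 0" shows "bT p = T p"
proof (rule bT_eqI)
  have "N p = {}" using assms by (simp flip: len_0_N)
  then show "T p \<star> T (ext_inv p) = T e1" using assms by (simp add: T_mult)
qed (use assms in simp_all)

lemma bT_one [simp]: "bT e1 = T e1"
  by (simp add: bT_zero)

lemma bT_mult:
  assumes u: "u \<in> EC" and v: "v \<in> EC" and disj: "N (ext_inv v) \<inter> N u = {}"
  shows "bT (u \<cdot> v) = bT u \<star> bT v"
proof (rule bT_eqI)
  have "T (ext_inv (u \<cdot> v)) = T (ext_inv v) \<star> T (ext_inv u)"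
    using assms by (simp add: T_mult E.inv_mult_group)
  then have "bT u \<star> bT v \<star> T (ext_inv (u \<cdot> v)) = bT u \<star> (bT v \<star> T (ext_inv v)) \<star> T (ext_inv u)"
    using u v by (simp add: H.m_assoc)
  then show "bT u \<star> bT v \<star> T (ext_inv (u \<cdot> v)) = T e1"
    using u v by (simp add: bT_inv)
qed (use u v in simp_all)

lemma bT_S: "i \<in> I0 \<Longrightarrow> bT (S i) = T (S i) - xi \<odot>\<^sub>A T e1"
  by (rule bT_eqI) (simp_all add: S_carrier mult_distrib T_S_square)

lemma bT_S_up: "w \<in> EC \<Longrightarrow> i \<in> I0 \<Longrightarrow> 0 < ev w (sroot i) \<Longrightarrow> bT (w \<cdot> S i) = bT w \<star> bT (S i)"
  by (rule bT_mult) (auto simp: S_carrier N_S dest: N_D)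

definition bar :: "'y hecke_elt \<Rightarrow> 'y hecke_elt" where
  "bar h = (\<Sum>w\<in>ks h. lbar (lk h w) \<odot>\<^sub>A bT w)"

lemma hecke_bar_eq: "hecke_bar D H h = bar h"
  by (simp add: hecke_bar_def bar_def bT_def)

lemma bar_over: "finite X \<Longrightarrow> ks h \<subseteq> X \<Longrightarrow> bar h = (\<Sum>w\<in>X. lbar (lk h w) \<odot>\<^sub>A bT w)"
  unfolding bar_def by (rule sum.mono_neutral_left) (auto simp: in_keys_iff)

lemma bar_HC [simp]: "h \<in> HC \<Longrightarrow> bar h \<in> HC"
  unfolding bar_def by (intro HC_sum HC_simps bT_HC) (auto simp: HC_iff)

lemma bar_add: "bar (g + h) = bar g + bar h"
proof -
  have "finite (ks g \<union> ks h)" by simp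
  then show ?thesis
    using bar_over[of "ks g \<union> ks h"] keys_add[of g h]
    by (simp add: lookup_add smul_add_left sum.distrib)
qed

lemma bar_smul: "bar (a \<odot>\<^sub>A h) = lbar a \<odot>\<^sub>A bar h"
  using bar_over[of "ks h" "a \<odot>\<^sub>A h"] keys_smul[of a h] by (simp add: bar_def smul_sum)

lemma bar_T [simp]: "bar (T w) = bT w"
  using bar_over[of "{w}" "T w"] by (simp add: T_def)

lemma bar_0 [simp]: "bar 0 = 0"
  by (simp add: bar_def)

lemma bar_uminus: "bar (- h) = - bar h"
  using bar_smul[of "- 1" h] by (simp add: smul_minus_1)

lemma bar_diff: "bar (g - h) = bar g - bar h"
  using bar_add[of g "- h"] by (simp add: bar_uminus)

lemma bar_sum: "bar (\<Sum>x\<in>X. f x) = (\<Sum>x\<in>X. bar (f x))"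
  by (induction X rule: infinite_finite_induct) (simp_all add: bar_add)

lemma bT_S_square: "i \<in> I0 \<Longrightarrow> bT (S i) \<star> bT (S i) = T e1 - xi \<odot>\<^sub>A bT (S i)"
  by (simp add: bT_S mult_distrib S_carrier T_S_square smul_diff smul_add smul_diff_left algebra_simps)

text \<open>\<open>hecke_bar\<close> prescribes values on the basis only, so multiplicativity has to
  be proved. This is the case of one generator; if \<open>S i\<close> shortens \<open>w\<close>, it
  amounts to comparing the quadratic relation with its barred form
  \<open>bT_S_square\<close>.\<close>

lemma bar_T_mult_S:
  assumes w: "w \<in> EC" and i: "i \<in> I0"
  shows "bar (T w \<star> T (S i)) = bT w \<star> bT (S i)"
proof (cases "0 < ev w (sroot i)")
  case True
  then show ?thesis using w i by (simp add: T_S_up bT_S_up)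
next
  case False
  then have dn: "ev w (sroot i) < 0" using ev_sroot_neg w i by blast
  have SE: "S i \<in> EC" using i by (rule S_carrier)
  have "bT w = bT (w \<cdot> S i) \<star> bT (S i)"
    using bT_S_up[of "w \<cdot> S i" i] w i dn by (simp add: ev_mult_S SE)
  then have "bT w \<star> bT (S i) = bT (w \<cdot> S i) \<star> (bT (S i) \<star> bT (S i))"
    using w SE by (simp add: H.m_assoc)
  also have "\<dots> = bT (w \<cdot> S i) - xi \<odot>\<^sub>A (bT (w \<cdot> S i) \<star> bT (S i))"
    using w i SE by (simp add: bT_S_square mult_distrib)
  also have "\<dots> = bT (w \<cdot> S i) - xi \<odot>\<^sub>A bT w"
    using \<open>bT w = bT (w \<cdot> S i) \<star> bT (S i)\<close> by simp
  also have "\<dots> = bar (T w \<star> T (S i))"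
    using w i dn by (simp add: T_S_down bar_add bar_diff bar_smul smul_diff_left)
  finally show ?thesis by simp
qed

lemma bar_mult_S:
  assumes "h \<in> HC" and i: "i \<in> I0"
  shows "bar (h \<star> T (S i)) = bar h \<star> bT (S i)"
  using assms(1)
proof (induction rule: hecke_induct)
  case (single a w)
  then show ?case using i by (simp add: bar_smul bar_T_mult_S S_carrier)
qed (simp_all add: mult_distrib S_carrier i bar_add)

lemma bar_mult_T:
  assumes "v \<in> EC" "h \<in> HC"
  shows "bar (h \<star> T v) = bar h \<star> bT v"
  using assms
proof (induction arbitrary: h rule: ext_induct)
  case (zero p)
  have Np: "N (ext_inv p) = {}" using zero by (simp flip: len_0_N)
  from zero(3) show ?case
  proof (induction rule: hecke_induct)
    case (single a w)
    then show ?case using zero Np by (simp add: bar_smul T_mult bT_mult)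
  qed (simp_all add: mult_distrib zero bar_add)
next
  case (S v i)
  have SE: "S i \<in> EC" using S by (simp add: S_carrier)
  have "h \<star> T (v \<cdot> S i) = (h \<star> T v) \<star> T (S i)" using S SE by (simp add: T_S_up[symmetric] H.m_assoc)
  then have "bar (h \<star> T (v \<cdot> S i)) = bar (h \<star> T v \<star> T (S i))" by (simp only:)
  also have "\<dots> = bar h \<star> bT v \<star> bT (S i)" using S by (simp add: bar_mult_S S.IH)
  also have "\<dots> = bar h \<star> bT (v \<cdot> S i)" using S SE by (simp add: bT_S_up H.m_assoc)
  finally show ?case .
qed

lemma bar_mult: "g \<in> HC \<Longrightarrow> h \<in> HC \<Longrightarrow> bar (g \<star> h) = bar g \<star> bar h"
proof -
  assume g: "g \<in> HC" and h: "h \<in> HC"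
  from h show ?thesis
  proof (induction rule: hecke_induct)
    case (single a w)
    then show ?case using g by (simp add: bar_smul bar_mult_T)
  qed (simp_all add: mult_distrib g bar_add)
qed

lemma bar_bT: "w \<in> EC \<Longrightarrow> bar (bT w) = T w"
proof (induction rule: ext_induct)
  case (S w i)
  have "bar (bT (S i)) = T (S i)"
    using S(2) by (simp add: bT_S bar_diff bar_smul smul_diff_left)
  then show ?case using S by (simp add: bT_S_up bar_mult S_carrier T_S_up)
qed (simp add: bT_zero)

lemma bar_bar: "h \<in> HC \<Longrightarrow> bar (bar h) = h"
  by (induction rule: hecke_induct) (simp_all add: bar_add bar_smul bar_bT)

section \<open>Triangularity of the bar involution and uniqueness of Kazhdan-Lusztig
  elements\<close>

definition Sp :: "'y weyl_elt set \<Rightarrow> 'y hecke_elt set" where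
  "Sp X = {h \<in> HC. ks h \<subseteq> X}"

lemma Sp_HC: "h \<in> Sp X \<Longrightarrow> h \<in> HC"
  by (simp add: Sp_def)

lemma Sp_add: "g \<in> Sp X \<Longrightarrow> h \<in> Sp X \<Longrightarrow> g + h \<in> Sp X"
  using keys_add[of g h] by (auto simp: Sp_def)

lemma Sp_diff: "g \<in> Sp X \<Longrightarrow> h \<in> Sp X \<Longrightarrow> g - h \<in> Sp X"
  using keys_minus[of g h] by (auto simp: Sp_def)

lemma Sp_smul: "h \<in> Sp X \<Longrightarrow> a \<odot>\<^sub>A h \<in> Sp X"
  using keys_smul[of a h] by (auto simp: Sp_def)

lemma Sp_0 [simp]: "0 \<in> Sp X"
  by (simp add: Sp_def)

lemma Sp_sum: "(\<And>x. x \<in> Y \<Longrightarrow> f x \<in> Sp X) \<Longrightarrow> sum f Y \<in> Sp X"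
  by (induction Y rule: infinite_finite_induct) (auto intro: Sp_add)

lemma Sp_T: "w \<in> EC \<Longrightarrow> w \<in> X \<Longrightarrow> T w \<in> Sp X"
  by (simp add: Sp_def) (simp add: T_def)

lemma Sp_mono: "h \<in> Sp X \<Longrightarrow> X \<subseteq> Y \<Longrightarrow> h \<in> Sp Y"
  by (auto simp: Sp_def)

lemma Sp_lookup: "h \<in> Sp X \<Longrightarrow> w \<notin> X \<Longrightarrow> lk h w = 0"
  by (auto simp: Sp_def in_keys_iff)

lemma Sp_expansion: "h \<in> Sp X \<Longrightarrow> h = (\<Sum>w\<in>ks h. lk h w \<odot>\<^sub>A T w)"
  by (rule hecke_expansion) auto

lemma Sp_I: "h \<in> HC \<Longrightarrow> (\<And>w. w \<notin> X \<Longrightarrow> lk h w = 0) \<Longrightarrow> h \<in> Sp X"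
  by (auto simp: Sp_def in_keys_iff)

lemma Sp_mult_S:
  assumes h: "h \<in> Sp X" and i: "i \<in> I0" and XY: "\<And>w. w \<in> X \<Longrightarrow> w \<in> EC \<Longrightarrow> w \<in> Y \<and> w \<cdot> S i \<in> Y"
  shows "h \<star> T (S i) \<in> Sp Y"
proof -
  have TS: "T w \<star> T (S i) \<in> Sp Y" if w: "w \<in> X" "w \<in> EC" for w
  proof (cases "0 < ev w (sroot i)")
    case True
    then show ?thesis using w i XY[OF w] by (simp add: T_S_up Sp_T S_carrier)
  next
    case False
    then have "ev w (sroot i) < 0" using ev_sroot_neg w i by blast
    then show ?thesis using w i XY[OF w] by (simp add: T_S_down Sp_T Sp_add Sp_smul S_carrier)
  qed
  have k: "w \<in> X" "w \<in> EC" if "w \<in> ks h" for w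
    using h that by (auto simp: Sp_def HC_iff)
  have "h \<star> T (S i) = (\<Sum>w\<in>ks h. lk h w \<odot>\<^sub>A (T w \<star> T (S i)))"
    by (subst Sp_expansion[OF h]) (simp add: mult_sum k S_carrier i)
  then show ?thesis using TS k by (simp add: Sp_sum Sp_smul)
qed

abbreviation below :: "'y weyl_elt \<Rightarrow> 'y weyl_elt set" where
  "below x \<equiv> {y. y \<preceq> x \<and> y \<noteq> x}"

text \<open>Multiplying by the barred generator replaces a lower term \<open>y\<close> by a
  combination of \<open>y\<close> and \<open>y S i\<close>. Both lie below \<open>x S i\<close> by
  \<open>le_lift\<close>, and they differ from it because \<open>y\<close> is strictly shorter than
  \<open>x\<close>.\<close>

lemma bT_triangular: "x \<in> EC \<Longrightarrow> bT x - T x \<in> Sp (below x)"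
proof (induction rule: ext_induct)
  case (zero p)
  then show ?case by (simp add: bT_zero)
next
  case (S x i)
  define g where "g = bT x - T x"
  have g: "g \<in> Sp (below x)" using S by (simp add: g_def)
  have gHC: "g \<in> HC" using g by (rule Sp_HC)
  have SE: "S i \<in> EC" using S by (simp add: S_carrier)
  have "bT (x \<cdot> S i) = (T x + g) \<star> (T (S i) - xi \<odot>\<^sub>A T e1)"
    using S by (simp add: bT_S_up bT_S g_def)
  also have "\<dots> = T (x \<cdot> S i) + (g \<star> T (S i) - xi \<odot>\<^sub>A T x - xi \<odot>\<^sub>A g)"
    using S SE gHC by (simp add: mult_distrib T_S_up smul_add)
  finally have eq: "bT (x \<cdot> S i) - T (x \<cdot> S i) = g \<star> T (S i) - xi \<odot>\<^sub>A T x - xi \<odot>\<^sub>A g" by simp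
  have up: "x \<preceq> x \<cdot> S i" "len (x \<cdot> S i) = Suc (len x)"
    using S le_S_up len_S_up by blast+
  then have xb: "x \<in> below (x \<cdot> S i)" by auto
  have yb: "y \<in> below (x \<cdot> S i) \<and> y \<cdot> S i \<in> below (x \<cdot> S i)" if y: "y \<in> below x" for y
  proof -
    have "len y < len x" using y le_len by blast
    moreover have "len (y \<cdot> S i) \<le> Suc (len y)" using len_S_le y le_carrier(1) S(2) by blast
    moreover have "y \<preceq> x \<cdot> S i" using y up le_trans by blast
    moreover have "y \<cdot> S i \<preceq> x \<cdot> S i" using le_lift y S by blast
    ultimately show ?thesis using up(2) by auto
  qed
  have "g \<star> T (S i) \<in> Sp (below (x \<cdot> S i))" using g S(2) yb by (intro Sp_mult_S)
  moreover have "T x \<in> Sp (below (x \<cdot> S i))" using xb S by (intro Sp_T) auto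
  moreover have "g \<in> Sp (below (x \<cdot> S i))" using g by (rule Sp_mono) (use yb in blast)
  ultimately show ?case unfolding eq by (intro Sp_diff Sp_smul)
qed

lemma lookup_bT:
  assumes "x \<in> EC"
  shows "lk (bT x) x = 1" "y \<noteq> x \<Longrightarrow> len x \<le> len y \<Longrightarrow> lk (bT x) y = 0"
proof -
  have eq: "lk (bT x) y = lk (T x) y + lk (bT x - T x) y" for y by (simp add: lookup_minus)
  show "lk (bT x) x = 1" using eq[of x] Sp_lookup[OF bT_triangular[OF assms], of x] by (simp add: lookup_T)
  assume y: "y \<noteq> x" "len x \<le> len y"
  then have "y \<notin> below x" using le_len[of y x] by auto
  then show "lk (bT x) y = 0" using eq[of y] y Sp_lookup[OF bT_triangular[OF assms], of y] by (simp add: lookup_T)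
qed

lemma bar_lookup_maximal:
  assumes h: "h \<in> HC" and max: "\<And>x. x \<in> ks h \<Longrightarrow> len x \<le> len w"
  shows "lk (bar h) w = lbar (lk h w)"
proof -
  have k: "x \<in> EC" if "x \<in> ks h" for x using h that by (auto simp: HC_iff)
  have "lk (bar h) w = (\<Sum>x\<in>ks h. lbar (lk h x) * lk (bT x) w)" by (simp add: bar_def lookup_sum)
  also have "\<dots> = (\<Sum>x\<in>ks h. if x = w then lbar (lk h w) else 0)"
    using k max by (intro sum.cong) (auto simp: lookup_bT)
  finally show ?thesis by (auto simp: in_keys_iff)
qed

lemma Ldeg_lookup: "h \<in> Ldeg k \<Longrightarrow> ldeg k (lk h w)"
  unfolding Ldeg_def by blast

text \<open>By triangularity the coefficient at a longest element of the support is itself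
  bar-invariant; having negative degree, it vanishes.\<close>

lemma bar_fixed_neg: assumes "h \<in> Ldeg (- 1)" "bar h = h" shows "h = 0"
proof (rule ccontr)
  assume "h \<noteq> 0"
  then have "finite (ks h)" "ks h \<noteq> {}" by simp_all
  then obtain w where w: "w \<in> ks h" "\<And>x. x \<in> ks h \<Longrightarrow> int (len x) \<le> int (len w)"
    using finite_maximizer[of "ks h" "\<lambda>w. int (len w)"] by blast
  then have "lbar (lk h w) = lk h w"
    using bar_lookup_maximal[OF Ldeg_HC[OF assms(1)], of w] assms(2) by simp
  moreover have "ldeg (- 1) (lk h w)" using assms(1) by (rule Ldeg_lookup)
  ultimately have "lk h w = 0" by (rule ldeg_neg_bar_eq[rotated])
  with w(1) show False by (simp add: in_keys_iff)
qed

lemma Ldeg_minus_1_eq: "(\<lambda>g. qhalf (- 1) \<odot>\<^sub>A g) ` hecke_lattice D = Ldeg (- 1)"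
proof -
  have lat: "g \<in> hecke_lattice D \<longleftrightarrow> g \<in> Ldeg 0" for g
    by (auto simp: hecke_lattice_def Ldeg_def HC_iff ldeg_def laurent_minus_def)
  have "g \<in> (\<lambda>g. qhalf (- 1) \<odot>\<^sub>A g) ` hecke_lattice D" if "g \<in> Ldeg (- 1)" for g
  proof (rule image_eqI)
    show "g = qhalf (- 1) \<odot>\<^sub>A (qhalf 1 \<odot>\<^sub>A g)" by simp
    show "qhalf 1 \<odot>\<^sub>A g \<in> hecke_lattice D"
      using Ldeg_smul[OF _ that, of 1 "qhalf 1"] by (simp add: lat)
  qed
  moreover have "qhalf (- 1) \<odot>\<^sub>A g \<in> Ldeg (- 1)" if "g \<in> hecke_lattice D" for g
    using Ldeg_smul[of "- 1" "qhalf (- 1)" g 0] that by (simp add: lat)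
  ultimately show ?thesis by blast
qed

text \<open>\<open>KL\<close> is a definite description; by \<open>bar_fixed_neg\<close> any witness
  is the only one, so each evaluation of \<open>KL\<close> amounts to exhibiting an element.\<close>

lemma KL_eqI:
  assumes "h \<in> HC" "bar h = h" "h - T w \<in> Ldeg (- 1)"
  shows "KL D H w = h"
  unfolding KL_def Ldeg_minus_1_eq hecke_bar_eq
proof (rule the_equality)
  fix g assume g: "g \<in> HC \<and> bar g = g \<and> g - T w \<in> Ldeg (- 1)"
  have "g - h = (g - T w) - (h - T w)" by simp
  then have "g - h \<in> Ldeg (- 1)" using g assms Ldeg_diff by metis
  moreover have "bar (g - h) = g - h" using g assms by (simp add: bar_diff)
  ultimately show "g = h" using bar_fixed_neg by fastforce
qed (use assms in blast)

subsection \<open>The anti-involution inverting basis elements\<close>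

text \<open>It exchanges left and right cosets of \<open>W\<^sub>f\<close>, so that only left-handed statements need proof.\<close>

definition iota :: "'y hecke_elt \<Rightarrow> 'y hecke_elt" where
  "iota h = (\<Sum>w\<in>ks h. lk h w \<odot>\<^sub>A T (ext_inv w))"

lemma iota_over: "finite X \<Longrightarrow> ks h \<subseteq> X \<Longrightarrow> iota h = (\<Sum>w\<in>X. lk h w \<odot>\<^sub>A T (ext_inv w))"
  unfolding iota_def by (rule sum.mono_neutral_left) (auto simp: in_keys_iff)

lemma iota_HC [simp]: "h \<in> HC \<Longrightarrow> iota h \<in> HC"
  unfolding iota_def by (intro HC_sum HC_simps E.inv_closed) (auto simp: HC_iff)

lemma iota_add: "iota (g + h) = iota g + iota h"
proof -
  have "finite (ks g \<union> ks h)" by simp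
  then show ?thesis
    using iota_over[of "ks g \<union> ks h"] keys_add[of g h]
    by (simp add: lookup_add smul_add_left sum.distrib)
qed

lemma iota_smul: "iota (a \<odot>\<^sub>A h) = a \<odot>\<^sub>A iota h"
  using iota_over[of "ks h" "a \<odot>\<^sub>A h"] keys_smul[of a h] by (simp add: iota_def smul_sum)

lemma iota_T [simp]: "iota (T w) = T (ext_inv w)"
  using iota_over[of "{w}" "T w"] by (simp add: T_def)

lemma iota_0 [simp]: "iota 0 = 0"
  by (simp add: iota_def)

lemma iota_diff: "iota (g - h) = iota g - iota h"
  using iota_add[of g "- h"] iota_smul[of "- 1" h] by (simp add: smul_minus_1)

lemma iota_sum: "iota (\<Sum>x\<in>X. f x) = (\<Sum>x\<in>X. iota (f x))"
  by (induction X rule: infinite_finite_induct) (simp_all add: iota_add)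

lemma lookup_iota: assumes "h \<in> HC" "w \<in> EC" shows "lk (iota h) w = lk h (ext_inv w)"
proof -
  have "lk (iota h) w = (\<Sum>v\<in>ks h. if v = ext_inv w then lk h (ext_inv w) else 0)"
    unfolding iota_def lookup_sum
    using assms by (intro sum.cong) (auto simp: lookup_T HC_iff subset_iff)
  then show ?thesis by (auto simp: in_keys_iff)
qed

lemma iota_Ldeg: assumes "h \<in> Ldeg k" shows "iota h \<in> Ldeg k"
proof -
  have h: "h \<in> HC" using assms by (rule Ldeg_HC)
  have "ldeg k (lk (iota h) w)" for w
  proof (cases "w \<in> EC")
    case True
    then have "lk (iota h) w = lk h (ext_inv w)" using h by (simp add: lookup_iota)
    then show ?thesis using Ldeg_lookup[OF assms] by simp
  next
    case False
    then have "lk (iota h) w = 0" using iota_HC[OF h] by (auto simp: HC_iff in_keys_iff)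
    then show ?thesis by simp
  qed
  then show ?thesis using iota_HC[OF h] unfolding Ldeg_def by blast
qed

lemma iota_mult_S:
  assumes "h \<in> HC" and i: "i \<in> I0"
  shows "iota (h \<star> T (S i)) = T (S i) \<star> iota h"
  using assms(1)
proof (induction rule: hecke_induct)
  case (single a w)
  have "iota (T w \<star> T (S i)) = T (S i) \<star> T (ext_inv w)"
  proof (cases "0 < ev w (sroot i)")
    case True
    then show ?thesis using single i by (simp add: T_S_up S_T_up E.inv_mult_group S_carrier)
  next
    case False
    then have "ev w (sroot i) < 0" using ev_sroot_neg single i by blast
    then show ?thesis using single i
      by (simp add: T_S_down S_T_down E.inv_mult_group S_carrier iota_add iota_smul)
  qed
  then show ?case using i single by (simp add: iota_smul S_carrier)
qed (simp_all add: mult_distrib S_carrier i iota_add)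

lemma iota_mult_T:
  assumes "v \<in> EC" "h \<in> HC"
  shows "iota (h \<star> T v) = T (ext_inv v) \<star> iota h"
  using assms
proof (induction arbitrary: h rule: ext_induct)
  case (zero p)
  have Np: "N p = {}" "N (ext_inv p) = {}" using zero by (simp_all flip: len_0_N)
  from zero(3) show ?case
  proof (induction rule: hecke_induct)
    case (single a w)
    then show ?case using zero Np by (simp add: iota_smul T_mult E.inv_mult_group)
  qed (simp_all add: mult_distrib zero iota_add)
next
  case (S v i)
  have SE: "S i \<in> EC" using S by (simp add: S_carrier)
  have "h \<star> T (v \<cdot> S i) = (h \<star> T v) \<star> T (S i)" using S SE by (simp add: T_S_up[symmetric] H.m_assoc)
  then have "iota (h \<star> T (v \<cdot> S i)) = iota (h \<star> T v \<star> T (S i))" by (simp only:)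
  also have "\<dots> = T (S i) \<star> (T (ext_inv v) \<star> iota h)" using S by (simp add: iota_mult_S S.IH)
  also have "\<dots> = T (S i) \<star> T (ext_inv v) \<star> iota h" using S SE by (simp add: H.m_assoc)
  also have "T (S i) \<star> T (ext_inv v) = T (ext_inv (v \<cdot> S i))"
    using S SE by (simp add: S_T_up E.inv_mult_group)
  finally show ?case .
qed

lemma iota_mult: "g \<in> HC \<Longrightarrow> h \<in> HC \<Longrightarrow> iota (g \<star> h) = iota h \<star> iota g"
proof -
  assume g: "g \<in> HC" and h: "h \<in> HC"
  from h show ?thesis
  proof (induction rule: hecke_induct)
    case (single a w)
    then show ?case using g by (simp add: iota_smul iota_mult_T)
  qed (simp_all add: mult_distrib g iota_add)
qed

lemma iota_bT: assumes w: "w \<in> EC" shows "iota (bT w) = bT (ext_inv w)"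
proof (rule bT_eqI[symmetric])
  have "iota (T (ext_inv w) \<star> bT w) = iota (bT w) \<star> T w" using w by (simp add: iota_mult)
  then show "iota (bT w) \<star> T (ext_inv (ext_inv w)) = T e1" using w by (simp add: bT_inv)
qed (use w in simp_all)

lemma bar_iota: "h \<in> HC \<Longrightarrow> bar (iota h) = iota (bar h)"
  by (induction rule: hecke_induct) (simp_all add: bar_add iota_add bar_smul iota_smul iota_bT)

subsection \<open>The Kazhdan-Lusztig element of the longest element\<close>

text \<open>The closed form of the Kazhdan-Lusztig element of \<open>w0\<close>, confirmed in
  \<open>KL_w0\<close>.\<close>

definition C0 :: "'y hecke_elt" where
  "C0 = (\<Sum>u\<in>FW. qhalf (int (len u) - int (len w0)) \<odot>\<^sub>A T u)"

lemma C0_HC [simp]: "C0 \<in> HC"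
  unfolding C0_def by (intro HC_sum HC_simps FW_carrier)

lemma lookup_C0: "u \<in> FW \<Longrightarrow> lk C0 u = qhalf (int (len u) - int (len w0))"
  by (simp add: C0_def lookup_sum lookup_T finite_FW if_distrib[of "(*) _"] cong: if_cong)

lemma C0_Sp: "C0 \<in> Sp FW"
  unfolding C0_def by (intro Sp_sum Sp_smul Sp_T FW_carrier)

text \<open>Pairing \<open>u\<close> with the longer \<open>u S i\<close> writes \<open>C0\<close>
  as a combination of elements q^(1/2) T_(u s_i) + T_u, each an eigenvector of right multiplication
  by \<open>T (S i)\<close> with eigenvalue q^(1/2).\<close>

lemma C0_mult_S:
  assumes i: "i \<in> I"
  shows "C0 \<star> T (S i) = qhalf 1 \<odot>\<^sub>A C0"
proof -
  note i0 = I_I0(1)[OF i]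
  note SE = S_carrier[OF i0]
  define P where "P = {u \<in> FW. 0 < ev u (sroot i)}"
  define c where "c u = qhalf (int (len u) - int (len w0))" for u
  have P: "u \<in> FW" "u \<in> EC" "0 < ev u (sroot i)" if "u \<in> P" for u
    using that FW_carrier by (auto simp: P_def)
  have FWS: "u \<cdot> S i \<in> FW" if "u \<in> FW" for u using that FW_mult FW_S[OF i] by blast
  have img: "FW - P = (\<lambda>u. u \<cdot> S i) ` P"
  proof (intro equalityI subsetI)
    fix u assume u: "u \<in> FW - P"
    then have uE: "u \<in> EC" using FW_carrier by blast
    have "ev u (sroot i) < 0" using u ev_sroot_neg[OF uE i0] by (simp add: P_def)
    then have "u \<cdot> S i \<in> P" using u FWS uE i0 by (simp add: P_def ev_mult_S)
    moreover have "u = u \<cdot> S i \<cdot> S i" using uE i0 by simp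
    ultimately show "u \<in> (\<lambda>u. u \<cdot> S i) ` P" by blast
  next
    fix u assume "u \<in> (\<lambda>u. u \<cdot> S i) ` P"
    then obtain v where v: "v \<in> P" "u = v \<cdot> S i" by blast
    then show "u \<in> FW - P" using P[OF v(1)] FWS i0 by (simp add: P_def ev_mult_S)
  qed
  have inj: "inj_on (\<lambda>u. u \<cdot> S i) P"
    by (rule inj_on_inverseI[of _ "\<lambda>u. u \<cdot> S i"]) (use P i0 in simp)
  have "C0 = (\<Sum>u\<in>FW - P. c u \<odot>\<^sub>A T u) + (\<Sum>u\<in>P. c u \<odot>\<^sub>A T u)"
    unfolding C0_def c_def by (rule sum.subset_diff) (auto simp: P_def finite_FW)
  also have "(\<Sum>u\<in>FW - P. c u \<odot>\<^sub>A T u) = (\<Sum>u\<in>P. c (u \<cdot> S i) \<odot>\<^sub>A T (u \<cdot> S i))"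
    unfolding img by (subst sum.reindex[OF inj]) simp
  also have "\<dots> + (\<Sum>u\<in>P. c u \<odot>\<^sub>A T u) = (\<Sum>u\<in>P. c u \<odot>\<^sub>A (qhalf 1 \<odot>\<^sub>A T (u \<cdot> S i) + T u))"
    unfolding sum.distrib[symmetric]
  proof (intro sum.cong refl)
    fix u assume u: "u \<in> P"
    have "c (u \<cdot> S i) = c u * qhalf 1" using len_S_up[OF P(2)[OF u] i0 P(3)[OF u]] by (simp add: c_def algebra_simps)
    then show "c (u \<cdot> S i) \<odot>\<^sub>A T (u \<cdot> S i) + c u \<odot>\<^sub>A T u = c u \<odot>\<^sub>A (qhalf 1 \<odot>\<^sub>A T (u \<cdot> S i) + T u)"
      by (simp add: smul_add)
  qed
  finally have C0: "C0 = (\<Sum>u\<in>P. c u \<odot>\<^sub>A (qhalf 1 \<odot>\<^sub>A T (u \<cdot> S i) + T u))" .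
  have "(qhalf 1 \<odot>\<^sub>A T (u \<cdot> S i) + T u) \<star> T (S i) = qhalf 1 \<odot>\<^sub>A (qhalf 1 \<odot>\<^sub>A T (u \<cdot> S i) + T u)"
    if u: "u \<in> P" for u
    using P[OF u] i0 SE
    by (simp add: mult_distrib T_S_up T_S_down ev_mult_S smul_add smul_diff_left smul_diff algebra_simps)
  then show ?thesis
    unfolding C0 using P SE by (simp add: mult_sum smul_sum) (simp add: mult.commute)
qed

lemma iota_C0: "iota C0 = C0"
proof -
  have "iota C0 = (\<Sum>u\<in>FW. qhalf (int (len u) - int (len w0)) \<odot>\<^sub>A T (ext_inv u))"
    by (simp add: C0_def iota_sum iota_smul)
  also have "\<dots> = C0" unfolding C0_def
    by (rule sum.reindex_bij_witness[of _ ext_inv ext_inv]) (auto simp: FW_inv FW_carrier)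
  finally show ?thesis .
qed

lemma lookup_mult_S:
  assumes "h \<in> HC" and u: "u \<in> EC" and i: "i \<in> I0" and up: "0 < ev u (sroot i)"
  shows "lk (h \<star> T (S i)) u = lk h (u \<cdot> S i)"
  using assms(1)
proof (induction rule: hecke_induct)
  case (single a w)
  have "lk (T w \<star> T (S i)) u = lk (T w) (u \<cdot> S i)"
  proof (cases "0 < ev w (sroot i)")
    case True
    have "u \<noteq> w \<cdot> S i" "u \<cdot> S i \<noteq> w"
      using up True single i u ev_mult_S[of w i] ev_mult_S[of u i] by force+
    then show ?thesis using True single i by (simp add: T_S_up lookup_T)
  next
    case False
    then have dn: "ev w (sroot i) < 0" using ev_sroot_neg single i by blast
    have "u \<noteq> w" using up dn by auto
    moreover have "u = w \<cdot> S i \<longleftrightarrow> u \<cdot> S i = w" using single u i by auto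
    ultimately show ?thesis using single i dn by (simp add: T_S_down lookup_T lookup_add)
  qed
  then show ?case using single i by (simp add: S_carrier)
qed (simp_all add: mult_distrib S_carrier i lookup_add)

text \<open>Barring the eigenvector equations of \<open>C0\<close> gives the same equations for
  \<open>bar C0\<close>. On elements supported in W_f they determine all coefficients from the one
  at \<open>w0\<close>, by descending induction on length, and that coefficient is 1 for
  both.\<close>

lemma bar_C0: "bar C0 = C0"
proof -
  define G where "G = bar C0"
  have GHC: "G \<in> HC" by (simp add: G_def)
  have keysFW: "v \<in> FW \<Longrightarrow> v \<cdot> S i \<in> FW" if "i \<in> I" for v i using that FW_mult FW_S by blast
  have bTFW: "bT u \<in> Sp FW" if "u \<in> FW" for u
    using that
  proof (induction "len u" arbitrary: u rule: less_induct)
    case less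
    show ?case
    proof (cases "u = e1")
      case True
      then show ?thesis by (simp add: Sp_T)
    next
      case False
      then obtain i where i: "i \<in> I" "ev u (sroot i) < 0" using FW_down less.prems by blast
      note i0 = I_I0(1)[OF i(1)] and uE = FW_carrier[OF less.prems]
      have "len (u \<cdot> S i) < len u" using len_S_down[OF uE i0 i(2)] by simp
      then have b: "bT (u \<cdot> S i) \<in> Sp FW" using less.hyps keysFW[OF i(1) less.prems] by blast
      have "bT u = bT (u \<cdot> S i) \<star> bT (S i)"
        using bT_S_up[of "u \<cdot> S i" i] uE i0 i(2) by (simp add: ev_mult_S S_carrier)
      also have "\<dots> = bT (u \<cdot> S i) \<star> T (S i) - xi \<odot>\<^sub>A bT (u \<cdot> S i)"
        using uE i0 by (simp add: bT_S mult_distrib S_carrier)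
      also have "\<dots> \<in> Sp FW"
        using b keysFW[OF i(1)] by (intro Sp_diff Sp_smul Sp_mult_S[OF b i0]) blast+
      finally show ?thesis .
    qed
  qed
  have GS: "G \<star> T (S i) = qhalf 1 \<odot>\<^sub>A G" if i: "i \<in> I" for i
  proof -
    note i0 = I_I0(1)[OF i]
    have "bar (C0 \<star> T (S i)) = G \<star> bT (S i)" using i0 by (simp add: bar_mult S_carrier G_def)
    then have "G \<star> T (S i) - xi \<odot>\<^sub>A G = qhalf (- 1) \<odot>\<^sub>A G"
      using i i0 GHC by (simp add: C0_mult_S bar_smul bT_S mult_distrib S_carrier G_def[symmetric])
    then show ?thesis by (simp add: smul_diff_left algebra_simps)
  qed
  have G_eq: "G = (\<Sum>u\<in>FW. qhalf (int (len w0) - int (len u)) \<odot>\<^sub>A bT u)"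
    by (simp add: G_def C0_def bar_sum bar_smul)
  have GSp: "G \<in> Sp FW" unfolding G_eq by (intro Sp_sum Sp_smul bTFW)
  have top: "lk G w0 = 1"
  proof -
    have "lk G w0 = (\<Sum>u\<in>FW. if u = w0 then 1 else 0)"
      unfolding G_eq lookup_sum by (intro sum.cong refl) (auto simp: lookup_bT FW_carrier w0_props)
    then show ?thesis using w0_props finite_FW by simp
  qed
  have "lk G u = lk C0 u" if "u \<in> FW" for u
    using that
  proof (induction "len w0 - len u" arbitrary: u rule: less_induct)
    case less
    note uE = FW_carrier[OF less.prems]
    show ?case
    proof (cases "u = w0")
      case True
      then show ?thesis using top w0_props by (simp add: lookup_C0)
    next
      case False
      then obtain i where i: "i \<in> I" "0 < ev u (sroot i)" using FW_up less.prems by blast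
      note i0 = I_I0(1)[OF i(1)]
      have uS: "u \<cdot> S i \<in> FW" using keysFW i(1) less.prems by blast
      have l: "len (u \<cdot> S i) = Suc (len u)" using len_S_up[OF uE i0 i(2)] .
      then have IH: "lk G (u \<cdot> S i) = lk C0 (u \<cdot> S i)"
        using less.hyps[OF _ uS] w0_props(2)[OF uS] by simp
      have "qhalf 1 * lk G u = lk G (u \<cdot> S i)"
        using lookup_mult_S[OF GHC uE i0 i(2)] GS[OF i(1)] by simp
      moreover have "qhalf 1 * lk C0 u = lk C0 (u \<cdot> S i)"
        using lookup_mult_S[OF C0_HC uE i0 i(2)] C0_mult_S[OF i(1)] by simp
      ultimately have "qhalf (- 1) * (qhalf 1 * lk G u) = qhalf (- 1) * (qhalf 1 * lk C0 u)" using IH by simp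
      then show ?thesis by (simp flip: mult.assoc)
    qed
  qed
  then have "lk G u = lk C0 u" for u
    using Sp_lookup[OF GSp] Sp_lookup[OF C0_Sp] by metis
  then show ?thesis unfolding G_def by (rule poly_mapping_eqI)
qed

subsection \<open>The parabolic Kazhdan-Lusztig basis\<close>

lemma T_mult_C0:
  assumes "x \<in> Mr"
  shows "T x \<star> C0 = (\<Sum>u\<in>FW. qhalf (int (len u) - int (len w0)) \<odot>\<^sub>A T (x \<cdot> u))"
  unfolding C0_def using assms Mr_len(1) Mr_carrier FW_carrier by (simp add: mult_sum T_mult)

lemma lookup_T_mult_C0:
  assumes "x \<in> Mr" "y \<in> Mr"
  shows "lk (T x \<star> C0) (y \<cdot> w0) = (if x = y then 1 else 0)"
proof -
  have "x \<cdot> u = y \<cdot> w0 \<longleftrightarrow> u = w0 \<and> x = y" if "u \<in> FW" for u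
    using Mr_unique[OF assms that w0_props(1)] by blast
  then have "lk (T (x \<cdot> u)) (y \<cdot> w0) = (if u = w0 then (if x = y then 1 else 0) else 0)" if "u \<in> FW" for u
    using that by (simp add: lookup_T eq_commute[of "y \<cdot> w0"])
  then have "lk (T x \<star> C0) (y \<cdot> w0) = (\<Sum>u\<in>FW. if u = w0 then (if x = y then 1 else 0) else 0)"
    unfolding T_mult_C0[OF assms(1)] lookup_sum by (intro sum.cong refl) simp
  then show ?thesis using w0_props finite_FW by simp
qed

text \<open>Among the products \<open>x u\<close> with \<open>x\<close> in \<open>Mr\<close> and
  \<open>u\<close> in W_f, \<open>y w0\<close> arises only from \<open>y\<close> and
  \<open>w0\<close>, with coefficient 1. So \<open>h\<close> can be recovered from
  \<open>h \<star> C0\<close>.\<close>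

lemma lookup_mult_C0:
  assumes h: "h \<in> Sp Mr" and y: "y \<in> Mr"
  shows "lk (h \<star> C0) (y \<cdot> w0) = lk h y"
proof -
  have k: "x \<in> Mr" "x \<in> EC" if "x \<in> ks h" for x
    using h that Mr_carrier unfolding Sp_def by blast+
  have "h \<star> C0 = (\<Sum>x\<in>ks h. lk h x \<odot>\<^sub>A (T x \<star> C0))"
    by (subst Sp_expansion[OF h]) (simp add: mult_sum k)
  then have "lk (h \<star> C0) (y \<cdot> w0) = (\<Sum>x\<in>ks h. if x = y then lk h y else 0)"
    using k y by (simp add: lookup_sum lookup_T_mult_C0 if_distrib[of "(*) _"] cong: if_cong)
  then show ?thesis by (auto simp: in_keys_iff)
qed

abbreviation belowM :: "'y weyl_elt \<Rightarrow> 'y weyl_elt set" where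
  "belowM x \<equiv> {y \<in> Mr. y \<preceq> x \<and> y \<noteq> x}"

text \<open>A descent of \<open>y\<close> in W_f can be moved across to \<open>C0\<close>, which
  absorbs it as the scalar q^(1/2); repeating this ends at a minimal coset representative.\<close>

lemma T_mult_C0_reduce:
  assumes "y \<in> EC"
  shows "\<exists>h\<in>Sp {z \<in> Mr. z \<preceq> y}. T y \<star> C0 = h \<star> C0"
  using assms
proof (induction "len y" arbitrary: y rule: less_induct)
  case less
  show ?case
  proof (cases "y \<in> Mr")
    case True
    then show ?thesis using less.prems le_refl[OF less.prems] by (intro bexI[of _ "T y"] Sp_T) simp_all
  next
    case False
    then obtain i where i: "i \<in> I" "\<not> 0 < ev y (sroot i)" using less.prems by (auto simp: Mr_def)
    note i0 = I_I0(1)[OF i(1)]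
    have dn: "ev y (sroot i) < 0" using i ev_sroot_neg less.prems i0 by blast
    have SE: "y \<cdot> S i \<in> EC" "S i \<in> EC" using less.prems i0 by (simp_all add: S_carrier)
    obtain h where h: "h \<in> Sp {z \<in> Mr. z \<preceq> y \<cdot> S i}" "T (y \<cdot> S i) \<star> C0 = h \<star> C0"
      using less.hyps[OF _ SE(1)] len_S_down[OF less.prems i0 dn] by auto
    have SC: "T (S i) \<star> C0 = qhalf 1 \<odot>\<^sub>A C0"
      using iota_mult[of C0 "T (S i)"] C0_mult_S[OF i(1)] SE i0 by (simp add: iota_C0 iota_smul)
    have "T y = T (y \<cdot> S i) \<star> T (S i)"
      using T_S_up[of "y \<cdot> S i" i] less.prems i0 dn SE by (simp add: ev_mult_S)
    then have "T y \<star> C0 = T (y \<cdot> S i) \<star> (T (S i) \<star> C0)"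
      using SE by (simp add: H.m_assoc)
    also have "\<dots> = (qhalf 1 \<odot>\<^sub>A h) \<star> C0" using SC SE h Sp_HC by simp
    finally have "T y \<star> C0 = (qhalf 1 \<odot>\<^sub>A h) \<star> C0" .
    moreover have "{z \<in> Mr. z \<preceq> y \<cdot> S i} \<subseteq> {z \<in> Mr. z \<preceq> y}"
      using le_S_down[OF less.prems i0 dn] le_trans by blast
    then have "qhalf 1 \<odot>\<^sub>A h \<in> Sp {z \<in> Mr. z \<preceq> y}" using h(1) Sp_mono by (intro Sp_smul) blast
    ultimately show ?thesis by blast
  qed
qed

text \<open>As \<open>C0\<close> is fixed by the bar involution, only \<open>T x\<close> gets
  barred; the lower terms are then brought into \<open>Mr\<close> without leaving the interval below
  \<open>x\<close>.\<close>

lemma bar_T_mult_C0: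
  assumes x: "x \<in> Mr"
  shows "\<exists>h\<in>Sp (belowM x). bar (T x \<star> C0) = (T x + h) \<star> C0"
proof -
  note xE = Mr_carrier[OF x]
  define g where "g = bT x - T x"
  have g: "g \<in> Sp (below x)" using bT_triangular[OF xE] by (simp add: g_def)
  have k: "y \<in> EC" "y \<preceq> x" "y \<noteq> x" if "y \<in> ks g" for y
    using g that by (auto simp: Sp_def le_def)
  have "\<exists>f. \<forall>y\<in>ks g. f y \<in> Sp {z \<in> Mr. z \<preceq> y} \<and> T y \<star> C0 = f y \<star> C0"
    using T_mult_C0_reduce k(1) by (intro bchoice) blast
  then obtain f where f: "\<And>y. y \<in> ks g \<Longrightarrow> f y \<in> Sp {z \<in> Mr. z \<preceq> y}" "\<And>y. y \<in> ks g \<Longrightarrow> T y \<star> C0 = f y \<star> C0"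
    by blast
  have fHC: "f y \<in> HC" if "y \<in> ks g" for y using f(1)[OF that] by (rule Sp_HC)
  define h where "h = (\<Sum>y\<in>ks g. lk g y \<odot>\<^sub>A f y)"
  have "h \<in> Sp (belowM x)" unfolding h_def
  proof (intro Sp_sum Sp_smul)
    fix y assume y: "y \<in> ks g"
    have "len y < len x" using k[OF y] le_len by blast
    then have "{z \<in> Mr. z \<preceq> y} \<subseteq> belowM x"
      using k[OF y] le_trans le_len by fastforce
    then show "f y \<in> Sp (belowM x)" using f(1)[OF y] Sp_mono by blast
  qed
  moreover have "bar (T x \<star> C0) = (T x + h) \<star> C0"
  proof -
    have gC: "g \<star> C0 = h \<star> C0"
      unfolding h_def using fHC k(1) f(2) by (subst Sp_expansion[OF g]) (simp add: mult_sum)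
    have "bar (T x \<star> C0) = bT x \<star> C0" using xE by (simp add: bar_mult bar_C0)
    also have "bT x = T x + g" by (simp add: g_def)
    finally show ?thesis using xE gC g \<open>h \<in> Sp (belowM x)\<close> by (simp add: mult_distrib Sp_HC)
  qed
  ultimately show ?thesis by blast
qed

text \<open>Lusztig's lemma, by induction on a finite lower set of minimal coset representatives:
  the top coefficient of a bar-antiinvariant element is antiinvariant, hence of the form
  \<open>b - bar b\<close> with \<open>b\<close> of negative degree.\<close>

lemma antiinvariant_split:
  assumes "finite X" "X \<subseteq> Mr" "\<And>x y. x \<in> X \<Longrightarrow> y \<in> Mr \<Longrightarrow> y \<preceq> x \<Longrightarrow> y \<in> X"
    and "g \<in> Sp X" "bar (g \<star> C0) = - (g \<star> C0)"
  shows "\<exists>f\<in>Sp X \<inter> Ldeg (- 1). f \<star> C0 - bar (f \<star> C0) = g \<star> C0"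
  using assms
proof (induction "card X" arbitrary: X g rule: less_induct)
  case less
  show ?case
  proof (cases "X = {}")
    case True
    then have "g = 0" using less.prems(4) by (simp add: Sp_def)
    then show ?thesis by (intro bexI[of _ 0]) simp_all
  next
    case False
    then obtain y where y: "y \<in> X" "\<And>x. x \<in> X \<Longrightarrow> int (len x) \<le> int (len y)"
      using finite_maximizer[OF less.prems(1) False, of "\<lambda>x. int (len x)"] by blast
    have yM: "y \<in> Mr" using y less.prems(2) by blast
    note yE = Mr_carrier[OF yM] and gHC = Sp_HC[OF less.prems(4)]
    have gM: "g \<in> Sp Mr" using less.prems(2,4) by (rule Sp_mono[rotated])
    define r where "r = lk g y"
    have k: "x \<in> X" "x \<in> Mr" "x \<in> EC" if "x \<in> ks g" for x
      using less.prems(2,4) that Mr_carrier unfolding Sp_def by blast+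
    have "\<exists>b. \<forall>x\<in>Mr. b x \<in> Sp (belowM x) \<and> bar (T x \<star> C0) = (T x + b x) \<star> C0"
      using bar_T_mult_C0 by (intro bchoice) blast
    then obtain b where b: "\<And>x. x \<in> Mr \<Longrightarrow> b x \<in> Sp (belowM x)"
      "\<And>x. x \<in> Mr \<Longrightarrow> bar (T x \<star> C0) = (T x + b x) \<star> C0" by blast
    have bHC: "b x \<in> HC" if "x \<in> Mr" for x using b(1)[OF that] by (rule Sp_HC)
    have "lbar r = - r"
    proof -
      \<comment> \<open>\<open>g'\<close> represents the barred product:
        \<open>bar (g \<star> C0) = g' \<star> C0\<close>. Since \<open>y\<close> has maximal length
        in \<open>X\<close>, the corrections \<open>b x\<close> contribute nothing at
        \<open>y\<close>.\<close>
      define g' where "g' = (\<Sum>x\<in>ks g. lbar (lk g x) \<odot>\<^sub>A (T x + b x))"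
      have "g \<star> C0 = (\<Sum>x\<in>ks g. lk g x \<odot>\<^sub>A (T x \<star> C0))"
        by (subst Sp_expansion[OF gM]) (simp add: mult_sum k)
      then have "bar (g \<star> C0) = g' \<star> C0"
        unfolding g'_def using k bHC by (simp add: bar_sum bar_smul b(2) mult_sum)
      moreover have g'M: "g' \<in> Sp Mr" unfolding g'_def
      proof (intro Sp_sum Sp_smul Sp_add)
        fix x assume x: "x \<in> ks g"
        show "T x \<in> Sp Mr" using k[OF x] by (intro Sp_T)
        show "b x \<in> Sp Mr" using b(1)[OF k(2)[OF x]] by (rule Sp_mono) blast
      qed
      ultimately have "lk g' y = - lk g y"
        using lookup_mult_C0[OF g'M yM] lookup_mult_C0[OF gM yM] less.prems(5) by (metis lookup_uminus)
      moreover have "lk g' y = (\<Sum>x\<in>ks g. if x = y then lbar r else 0)"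
        unfolding g'_def lookup_sum
      proof (intro sum.cong refl)
        fix x assume x: "x \<in> ks g"
        have "y \<notin> belowM x" using y(2)[OF k(1)[OF x]] le_len[of y x] by auto
        then have "lk (b x) y = 0" using b(1)[OF k(2)[OF x]] Sp_lookup by blast
        then show "lk (lbar (lk g x) \<odot>\<^sub>A (T x + b x)) y = (if x = y then lbar r else 0)"
          by (simp add: lookup_add lookup_T r_def)
      qed
      ultimately show ?thesis by (cases "lk g y = 0") (simp_all add: r_def in_keys_iff)
    qed
    then obtain c where c: "ldeg (- 1) c" "c - lbar c = r" by (rule laurent_split)
    \<comment> \<open>Subtracting \<open>F\<close> and adding its bar keeps the element
      antiinvariant and cancels the coefficient at \<open>y\<close>, because
      \<open>c - lbar c = r\<close>.\<close>
    define g' where "g' = g - c \<odot>\<^sub>A T y + lbar c \<odot>\<^sub>A (T y + b y)"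
    have below_X: "belowM y \<subseteq> X - {y}" using less.prems(3) y by blast
    have "g' \<in> Sp X"
      unfolding g'_def using less.prems(4) y(1) yE b(1)[OF yM] below_X
      by (intro Sp_add Sp_diff Sp_smul Sp_T) (auto elim: Sp_mono)
    moreover have "lk g' y = 0"
    proof -
      have "lk (b y) y = 0" using b(1)[OF yM] Sp_lookup by blast
      moreover have "lk g y = c - lbar c" using c(2) by (simp add: r_def)
      ultimately show ?thesis by (simp add: g'_def lookup_add lookup_minus lookup_T)
    qed
    ultimately have g'X: "g' \<in> Sp (X - {y})"
      using Sp_lookup[of g' X] Sp_HC[of g' X] by (intro Sp_I) auto
    define F where "F = (c \<odot>\<^sub>A T y) \<star> C0"
    have FHC: "F \<in> HC" using yE by (simp add: F_def)
    have barF: "bar F = (lbar c \<odot>\<^sub>A (T y + b y)) \<star> C0"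
      unfolding F_def using yE bHC[OF yM] b(2)[OF yM] by (simp add: bar_smul)
    have "g' \<star> C0 = g \<star> C0 - (c \<odot>\<^sub>A T y) \<star> C0 + (lbar c \<odot>\<^sub>A (T y + b y)) \<star> C0"
      unfolding g'_def using gHC yE bHC[OF yM] by (simp add: mult_distrib)
    then have g'C: "g' \<star> C0 = g \<star> C0 - F + bar F" by (simp only: barF) (simp only: F_def)
    have anti: "bar (g' \<star> C0) = - (g' \<star> C0)"
      unfolding g'C using less.prems(5) FHC by (simp add: bar_add bar_diff bar_bar)
    have "card (X - {y}) < card X" using less.prems(1) y(1) by (rule card_Diff1_less)
    moreover have "x \<in> X - {y} \<Longrightarrow> z \<in> Mr \<Longrightarrow> z \<preceq> x \<Longrightarrow> z \<in> X - {y}" for x z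
      using less.prems(3)[of x z] y(2)[of x] le_len[of z x] by auto
    ultimately obtain f where f: "f \<in> Sp (X - {y}) \<inter> Ldeg (- 1)" "f \<star> C0 - bar (f \<star> C0) = g' \<star> C0"
      using less.hyps[of "X - {y}" g'] less.prems(1,2) g'X anti by blast
    have fHC: "f \<in> HC" using f Sp_HC by blast
    have "f + c \<odot>\<^sub>A T y \<in> Sp X"
      using f y yE by (intro Sp_add Sp_smul Sp_T) (auto elim: Sp_mono)
    moreover have "f + c \<odot>\<^sub>A T y \<in> Ldeg (- 1)"
      using f Ldeg_smul[OF c(1) Ldeg_T[OF yE]] by (simp add: Ldeg_add)
    moreover have "(f + c \<odot>\<^sub>A T y) \<star> C0 - bar ((f + c \<odot>\<^sub>A T y) \<star> C0) = g \<star> C0"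
    proof -
      have eq: "(f + c \<odot>\<^sub>A T y) \<star> C0 = f \<star> C0 + F"
        using fHC yE by (simp add: mult_distrib F_def)
      show ?thesis unfolding eq bar_add using f(2) g'C by (simp add: algebra_simps)
    qed
    ultimately show ?thesis by blast
  qed
qed

text \<open>\<open>g\<close> measures the failure of \<open>T v \<star> C0\<close> to be
  bar-invariant; because the bar involution squares to the identity, \<open>g \<star> C0\<close> is
  antiinvariant, and the splitting supplies a correction in negative degree.\<close>

lemma parabolic_KL_exists:
  assumes v: "v \<in> Mr"
  shows "\<exists>p. p - T v \<in> Sp (belowM v) \<inter> Ldeg (- 1) \<and> bar (p \<star> C0) = p \<star> C0"
proof -
  note vE = Mr_carrier[OF v]
  obtain g where g: "g \<in> Sp (belowM v)" "bar (T v \<star> C0) = (T v + g) \<star> C0"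
    using bar_T_mult_C0[OF v] by blast
  have gC: "g \<star> C0 = bar (T v \<star> C0) - T v \<star> C0"
    using g vE Sp_HC[OF g(1)] by (simp add: mult_distrib)
  have anti: "bar (g \<star> C0) = - (g \<star> C0)"
    unfolding gC using vE by (simp add: bar_diff bar_bar)
  have "belowM v \<subseteq> {x \<in> carrier E. len x \<le> len v}"
    using Mr_carrier le_len by fastforce
  then have fin: "finite (belowM v)" using finite_len_le finite_subset by blast
  have "x \<in> belowM v \<Longrightarrow> y \<in> Mr \<Longrightarrow> y \<preceq> x \<Longrightarrow> y \<in> belowM v" for x y
    using le_trans[of y x v] le_len[of y x] le_len[of x v] by auto
  then obtain f where f: "f \<in> Sp (belowM v) \<inter> Ldeg (- 1)" "f \<star> C0 - bar (f \<star> C0) = g \<star> C0"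
    using antiinvariant_split[OF fin _ _ g(1) anti] by blast
  have "bar ((T v + f) \<star> C0) = (T v + f) \<star> C0"
  proof -
    have "f \<in> HC" using f Sp_HC by blast
    then have "(T v + f) \<star> C0 = T v \<star> C0 + f \<star> C0" using vE by (simp add: mult_distrib)
    moreover have "bar (T v \<star> C0) = g \<star> C0 + T v \<star> C0" using gC by simp
    moreover have "bar (f \<star> C0) = f \<star> C0 - g \<star> C0" using f(2) by (simp add: algebra_simps)
    ultimately show ?thesis by (simp only: bar_add) simp
  qed
  then show ?thesis using f by (intro exI[of _ "T v + f"]) simp
qed

text \<open>A parabolic Kazhdan-Lusztig element in the left ideal of \<open>C0\<close>;
  \<open>KL_left_eq\<close> identifies it with \<open>KL_left D H v\<close>.\<close>

definition parKL :: "'y weyl_elt \<Rightarrow> 'y hecke_elt" where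
  "parKL v = (SOME p. p - T v \<in> Sp (belowM v) \<inter> Ldeg (- 1) \<and> bar (p \<star> C0) = p \<star> C0)"

lemma parKL:
  assumes "v \<in> Mr"
  shows "parKL v - T v \<in> Sp (belowM v)" "parKL v - T v \<in> Ldeg (- 1)" "bar (parKL v \<star> C0) = parKL v \<star> C0"
  using someI_ex[OF parabolic_KL_exists[OF assms], folded parKL_def] by blast+

lemma parKL_Sp: assumes v: "v \<in> Mr" shows "parKL v \<in> Sp {x \<in> Mr. x \<preceq> v}"
proof -
  have "T v \<in> Sp {x \<in> Mr. x \<preceq> v}" using v Mr_carrier[OF v] le_refl by (intro Sp_T) auto
  moreover have "parKL v - T v \<in> Sp {x \<in> Mr. x \<preceq> v}" using parKL(1)[OF v] by (rule Sp_mono) blast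
  ultimately have "T v + (parKL v - T v) \<in> Sp {x \<in> Mr. x \<preceq> v}" by (rule Sp_add)
  then show ?thesis by simp
qed

lemma parKL_HC [simp]: "v \<in> Mr \<Longrightarrow> parKL v \<in> HC"
  using parKL_Sp Sp_HC by blast

section \<open>Parabolic elements and the one-sided factors of the theorem\<close>

lemma T_mult_C0_Ldeg:
  assumes x: "x \<in> Mr"
  shows "T x \<star> C0 \<in> Ldeg 0" "T x \<star> C0 - T (x \<cdot> w0) \<in> Ldeg (- 1)"
proof -
  define c where "c u = qhalf (int (len u) - int (len w0))" for u
  have xu: "T (x \<cdot> u) \<in> Ldeg 0" if "u \<in> FW" for u
    using that x Mr_carrier FW_carrier by (intro Ldeg_T) blast
  have eq: "T x \<star> C0 = T (x \<cdot> w0) + (\<Sum>u\<in>FW - {w0}. c u \<odot>\<^sub>A T (x \<cdot> u))"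
    unfolding T_mult_C0[OF x] c_def by (subst sum.remove[OF finite_FW w0_props(1)]) simp
  have less: "len u < len w0" if "u \<in> FW - {w0}" for u
  proof -
    have u: "u \<in> FW" "u \<noteq> w0" using that by auto
    obtain i where i: "i \<in> I" "0 < ev u (sroot i)" using FW_up[OF u] by blast
    have "Suc (len u) = len (u \<cdot> S i)" using len_S_up[OF FW_carrier[OF u(1)] I_I0(1)[OF i(1)] i(2)] by simp
    also have "\<dots> \<le> len w0" using u i FW_mult FW_S w0_props by blast
    finally show ?thesis by simp
  qed
  have "(\<Sum>u\<in>FW - {w0}. c u \<odot>\<^sub>A T (x \<cdot> u)) \<in> Ldeg (- 1)"
  proof (rule Ldeg_sum)
    fix u assume u: "u \<in> FW - {w0}"
    have "ldeg (- 1) (c u)" using less[OF u] by (simp add: c_def)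
    then show "c u \<odot>\<^sub>A T (x \<cdot> u) \<in> Ldeg (- 1)" using Ldeg_smul[OF _ xu[of u], of "- 1" "c u"] u by simp
  qed
  with eq show "T x \<star> C0 - T (x \<cdot> w0) \<in> Ldeg (- 1)" by simp
  then show "T x \<star> C0 \<in> Ldeg 0"
    using Ldeg_add[OF xu[OF w0_props(1)] Ldeg_mono[of "T x \<star> C0 - T (x \<cdot> w0)" "- 1" 0]] by simp
qed

lemma parKL_mult_C0_Ldeg:
  assumes v: "v \<in> Mr"
  shows "parKL v \<star> C0 - T (v \<cdot> w0) \<in> Ldeg (- 1)"
proof -
  define g where "g = parKL v - T v"
  have g: "g \<in> Sp (belowM v)" "g \<in> Ldeg (- 1)" using parKL[OF v] by (simp_all add: g_def)
  note vE = Mr_carrier[OF v]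
  have k: "x \<in> Mr" "x \<in> EC" if "x \<in> ks g" for x
    using g(1) that Mr_carrier unfolding Sp_def by blast+
  have "g \<star> C0 = (\<Sum>x\<in>ks g. lk g x \<odot>\<^sub>A (T x \<star> C0))"
    by (subst Sp_expansion[OF g(1)]) (simp add: mult_sum k)
  also have "\<dots> \<in> Ldeg (- 1)"
  proof (rule Ldeg_sum)
    fix x assume x: "x \<in> ks g"
    show "lk g x \<odot>\<^sub>A (T x \<star> C0) \<in> Ldeg (- 1)"
      using Ldeg_smul[OF Ldeg_lookup[OF g(2)] T_mult_C0_Ldeg(1)[OF k(1)[OF x]]] by simp
  qed
  finally have "g \<star> C0 + (T v \<star> C0 - T (v \<cdot> w0)) \<in> Ldeg (- 1)"
    using T_mult_C0_Ldeg(2)[OF v] by (rule Ldeg_add)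
  moreover have "parKL v \<star> C0 = g \<star> C0 + T v \<star> C0"
    using v vE by (simp add: g_def mult_distrib)
  ultimately show ?thesis by (simp add: algebra_simps)
qed

lemma KL_parabolic: "v \<in> Mr \<Longrightarrow> KL D H (v \<cdot> w0) = parKL v \<star> C0"
  by (rule KL_eqI) (simp_all add: parKL parKL_mult_C0_Ldeg)

lemma one_Mr: "e1 \<in> Mr"
  by (simp add: Mr_def ht_sroot I_I0)

lemma KL_w0: "KL D H w0 = C0"
proof (rule KL_eqI)
  show "C0 - T w0 \<in> Ldeg (- 1)" using T_mult_C0_Ldeg(2)[OF one_Mr] by simp
qed (simp_all add: bar_C0)

lemma KL_parabolic_right:
  assumes v: "v \<in> EC" "ext_inv v \<in> Mr"
  shows "KL D H (w0 \<cdot> v) = iota (parKL (ext_inv v) \<star> C0)"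
proof (rule KL_eqI)
  let ?p = "parKL (ext_inv v)"
  show "bar (iota (?p \<star> C0)) = iota (?p \<star> C0)"
    using v(2) by (simp add: bar_iota parKL(3))
  have "iota (?p \<star> C0) - T (w0 \<cdot> v) = iota (?p \<star> C0 - T (ext_inv v \<cdot> w0))"
    using v by (simp add: iota_diff E.inv_mult_group)
  then show "iota (?p \<star> C0) - T (w0 \<cdot> v) \<in> Ldeg (- 1)"
    using parKL_mult_C0_Ldeg[OF v(2)] iota_Ldeg by simp
qed (use v in simp)

lemma finite_bruhat_interval: "finite {x. bruhat_le D x v \<and> P x}"
  by (rule finite_subset[OF _ finite_len_le[of "len v"]]) (use bruhat_le_len in blast)

text \<open>The coefficient of the ordinary element for \<open>v w0\<close> at \<open>x w0\<close>
  is the coefficient of \<open>parKL v\<close> at \<open>x\<close>, by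
  \<open>lookup_mult_C0\<close>. Its support lies in the index set of \<open>KL_left\<close> by
  \<open>le_bruhat\<close>, and that set is finite.\<close>

lemma KL_left_eq: assumes v: "v \<in> Mr" shows "KL_left D H v = parKL v"
proof -
  let ?X = "{x. bruhat_le D x v \<and> reduced_product D x w0}"
  have X: "x \<in> Mr" if "x \<in> ?X" for x using that bruhat_le_len(1) reduced_w0_iff by blast
  have pM: "parKL v \<in> Sp Mr" using parKL_Sp[OF v] by (rule Sp_mono) blast
  have "ks (parKL v) \<subseteq> ?X"
  proof
    fix x assume "x \<in> ks (parKL v)"
    then have "x \<in> Mr" "x \<preceq> v" using parKL_Sp[OF v] unfolding Sp_def by blast+
    then show "x \<in> ?X" using le_bruhat reduced_w0_iff Mr_carrier by blast
  qed
  then have "parKL v = (\<Sum>x\<in>?X. lk (parKL v) x \<odot>\<^sub>A T x)"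
    by (intro hecke_expansion finite_bruhat_interval)
  also have "\<dots> = KL_left D H v"
    unfolding KL_left_def Let_def KL_coeff_def KL_parabolic[OF v]
    using X lookup_mult_C0[OF pM] by (intro sum.cong) auto
  finally show ?thesis by simp
qed

lemma KL_right_eq:
  assumes v: "v \<in> EC" "ext_inv v \<in> Mr"
  shows "KL_right D H v = iota (parKL (ext_inv v))"
proof -
  let ?X = "{x. bruhat_le D x v \<and> reduced_product D w0 x}" and ?p = "parKL (ext_inv v)"
  have X: "x \<in> EC" "ext_inv x \<in> Mr" if "x \<in> ?X" for x
    using that bruhat_le_len(1) reduced_w0_left_iff by blast+
  have pM: "?p \<in> Sp Mr" using parKL_Sp[OF v(2)] by (rule Sp_mono) blast
  have ipHC: "iota ?p \<in> HC" using v by simp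
  have "ks (iota ?p) \<subseteq> ?X"
  proof
    fix x assume x: "x \<in> ks (iota ?p)"
    have xE: "x \<in> EC" using x ipHC by (auto simp: HC_iff)
    have "ext_inv x \<in> ks ?p" using x xE v by (simp add: in_keys_iff lookup_iota)
    then have "ext_inv x \<in> Mr" "ext_inv x \<preceq> ext_inv v" using parKL_Sp[OF v(2)] by (auto simp: Sp_def)
    then show "x \<in> ?X" using le_inv[of "ext_inv x" "ext_inv v"] le_bruhat reduced_w0_left_iff xE v by simp
  qed
  then have "iota ?p = (\<Sum>x\<in>?X. lk (iota ?p) x \<odot>\<^sub>A T x)"
    by (intro hecke_expansion finite_bruhat_interval)
  also have "\<dots> = KL_right D H v"
    unfolding KL_right_def Let_def KL_coeff_def KL_parabolic_right[OF v]
  proof (intro sum.cong refl)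
    fix x assume x: "x \<in> ?X"
    have "lk (iota (?p \<star> C0)) (w0 \<cdot> x) = lk (?p \<star> C0) (ext_inv x \<cdot> w0)"
      using X[OF x] v by (simp add: lookup_iota E.inv_mult_group)
    also have "\<dots> = lk (iota ?p) x"
      using X[OF x] v lookup_mult_C0[OF pM] by (simp add: lookup_iota)
    finally show "lk (iota ?p) x \<odot>\<^sub>A T x = lk (iota (?p \<star> C0)) (w0 \<cdot> x) \<odot>\<^sub>A T x" by simp
  qed
  finally show ?thesis by simp
qed

subsection \<open>The factorization\<close>

lemma T_C0_T:
  assumes x: "x \<in> Mr" and z: "z \<in> EC" "ext_inv z \<in> Mr"
  shows "T x \<star> C0 \<star> T z = (\<Sum>u\<in>FW. qhalf (int (len u) - int (len w0)) \<odot>\<^sub>A (T x \<star> T (u \<cdot> z)))"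
proof -
  note xE = Mr_carrier[OF x]
  have "T u \<star> T z = T (u \<cdot> z)" if u: "u \<in> FW" for u
  proof (rule T_mult)
    show "N u \<inter> N (ext_inv z) = {}"
      using N_FW[OF u] Mr_Rp[OF z(2)] N_D(3)[of _ "ext_inv z"] by force
  qed (use u z FW_carrier in auto)
  then have "C0 \<star> T z = (\<Sum>u\<in>FW. qhalf (int (len u) - int (len w0)) \<odot>\<^sub>A T (u \<cdot> z))"
    using z FW_carrier by (simp add: C0_def mult_sum)
  then show ?thesis using xE z FW_carrier by (simp add: H.m_assoc mult_sum)
qed

lemma T_C0_T_Ldeg:
  assumes x: "x \<in> Mr" and z: "z \<in> EC" "ext_inv z \<in> Mr"
  shows "T x \<star> C0 \<star> T z \<in> Ldeg 0"
  unfolding T_C0_T[OF assms]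
proof (rule Ldeg_sum)
  fix u assume u: "u \<in> FW"
  have "T x \<star> T (u \<cdot> z) \<in> Ldeg (int (card (Fdir x (u \<cdot> z))))"
    using T_mult_degree Mr_carrier[OF x] z FW_carrier[OF u] by blast
  then have "T x \<star> T (u \<cdot> z) \<in> Ldeg (int (len w0) - int (len u))"
    by (rule Ldeg_mono) (use card_Fdir_le[OF x z u] in simp)
  from Ldeg_smul[OF _ this, of "int (len u) - int (len w0)" "qhalf (int (len u) - int (len w0))"]
  show "qhalf (int (len u) - int (len w0)) \<odot>\<^sub>A (T x \<star> T (u \<cdot> z)) \<in> Ldeg 0" by simp
qed

lemma T_C0_T_primitive:
  assumes v: "v \<in> Mr" "primitive_elt D v" and z: "z \<in> EC" "ext_inv z \<in> Mr"
  shows "T v \<star> C0 \<star> T z - T (v \<cdot> w0 \<cdot> z) \<in> Ldeg (- 1)"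
proof -
  note vE = Mr_carrier[OF v(1)]
  let ?t = "\<lambda>u. qhalf (int (len u) - int (len w0)) \<odot>\<^sub>A (T v \<star> T (u \<cdot> z))"
  have "T v \<star> C0 \<star> T z = ?t w0 + (\<Sum>u\<in>FW - {w0}. ?t u)"
    unfolding T_C0_T[OF v(1) z] by (rule sum.remove[OF finite_FW w0_props(1)])
  moreover have "?t w0 = T (v \<cdot> w0 \<cdot> z)"
  proof -
    \<comment> \<open>At \<open>u = w0\<close> the general bound leaves room for no direction, so
      the product is reduced.\<close>
    have "card (Fdir v (w0 \<cdot> z)) = 0" using card_Fdir_le[OF v(1) z w0_props(1)] by simp
    then have "N v \<inter> N (ext_inv (w0 \<cdot> z)) = {}" using finite_Fdir by (simp add: Fdir_def finite_N)
    then show ?thesis using T_mult[of v "w0 \<cdot> z"] vE z by (simp add: E.m_assoc)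
  qed
  moreover have "(\<Sum>u\<in>FW - {w0}. ?t u) \<in> Ldeg (- 1)"
  proof (rule Ldeg_sum)
    fix u assume u: "u \<in> FW - {w0}"
    have "T v \<star> T (u \<cdot> z) \<in> Ldeg (int (card (Fdir v (u \<cdot> z))))"
      using T_mult_degree vE z u FW_carrier by blast
    then have "T v \<star> T (u \<cdot> z) \<in> Ldeg (int (len w0) - int (len u) - 1)"
      by (rule Ldeg_mono) (use card_Fdir_less[OF v z, of u] u in simp)
    from Ldeg_smul[OF _ this, of "int (len u) - int (len w0)" "qhalf (int (len u) - int (len w0))"]
    show "?t u \<in> Ldeg (- 1)" by simp
  qed
  ultimately show ?thesis by simp
qed

lemma factorization:
  assumes v1: "v1 \<in> Mr" "primitive_elt D v1" and v2: "v2 \<in> EC" "ext_inv v2 \<in> Mr"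
  shows "KL D H (v1 \<cdot> w0 \<cdot> v2) = parKL v1 \<star> C0 \<star> iota (parKL (ext_inv v2))"
proof (rule KL_eqI)
  define p r where "p = parKL v1" and "r = iota (parKL (ext_inv v2))"
  have HC: "p \<in> HC" "r \<in> HC" using v1 v2 by (simp_all add: p_def r_def)
  have "C0 \<star> r = iota (parKL (ext_inv v2) \<star> C0)"
    using v2 by (simp add: r_def iota_mult iota_C0)
  then have bar_right: "bar (C0 \<star> r) = C0 \<star> r"
    using v2 by (simp add: bar_iota parKL(3))
  \<comment> \<open>The two invariances are used in different bracketings:
    \<open>p \<star> C0\<close> is fixed first, and then the fixed \<open>C0\<close> is regrouped
    with \<open>bar r\<close>.\<close>
  have "bar (p \<star> C0 \<star> r) = (p \<star> C0) \<star> bar r"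
    using bar_mult[of "p \<star> C0" r] HC parKL(3)[OF v1(1)] by (simp add: p_def[symmetric])
  also have "\<dots> = p \<star> bar (C0 \<star> r)" using HC by (simp add: H.m_assoc bar_mult bar_C0)
  also have "\<dots> = p \<star> C0 \<star> r" using HC by (simp add: bar_right H.m_assoc)
  finally show "bar (parKL v1 \<star> C0 \<star> iota (parKL (ext_inv v2))) = parKL v1 \<star> C0 \<star> iota (parKL (ext_inv v2))"
    by (simp add: p_def r_def)
  show "parKL v1 \<star> C0 \<star> iota (parKL (ext_inv v2)) \<in> HC" using HC by (simp add: p_def r_def)
  \<comment> \<open>Every term involving \<open>p'\<close> or \<open>r'\<close> has a coefficient of
    negative degree times a product in the lattice. Only the product of the leading terms
    \<open>T v1\<close>, \<open>C0\<close> and \<open>T v2\<close> calls for primitivity.\<close>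
  define p' r' where "p' = p - T v1" and "r' = r - T v2"
  note v1E = Mr_carrier[OF v1(1)]
  have p': "p' \<in> Ldeg (- 1)" "p' \<in> Sp Mr"
    using parKL(2)[OF v1(1)] Sp_mono[OF parKL(1)[OF v1(1)], of Mr] by (auto simp: p'_def p_def)
  have r'_eq: "r' = iota (parKL (ext_inv v2) - T (ext_inv v2))"
    using v2 by (simp add: r'_def r_def iota_diff)
  have r': "r' \<in> Ldeg (- 1)" unfolding r'_eq by (intro iota_Ldeg parKL(2) v2)
  have r'_ks: "z \<in> EC \<and> ext_inv z \<in> Mr" if z: "z \<in> ks r'" for z
  proof -
    have zE: "z \<in> EC" using z r' by (auto simp: Ldeg_def HC_iff)
    have "parKL (ext_inv v2) - T (ext_inv v2) \<in> HC" using v2 by simp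
    then have "ext_inv z \<in> ks (parKL (ext_inv v2) - T (ext_inv v2))"
      using z zE unfolding r'_eq by (simp add: in_keys_iff lookup_iota)
    then show ?thesis using zE parKL(1)[OF v2(2)] by (auto simp: Sp_def)
  qed
  have p'_ks: "x \<in> Mr \<and> x \<in> EC" if "x \<in> ks p'" for x
    using that p'(2) Mr_carrier unfolding Sp_def by blast
  have HC': "p' \<in> HC" "r' \<in> HC" using p' r' Ldeg_HC by blast+
  have right: "T x \<star> C0 \<star> r' \<in> Ldeg (- 1)" if x: "x \<in> Mr" for x
  proof -
    have "T x \<star> C0 \<star> r' = (\<Sum>z\<in>ks r'. lk r' z \<odot>\<^sub>A (T x \<star> C0 \<star> T z))"
      by (subst hecke_expansion[OF finite_keys order_refl, of r']) (simp add: mult_sum r'_ks Mr_carrier[OF x])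
    also have "\<dots> \<in> Ldeg (- 1)"
    proof (rule Ldeg_sum)
      fix z assume z: "z \<in> ks r'"
      have "T x \<star> C0 \<star> T z \<in> Ldeg 0" using T_C0_T_Ldeg[OF x] r'_ks[OF z] by blast
      from Ldeg_smul[OF Ldeg_lookup[OF r'] this]
      show "lk r' z \<odot>\<^sub>A (T x \<star> C0 \<star> T z) \<in> Ldeg (- 1)" by simp
    qed
    finally show ?thesis .
  qed
  have rsplit: "r = r' + T v2" by (simp add: r'_def)
  have "p' \<star> C0 \<star> r \<in> Ldeg (- 1)"
  proof -
    have "p' \<star> C0 \<star> r = (\<Sum>x\<in>ks p'. lk p' x \<odot>\<^sub>A (T x \<star> C0 \<star> r))"
      using HC by (subst Sp_expansion[OF p'(2)]) (simp add: mult_sum p'_ks)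
    also have "\<dots> \<in> Ldeg (- 1)"
    proof (rule Ldeg_sum)
      fix x assume x: "x \<in> ks p'"
      then have xM: "x \<in> Mr" "x \<in> EC" using p'_ks by blast+
      have "T x \<star> C0 \<star> r = T x \<star> C0 \<star> r' + T x \<star> C0 \<star> T v2"
        unfolding rsplit using xM HC' v2 by (simp add: mult_distrib)
      also have "\<dots> \<in> Ldeg 0"
        using Ldeg_add[OF Ldeg_mono[OF right[OF xM(1)]] T_C0_T_Ldeg[OF xM(1) v2]] by simp
      finally have "T x \<star> C0 \<star> r \<in> Ldeg 0" .
      from Ldeg_smul[OF Ldeg_lookup[OF p'(1)] this]
      show "lk p' x \<odot>\<^sub>A (T x \<star> C0 \<star> r) \<in> Ldeg (- 1)" by simp
    qed
    finally show ?thesis .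
  qed
  moreover have "T v1 \<star> C0 \<star> r - T (v1 \<cdot> w0 \<cdot> v2) \<in> Ldeg (- 1)"
  proof -
    have "T v1 \<star> C0 \<star> r = T v1 \<star> C0 \<star> r' + T v1 \<star> C0 \<star> T v2"
      unfolding rsplit using v1E HC' v2 by (simp add: mult_distrib)
    then show ?thesis
      using Ldeg_add[OF right[OF v1(1)] T_C0_T_primitive[OF v1 v2]] by (simp add: add_diff_eq)
  qed
  moreover have "p \<star> C0 \<star> r = p' \<star> C0 \<star> r + T v1 \<star> C0 \<star> r"
    using HC v1E by (simp add: p'_def mult_distrib)
  ultimately have "p \<star> C0 \<star> r - T (v1 \<cdot> w0 \<cdot> v2) \<in> Ldeg (- 1)"
    using Ldeg_add by (simp add: add_diff_eq[symmetric])
  then show "parKL v1 \<star> C0 \<star> iota (parKL (ext_inv v2)) - T (v1 \<cdot> w0 \<cdot> v2) \<in> Ldeg (- 1)"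
    by (simp add: p_def r_def)
qed

end

theorem theorem4p1:
  fixes D :: "'y::ab_group_add root_datum"
    and H :: "'y hecke_elt ring"
    and v1 v2 :: "'y weyl_elt"
  assumes "finite_root_datum D"
    and "irreducible_datum D"
    and "simply_connected D"
    and "hecke_algebra D H"
    and "v1 \<in> carrier (ext_weyl D)"
    and "v2 \<in> carrier (ext_weyl D)"
    and "reduced_product D v1 (longest_elt D)"
    and "reduced_product D (longest_elt D) v2"
    and "primitive_elt D v1"
  shows "KL D H (v1 \<otimes>\<^bsub>ext_weyl D\<^esub> longest_elt D \<otimes>\<^bsub>ext_weyl D\<^esub> v2) =
    KL_left D H v1 \<otimes>\<^bsub>H\<^esub> KL D H (longest_elt D) \<otimes>\<^bsub>H\<^esub> KL_right D H v2"
proof -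
  interpret hecke_datum D H
    by unfold_locales (fact assms(1-4))+
  have v1: "v1 \<in> Mr" and v2: "ext_inv v2 \<in> Mr"
    using assms(5-8) reduced_w0_iff reduced_w0_left_iff by blast+
  show ?thesis
    using factorization[OF v1 assms(9,6) v2] KL_left_eq[OF v1] KL_right_eq[OF assms(6) v2] KL_w0 by simp
qed

end
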